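(* For every $\varepsilon>0$ there exists $n_0=n_0(\varepsilon)$ such that for every integer $n\ge n_0$ there exists a triangle-free graph $G$ on $n$ vertices with independence number \[ \alpha(G)<(1+\varepsilon)\sqrt{n\log n}. \]
   Context: $\alpha(G)$ denotes the maximum size of an independent set of vertices of the graph $G$. The logarithm is natural. *)

theory Defs
  imports Complex_Main "HOL-Library.Ramsey"
begin

text \<open>Edges are two-element vertex sets, the encoding that \<^const>\<open>clique\<close> and
  \<^const>\<open>indep\<close> assume; both quantify over distinct vertices only.\<close>

definition simple_graph :: "'a set \<Rightarrow> 'a set set \<Rightarrow> bool" where
  "simple_graph V E \<longleftrightarrow> finite V \<and> E \<subseteq> [V]\<^bsup>2\<^esup>"

definition triangle_free :: "'a set \<Rightarrow> 'a set set \<Rightarrow> bool" where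
  "triangle_free V E \<longleftrightarrow> \<not> (\<exists>T\<subseteq>V. card T = 3 \<and> clique T E)"

definition independence_number :: "'a set \<Rightarrow> 'a set set \<Rightarrow> nat" where
  "independence_number V E = Max (card ` {S. S \<subseteq> V \<and> indep S E})"

end

theory Submission
  imports Defs "HOL-Library.FuncSet" "HOL-Real_Asymp.Real_Asymp"
begin

text \<open>Let \<open>N = n\<^sup>1\<^sup>-\<^sup>\<delta>\<close>. Take two independent random graphs of density
  \<open>q = sqrt (ln n / n) / 2\<close> on \<open>N\<close> vertices, the two colours, and blow them up along independent
  random maps from \<open>n\<close> to \<open>N\<close> vertices. Keep an edge if its endpoints have no common neighbour in
  either colour. Two of the three edges of a triangle share a colour and thereby close the third one,
  so the graph is triangle-free.

  The codegrees \<open>N q\<^sup>2\<close> tend to zero, so few edges are lost. For a set \<open>I\<close> of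
  \<open>k = (1 + \<epsilon>) sqrt (n ln n)\<close> vertices, pairs closed by vertices with small neighbourhoods in
  \<open>I\<close> carry only \<open>O(k)\<close> edges, which does not affect the exponent. The few remaining heavy vertices
  are summed over. Measured in units of \<open>(k / 2) ln n\<close>, the union bound over \<open>I\<close> costs \<open>1\<close>. A
  projection of relative size \<open>\<rho>\<close> contributes \<open>1 - \<rho>\<close> for its collisions and about
  \<open>\<rho>\<^sup>2 / 2\<close> for the missing edges. Without heavy vertices the bound is therefore the
  inequality \<open>(1 - \<rho>) + \<rho>\<^sup>2 / 2 \<ge> 1 / 2\<close> in each colour. Pairs lost to heavy vertices are paid
  for by the additional collisions or edges that put large parts of \<open>I\<close> into their neighbourhoods.\<close>

subsection \<open>Random subsets and random functions\<close>

text \<open>The density is pinned from two sides. A vertex gets about \<open>n q\<close> neighbours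
  per colour, and its neighbourhood is independent by triangle-freeness, so \<open>2 n q\<close>
  must not exceed \<open>sqrt (n ln n)\<close>. A set of \<open>k\<close> vertices must expect about
  \<open>q k^2\<close> edges, at least the entropy \<open>(k / 2) ln n\<close>. The chosen
  \<open>q\<close> meets both demands at once, so nothing of leading order may be lost. On
  \<open>n\<close> vertices this \<open>q\<close> would give codegrees of order \<open>ln n\<close>
  and most edges would be closed; this is why the graphs live on fewer vertices, at the price of
  colliding projections. The obstacle is dependence: an edge inside a set survives or not according
  to other random edges, possibly inside the same projection and in either colour. For light
  vertices, a constant fraction of the closed edges is selected whose closing edges lie outside the
  selection, so that being present and being closed become independent. For heavy vertices, only
  their edges into the projections are revealed. Given such a certificate, the set of pairs not
  closed by heavy vertices is fixed and its unrevealed pairs are still fresh.\<close>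

definition rs_exp :: "real \<Rightarrow> 'a set \<Rightarrow> ('a set \<Rightarrow> real) \<Rightarrow> real" where
  "rs_exp q P f = (\<Sum>E\<in>Pow P. q ^ card E * (1 - q) ^ card (P - E) * f E)"

lemma rs_exp_empty [simp]: "rs_exp q {} f = f {}"
  by (simp add: rs_exp_def)

lemma rs_exp_insert:
  assumes "finite P" "x \<notin> P"
  shows "rs_exp q (insert x P) f = q * rs_exp q P (\<lambda>E. f (insert x E)) + (1 - q) * rs_exp q P f"
proof -
  have inj: "inj_on (insert x) (Pow P)"
    using assms by (auto simp: inj_on_def)
  have disj: "Pow P \<inter> insert x ` Pow P = {}"
    using assms by auto
  have a: "q ^ card (insert x E) * (1 - q) ^ card (insert x P - insert x E) * f (insert x E)
      = q * (q ^ card E * (1 - q) ^ card (P - E) * f (insert x E))" if "E \<in> Pow P" for E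
  proof -
    have "finite E" "x \<notin> E" using that assms finite_subset by auto
    moreover have "insert x P - insert x E = P - E" using assms by auto
    ultimately show ?thesis by simp
  qed
  have b: "q ^ card E * (1 - q) ^ card (insert x P - E) * f E
      = (1 - q) * (q ^ card E * (1 - q) ^ card (P - E) * f E)" if "E \<in> Pow P" for E
  proof -
    have "insert x P - E = insert x (P - E)" using assms that by auto
    thus ?thesis using assms by simp
  qed
  have "rs_exp q (insert x P) f
     = (\<Sum>E\<in>Pow P. q ^ card E * (1 - q) ^ card (insert x P - E) * f E)
     + (\<Sum>E\<in>Pow P. q ^ card (insert x E) * (1 - q) ^ card (insert x P - insert x E) * f (insert x E))"
    unfolding rs_exp_def Pow_insert
    using assms disj by (subst sum.union_disjoint) (auto simp: sum.reindex[OF inj])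
  also have "\<dots> = (1 - q) * rs_exp q P f + q * rs_exp q P (\<lambda>E. f (insert x E))"
    unfolding rs_exp_def sum_distrib_left
    by (intro arg_cong2[of _ _ _ _ "(+)"] sum.cong refl a b)
  finally show ?thesis by simp
qed

lemma rs_exp_mono:
  assumes "0 \<le> q" "q \<le> 1" "\<And>E. E \<subseteq> P \<Longrightarrow> f E \<le> g E"
  shows "rs_exp q P f \<le> rs_exp q P g"
  unfolding rs_exp_def using assms by (intro sum_mono mult_left_mono) auto

lemma rs_exp_nonneg:
  assumes "0 \<le> q" "q \<le> 1" "\<And>E. E \<subseteq> P \<Longrightarrow> 0 \<le> f E"
  shows "0 \<le> rs_exp q P f"
  unfolding rs_exp_def using assms by (intro sum_nonneg mult_nonneg_nonneg) auto

lemma rs_exp_cong: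
  assumes "\<And>E. E \<subseteq> P \<Longrightarrow> f E = g E"
  shows "rs_exp q P f = rs_exp q P g"
  unfolding rs_exp_def using assms by (intro sum.cong) auto

lemma rs_exp_add: "rs_exp q P (\<lambda>E. f E + g E) = rs_exp q P f + rs_exp q P g"
  by (simp add: rs_exp_def sum.distrib algebra_simps)

lemma rs_exp_cmult: "rs_exp q P (\<lambda>E. c * f E) = c * rs_exp q P f"
  by (simp add: rs_exp_def sum_distrib_left algebra_simps)

lemma rs_exp_sum: "rs_exp q P (\<lambda>E. \<Sum>i\<in>S. f i E) = (\<Sum>i\<in>S. rs_exp q P (f i))"
  unfolding rs_exp_def sum_distrib_left by (rule sum.swap)

lemma rs_exp_const [simp]: "finite P \<Longrightarrow> rs_exp q P (\<lambda>_. c) = c"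
  by (induction P rule: finite_induct) (auto simp: rs_exp_insert algebra_simps)

text \<open>A random subset of a disjoint union is a pair of independent random subsets. Locality,
  conditioning on \<open>A \<subseteq> E\<close>, conditioning on missing \<open>A\<close>, and
  independence of disjoint blocks are all read off from this identity.\<close>

lemma rs_exp_union:
  assumes "finite A" "finite B" "A \<inter> B = {}"
  shows "rs_exp q (A \<union> B) f = rs_exp q A (\<lambda>X. rs_exp q B (\<lambda>Y. f (X \<union> Y)))"
  using assms(1,3)
proof (induction A arbitrary: f rule: finite_induct)
  case empty
  thus ?case by simp
next
  case (insert x A)
  thus ?case using assms(2) by (simp add: rs_exp_insert)
qed

lemma rs_exp_power_card:
  "finite B \<Longrightarrow> rs_exp q B (\<lambda>E. Z ^ card E) = (1 - q + q * Z) ^ card B"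
proof (induction B rule: finite_induct)
  case (insert x B)
  have "rs_exp q B (\<lambda>E. Z ^ card (insert x E)) = rs_exp q B (\<lambda>E. Z * Z ^ card E)"
    using insert finite_subset by (intro rs_exp_cong) (fastforce simp: card_insert_if)
  thus ?case using insert by (simp add: rs_exp_insert rs_exp_cmult algebra_simps)
qed simp

lemma rs_exp_local:
  assumes "finite P" "B \<subseteq> P"
  shows "rs_exp q P (\<lambda>E. g (E \<inter> B)) = rs_exp q B g"
proof -
  have *: "finite B" using assms finite_subset by auto
  have "rs_exp q (B \<union> (P - B)) (\<lambda>E. g (E \<inter> B))
      = rs_exp q B (\<lambda>X. rs_exp q (P - B) (\<lambda>Y. g X))"
  proof (subst rs_exp_union)
    show "rs_exp q B (\<lambda>X. rs_exp q (P - B) (\<lambda>Y. g ((X \<union> Y) \<inter> B))) =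
          rs_exp q B (\<lambda>X. rs_exp q (P - B) (\<lambda>Y. g X))"
      by (intro rs_exp_cong arg_cong[of _ _ g]) auto
  qed (use assms * in auto)
  moreover have "B \<union> (P - B) = P" using assms by auto
  ultimately show ?thesis using assms by simp
qed

lemma rs_exp_mgf:
  assumes "finite P" "B \<subseteq> P"
  shows "rs_exp q P (\<lambda>E. Z ^ card (E \<inter> B)) = (1 - q + q * Z) ^ card B"
  using rs_exp_local[OF assms, of q "\<lambda>X. Z ^ card X"] rs_exp_power_card[of B q Z] assms finite_subset
  by auto

lemma rs_exp_contains:
  assumes "finite P" "A \<subseteq> P"
  shows "rs_exp q P (\<lambda>E. of_bool (A \<subseteq> E) * g (E - A)) = q ^ card A * rs_exp q (P - A) g"
proof -
  have fA: "finite A" using assms finite_subset by auto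
  have "rs_exp q (A \<union> (P - A)) (\<lambda>E. of_bool (A \<subseteq> E) * g (E - A))
      = rs_exp q A (\<lambda>X. rs_exp q (P - A) (\<lambda>Y. of_bool (A \<subseteq> X) * g Y))"
  proof (subst rs_exp_union)
    show "rs_exp q A (\<lambda>X. rs_exp q (P - A) (\<lambda>Y. of_bool (A \<subseteq> X \<union> Y) * g (X \<union> Y - A))) =
          rs_exp q A (\<lambda>X. rs_exp q (P - A) (\<lambda>Y. of_bool (A \<subseteq> X) * g Y))"
    proof (intro rs_exp_cong)
      fix X Y assume "X \<subseteq> A" "Y \<subseteq> P - A"
      hence "X \<union> Y - A = Y" "A \<subseteq> X \<union> Y \<longleftrightarrow> A \<subseteq> X" by auto
      thus "of_bool (A \<subseteq> X \<union> Y) * g (X \<union> Y - A) = of_bool (A \<subseteq> X) * g Y" by simp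
    qed
  qed (use assms fA in auto)
  also have "\<dots> = rs_exp q A (\<lambda>X. of_bool (A \<subseteq> X) * rs_exp q (P - A) g)"
    by (simp add: rs_exp_cmult)
  also have "\<dots> = (\<Sum>E\<in>{A}. q ^ card E * (1 - q) ^ card (A - E) * (of_bool (A \<subseteq> E) * rs_exp q (P - A) g))"
    unfolding rs_exp_def[of q A] using fA by (intro sum.mono_neutral_right) auto
  finally show ?thesis using assms by (simp add: Un_absorb1)
qed

text \<open>Restricting to \<open>P - A\<close> is conditioning on missing \<open>A\<close>, an
  event of probability \<open>(1 - q) ^ card A\<close>; for nonnegative \<open>g\<close> this costs
  at most the inverse of that probability.\<close>

lemma rs_exp_remove_le:
  assumes "finite P" "A \<subseteq> P" "0 \<le> q" "q < 1" "\<And>E. E \<subseteq> P \<Longrightarrow> 0 \<le> g E"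
  shows "rs_exp q (P - A) g \<le> (1 / (1 - q)) ^ card A * rs_exp q P g"
proof -
  have fA: "finite A" using assms finite_subset by auto
  have PA: "A \<union> (P - A) = P" using assms by auto
  have nn: "0 \<le> rs_exp q (P - A) (\<lambda>Y. g (X \<union> Y))" if "X \<subseteq> A" for X
    using assms(2-4) that by (intro rs_exp_nonneg assms(5)) auto
  have "(1 - q) ^ card A * rs_exp q (P - A) g
      = (\<Sum>E\<in>{{}}. q ^ card E * (1 - q) ^ card (A - E) * rs_exp q (P - A) (\<lambda>Y. g (E \<union> Y)))"
    by simp
  also have "\<dots> \<le> rs_exp q A (\<lambda>X. rs_exp q (P - A) (\<lambda>Y. g (X \<union> Y)))"
    unfolding rs_exp_def[of q A] using fA assms nn by (intro sum_mono2) auto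
  also have "\<dots> = rs_exp q P g"
    using rs_exp_union[of A "P - A" q g] assms fA PA by auto
  finally show ?thesis using assms by (simp add: field_simps)
qed

lemma rs_exp_prod:
  assumes "finite S" "finite P" "\<And>v. v \<in> S \<Longrightarrow> B v \<subseteq> P"
    "\<And>v w. v \<in> S \<Longrightarrow> w \<in> S \<Longrightarrow> v \<noteq> w \<Longrightarrow> B v \<inter> B w = {}"
  shows "rs_exp q P (\<lambda>E. \<Prod>v\<in>S. F v (E \<inter> B v)) = (\<Prod>v\<in>S. rs_exp q (B v) (F v))"
  using assms
proof (induction S arbitrary: P rule: finite_induct)
  case empty
  thus ?case by simp
next
  case (insert x S)
  have fB: "finite (B x)" using insert finite_subset by (meson insertI1)
  have PB: "B x \<union> (P - B x) = P" using insert by auto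
  have "rs_exp q (B x \<union> (P - B x)) (\<lambda>E. \<Prod>v\<in>insert x S. F v (E \<inter> B v))
     = rs_exp q (B x) (\<lambda>X. rs_exp q (P - B x) (\<lambda>Y. F x X * (\<Prod>v\<in>S. F v (Y \<inter> B v))))"
  proof (subst rs_exp_union)
    show "rs_exp q (B x) (\<lambda>X. rs_exp q (P - B x) (\<lambda>Y. \<Prod>v\<in>insert x S. F v ((X \<union> Y) \<inter> B v))) =
      rs_exp q (B x) (\<lambda>X. rs_exp q (P - B x) (\<lambda>Y. F x X * (\<Prod>v\<in>S. F v (Y \<inter> B v))))"
    proof (intro rs_exp_cong)
      fix X Y assume X: "X \<subseteq> B x" and Y: "Y \<subseteq> P - B x"
      have "(X \<union> Y) \<inter> B x = X" using X Y by auto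
      moreover have "(X \<union> Y) \<inter> B v = Y \<inter> B v" if "v \<in> S" for v
        using X insert.prems(3)[of x v] insert.hyps that by auto
      ultimately show "(\<Prod>v\<in>insert x S. F v ((X \<union> Y) \<inter> B v)) = F x X * (\<Prod>v\<in>S. F v (Y \<inter> B v))"
        using insert.hyps by simp
    qed
  qed (use insert fB in auto)
  also have "\<dots> = rs_exp q (B x) (\<lambda>X. F x X * (\<Prod>v\<in>S. rs_exp q (B v) (F v)))"
  proof -
    have "rs_exp q (P - B x) (\<lambda>Y. \<Prod>v\<in>S. F v (Y \<inter> B v)) = (\<Prod>v\<in>S. rs_exp q (B v) (F v))"
    proof (rule insert.IH)
      fix v assume v: "v \<in> S"
      hence "B v \<inter> B x = {}" using insert.prems(3)[of v x] insert.hyps by auto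
      thus "B v \<subseteq> P - B x" using insert.prems(2)[of v] v by auto
    qed (use insert.prems in auto)
    thus ?thesis by (simp add: rs_exp_cmult)
  qed
  also have "\<dots> = (\<Prod>v\<in>S. rs_exp q (B v) (F v)) * rs_exp q (B x) (F x)"
    by (subst rs_exp_cmult[symmetric]) (simp add: mult.commute)
  finally show ?case using PB insert.hyps by (simp add: mult.commute)
qed

text \<open>Markov's inequality for \<open>Z ^ card (E \<inter> B)\<close>. The base
  \<open>Z\<close> stays free: near \<open>1\<close> it gives sharp concentration, as a small power
  of \<open>n\<close> it gives bounds that beat the number of \<open>k\<close>-sets.\<close>

lemma rs_exp_upper_tail:
  assumes "finite P" "B \<subseteq> P" "0 \<le> q" "q \<le> 1" "1 \<le> Z"
  shows "rs_exp q P (\<lambda>E. of_bool (real (card (E \<inter> B)) \<ge> a))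
    \<le> Z powr (- a) * (1 - q + q * Z) ^ card B"
proof -
  have "rs_exp q P (\<lambda>E. of_bool (real (card (E \<inter> B)) \<ge> a))
      \<le> rs_exp q P (\<lambda>E. Z powr (- a) * Z ^ card (E \<inter> B))"
  proof (rule rs_exp_mono)
    fix E
    show "of_bool (real (card (E \<inter> B)) \<ge> a) \<le> Z powr (- a) * Z ^ card (E \<inter> B)"
      using assms(5) ge_one_powr_ge_zero[of Z "real (card (E \<inter> B)) - a"]
      by (auto simp: powr_realpow[symmetric] powr_add[symmetric])
  qed (use assms in auto)
  also have "\<dots> = Z powr (- a) * (1 - q + q * Z) ^ card B"
    using assms by (simp add: rs_exp_cmult rs_exp_mgf)
  finally show ?thesis .
qed

lemma rs_exp_lower_tail:
  assumes "finite P" "B \<subseteq> P" "0 \<le> q" "q \<le> 1" "0 < z" "z \<le> 1"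
  shows "rs_exp q P (\<lambda>E. of_bool (real (card (E \<inter> B)) \<le> a))
    \<le> z powr (- a) * (1 - q + q * z) ^ card B"
proof -
  have "rs_exp q P (\<lambda>E. of_bool (real (card (E \<inter> B)) \<le> a))
      \<le> rs_exp q P (\<lambda>E. z powr (- a) * z ^ card (E \<inter> B))"
  proof (rule rs_exp_mono)
    fix E
    show "of_bool (real (card (E \<inter> B)) \<le> a) \<le> z powr (- a) * z ^ card (E \<inter> B)"
      using assms(5,6) powr_mono'[of "real (card (E \<inter> B)) - a" 0 z]
      by (auto simp: powr_realpow[symmetric] powr_add[symmetric])
  qed (use assms in auto)
  also have "\<dots> = z powr (- a) * (1 - q + q * z) ^ card B"
    using assms by (simp add: rs_exp_cmult rs_exp_mgf)
  finally show ?thesis .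
qed

lemma rs_exp_union_bound:
  assumes "0 \<le> q" "q \<le> 1" "finite S" "\<And>E. E \<subseteq> P \<Longrightarrow> Q E \<Longrightarrow> \<exists>s\<in>S. W s E"
  shows "rs_exp q P (\<lambda>E. of_bool (Q E)) \<le> (\<Sum>s\<in>S. rs_exp q P (\<lambda>E. of_bool (W s E)))"
  unfolding rs_exp_sum[symmetric]
proof (intro rs_exp_mono assms(1,2))
  fix E assume "E \<subseteq> P"
  show "of_bool (Q E) \<le> (\<Sum>s\<in>S. of_bool (W s E) :: real)"
  proof (cases "Q E")
    case True
    then obtain s where s: "s \<in> S" "W s E" using assms(4) \<open>E \<subseteq> P\<close> by blast
    have "of_bool (W s E) \<le> (\<Sum>s\<in>S. of_bool (W s E) :: real)"
      using s assms(3) by (intro member_le_sum) auto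
    thus ?thesis using True s by (simp only: of_bool_eq)
  qed (auto intro: sum_nonneg)
qed

lemma sum_Pow_power_card:
  fixes y :: real
  shows "finite B \<Longrightarrow> (\<Sum>S\<in>Pow B. y ^ card S) = (1 + y) ^ card B"
proof (induction B rule: finite_induct)
  case (insert x B)
  have inj: "inj_on (insert x) (Pow B)" using insert by (auto simp: inj_on_def)
  have "(\<Sum>S\<in>Pow (insert x B). y ^ card S) = (\<Sum>S\<in>Pow B. y ^ card S) + (\<Sum>S\<in>Pow B. y ^ card (insert x S))"
    unfolding Pow_insert using insert by (subst sum.union_disjoint) (auto simp: sum.reindex[OF inj])
  also have "(\<Sum>S\<in>Pow B. y ^ card (insert x S)) = y * (\<Sum>S\<in>Pow B. y ^ card S)"
    unfolding sum_distrib_left using insert finite_subset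
    by (intro sum.cong) (fastforce simp: card_insert_if)+
  finally show ?case using insert by (simp add: algebra_simps)
qed simp

section \<open>Averages over uniformly random functions\<close>

definition rf_avg :: "nat \<Rightarrow> 'a set \<Rightarrow> (('a \<Rightarrow> nat) \<Rightarrow> real) \<Rightarrow> real" where
  "rf_avg N D f = (\<Sum>g\<in>D \<rightarrow>\<^sub>E {..<N}. f g) / real N ^ card D"

lemma rf_avg_empty [simp]: "rf_avg N {} f = f (\<lambda>_. undefined)"
  by (simp add: rf_avg_def)

lemma rf_avg_insert:
  assumes "finite D" "x \<notin> D"
  shows "rf_avg N (insert x D) f = rf_avg N D (\<lambda>g. (\<Sum>u<N. f (g(x := u))) / real N)"
proof -
  have "(\<Sum>g\<in>insert x D \<rightarrow>\<^sub>E {..<N}. f g) = (\<Sum>(u, g)\<in>{..<N} \<times> (D \<rightarrow>\<^sub>E {..<N}). f (g(x := u)))"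
    unfolding PiE_insert_eq
    by (subst sum.reindex) (auto intro!: inj_combinator[OF assms(2)] sum.cong)
  also have "\<dots> = (\<Sum>g\<in>D \<rightarrow>\<^sub>E {..<N}. \<Sum>u<N. f (g(x := u)))"
    by (subst sum.swap) (simp add: sum.cartesian_product)
  finally show ?thesis
    unfolding rf_avg_def using assms
    by (simp add: sum_divide_distrib[symmetric] divide_simps)
qed

lemma rf_avg_mono:
  assumes "\<And>g. g \<in> D \<rightarrow>\<^sub>E {..<N} \<Longrightarrow> f g \<le> f' g"
  shows "rf_avg N D f \<le> rf_avg N D f'"
  unfolding rf_avg_def using assms by (intro divide_right_mono sum_mono) auto

lemma rf_avg_add: "rf_avg N D (\<lambda>g. f g + f' g) = rf_avg N D f + rf_avg N D f'"
  by (simp add: rf_avg_def sum.distrib add_divide_distrib)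

lemma rf_avg_cmult: "rf_avg N D (\<lambda>g. c * f g) = c * rf_avg N D f"
  by (simp add: rf_avg_def sum_distrib_left)

lemma rf_avg_sum: "rf_avg N D (\<lambda>g. \<Sum>i\<in>S. f i g) = (\<Sum>i\<in>S. rf_avg N D (f i))"
  unfolding rf_avg_def sum_divide_distrib[symmetric] by (subst sum.swap) simp

lemma rf_avg_const:
  assumes "finite D" "0 < N"
  shows "rf_avg N D (\<lambda>_. c) = c"
  using assms by (simp add: rf_avg_def card_PiE prod_constant)

lemma rf_avg_mgf:
  assumes "finite D" "0 < N" "J \<subseteq> D" "u < N"
  shows "rf_avg N D (\<lambda>g. Z ^ card {x\<in>J. g x = u}) = (1 + (Z - 1) / N) ^ card J"
  using assms(1,3)
proof (induction D arbitrary: J rule: finite_induct)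
  case empty
  thus ?case by simp
next
  case (insert d D)
  show ?case
  proof (cases "d \<in> J")
    case False
    hence *: "{x\<in>J. (g(d := w)) x = u} = {x\<in>J. g x = u}" for g :: "'a \<Rightarrow> nat" and w by auto
    have "J \<subseteq> D" using insert False by auto
    thus ?thesis unfolding rf_avg_insert[OF insert.hyps] *
      using insert.IH[of J] assms(2) by simp
  next
    case True
    define J' where "J' = J - {d}"
    have J: "J = insert d J'" "d \<notin> J'" "J' \<subseteq> D" using True insert by (auto simp: J'_def)
    have fJ: "finite J'" using J insert finite_subset by auto
    have *: "{x\<in>J. (g(d := w)) x = u} = (if w = u then insert d {x\<in>J'. g x = u} else {x\<in>J'. g x = u})"
      for g :: "'a \<Rightarrow> nat" and w using J by auto
    have "(\<Sum>w<N. Z ^ card {x\<in>J. (g(d := w)) x = u}) / N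
        = (1 + (Z - 1) / N) * Z ^ card {x\<in>J'. g x = u}" for g :: "'a \<Rightarrow> nat"
    proof -
      define a where "a = Z ^ card {x\<in>J'. g x = u}"
      have "Z ^ card {x\<in>J. (g(d := w)) x = u} = (if w = u then Z * a else a)" for w
        unfolding * a_def using J fJ by auto
      hence "(\<Sum>w<N. Z ^ card {x\<in>J. (g(d := w)) x = u}) = (\<Sum>w<N. a + (if w = u then (Z - 1) * a else 0))"
        by (intro sum.cong) (auto simp: algebra_simps)
      also have "\<dots> = N * a + (Z - 1) * a"
        using assms by (simp add: sum.distrib)
      finally show ?thesis using assms by (simp add: a_def field_simps)
    qed
    hence "rf_avg N (insert d D) (\<lambda>g. Z ^ card {x\<in>J. g x = u})
       = (1 + (Z - 1) / N) * rf_avg N D (\<lambda>g. Z ^ card {x\<in>J'. g x = u})"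
      unfolding rf_avg_insert[OF insert.hyps] by (simp only: rf_avg_cmult)
    thus ?thesis using insert.IH[OF J(3)] J fJ by simp
  qed
qed

text \<open>Revealing a random function one value at a time, a value collides with an earlier one
  with probability at most \<open>k / N\<close>, so weighting every collision by \<open>N / k\<close> costs at most
  a factor \<open>2\<close> per step.\<close>

lemma rf_avg_collisions:
  assumes "finite D" "0 < N" "0 < k" "J1 \<subseteq> D" "J2 \<subseteq> D" "J1 \<inter> J2 = {}" "card J1 \<le> k" "card J2 \<le> k"
  shows "rf_avg N D (\<lambda>g. (N / k) ^ (card J1 - card (g ` J1)) * (N / k) ^ (card J2 - card (g ` J2)))
    \<le> 2 ^ (card J1 + card J2)"
proof -
  define y where "y = real N / real k"
  have y: "0 < y" using assms by (simp add: y_def)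
  have step: "(\<Sum>w<N. y ^ (card (insert d J) - card ((g(d := w)) ` insert d J))) / N
      \<le> 2 * y ^ (card J - card (g ` J))"
    if "finite J" "d \<notin> J" "card (insert d J) \<le> k" for J :: "'a set" and d and g :: "'a \<Rightarrow> nat"
  proof -
    define m where "m = card J - card (g ` J)"
    have le: "card (g ` J) \<le> card J" using that card_image_le by auto
    have im: "(g(d := w)) ` insert d J = insert w (g ` J)" for w using that by auto
    have "(\<Sum>w<N. y ^ (card (insert d J) - card ((g(d := w)) ` insert d J)))
      \<le> (\<Sum>w<N. y ^ m + (if w \<in> g ` J then y * y ^ m else 0))"
    proof (intro sum_mono)
      fix w
      show "y ^ (card (insert d J) - card ((g(d := w)) ` insert d J))
          \<le> y ^ m + (if w \<in> g ` J then y * y ^ m else 0)"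
        unfolding im using that le y
        by (auto simp: card_insert_if m_def Suc_diff_le)
    qed
    also have "\<dots> = N * y ^ m + (\<Sum>w\<in>{..<N} \<inter> g ` J. y * y ^ m)"
      by (simp add: sum.distrib sum.If_cases)
    also have "\<dots> = N * y ^ m + card ({..<N} \<inter> g ` J) * (y * y ^ m)" by simp
    also have "\<dots> \<le> N * y ^ m + k * (y * y ^ m)"
    proof -
      have "card ({..<N} \<inter> g ` J) \<le> card (g ` J)" using that by (intro card_mono) auto
      also have "\<dots> \<le> k" using le that by simp
      finally show ?thesis using y by (intro add_left_mono mult_right_mono) auto
    qed
    also have "\<dots> = 2 * N * y ^ m" using assms by (simp add: y_def)
    finally show ?thesis using assms by (simp add: m_def field_simps)
  qed
  define w where "w J g = y ^ (card J - card (g ` J))" for J :: "'a set" and g :: "'a \<Rightarrow> nat"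
  \<comment> \<open>Disjointness lets the two weights be charged separately: a new value at
    \<open>d\<close> changes only one of them. Later the two sets are the copies of one vertex set
    in the two colours.\<close>
  have one: "rf_avg N (insert d D) (\<lambda>g. w (insert d J) g * w J' g) \<le> 2 * rf_avg N D (\<lambda>g. w J g * w J' g)"
    if "finite D" "d \<notin> D" "finite J" "d \<notin> J" "d \<notin> J'" "card (insert d J) \<le> k" for D J J' :: "'a set" and d
    unfolding rf_avg_insert[OF that(1,2)] rf_avg_cmult[symmetric]
  proof (rule rf_avg_mono)
    fix g :: "'a \<Rightarrow> nat"
    have "w J' (g(d := u)) = w J' g" for u
    proof -
      have "(g(d := u)) ` J' = g ` J'" using that by auto
      thus ?thesis by (simp add: w_def)
    qed
    hence "(\<Sum>u<N. w (insert d J) (g(d := u)) * w J' (g(d := u))) / N = ((\<Sum>u<N. w (insert d J) (g(d := u))) / N) * w J' g"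
      by (simp add: sum_distrib_right)
    also have "\<dots> \<le> 2 * w J g * w J' g"
      unfolding w_def using step[OF that(3,4,6)] y by (intro mult_right_mono) auto
    finally show "(\<Sum>u<N. w (insert d J) (g(d := u)) * w J' (g(d := u))) / N \<le> 2 * (w J g * w J' g)" by simp
  qed
  have "rf_avg N D (\<lambda>g. w J1 g * w J2 g) \<le> 2 ^ (card J1 + card J2)"
    using assms(1,4-)
  proof (induction D arbitrary: J1 J2 rule: finite_induct)
    case empty
    thus ?case by (simp add: w_def)
  next
    case (insert d D)
    have fJ: "finite J1" "finite J2" using insert.prems insert.hyps by (meson finite.insertI finite_subset)+
    have swap: "w J1 g * w J2 g = w J2 g * w J1 g" for J1 J2 g by simp
    have half: "rf_avg N (insert d D) (\<lambda>g. w X g * w X' g) \<le> 2 ^ (card X + card X')"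
      if X: "d \<in> X" "finite X" "X \<subseteq> insert d D" "X' \<subseteq> insert d D" "X \<inter> X' = {}" "card X \<le> k" "card X' \<le> k" for X X'
    proof -
      define J where "J = X - {d}"
      have J: "X = insert d J" "d \<notin> J" "J \<subseteq> D" "finite J" "d \<notin> X'" "X' \<subseteq> D" "J \<inter> X' = {}"
        using X by (auto simp: J_def)
      have "rf_avg N (insert d D) (\<lambda>g. w X g * w X' g) \<le> 2 * rf_avg N D (\<lambda>g. w J g * w X' g)"
        unfolding J(1) using J X insert.hyps by (intro one) auto
      also have "\<dots> \<le> 2 * 2 ^ (card J + card X')"
        using insert.IH[OF J(3,6,7)] X J by auto
      finally show ?thesis using J by simp
    qed
    consider (0) "d \<notin> J1" "d \<notin> J2" | (1) "d \<in> J1" | (2) "d \<in> J2" by blast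
    thus ?case
    proof cases
      case 0
      hence *: "(g(d := u)) ` J1 = g ` J1" "(g(d := u)) ` J2 = g ` J2" for g :: "'a \<Rightarrow> nat" and u by auto
      show ?thesis unfolding rf_avg_insert[OF insert.hyps] w_def *
        using insert.IH[of J1 J2] insert.prems 0 assms(2) by (simp add: subset_insert w_def)
    next
      case 1
      show ?thesis by (rule half) (use 1 insert.prems fJ in auto)
    next
      case 2
      show ?thesis unfolding swap[of J1] add.commute[of "card J1"]
        by (rule half) (use 2 insert.prems fJ in auto)
    qed
  qed
  thus ?thesis by (simp add: y_def w_def)
qed

subsection \<open>Closed pairs of a fixed vertex set\<close>

text \<open>Read \<open>\<phi> e\<close> as the out-neighbours of \<open>e\<close>. Out-degrees at
  most 2 force average in-degree at most 2 inside \<open>F\<close>, so some \<open>e\<close> has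
  in-degree at most 2. Keeping it and deleting its at most four neighbours, then recursing, spends
  at most five elements per kept one.\<close>

lemma independent_subset_outdegree_two:
  assumes "finite F" "\<And>e. e \<in> F \<Longrightarrow> finite (\<phi> e) \<and> card (\<phi> e) \<le> 2 \<and> e \<notin> \<phi> e"
  shows "\<exists>F'\<subseteq>F. card F \<le> 5 * card F' \<and> (\<forall>e\<in>F'. \<phi> e \<inter> F' = {})"
  using assms
proof (induction "card F" arbitrary: F rule: less_induct)
  case less
  show ?case
  proof (cases "F = {}")
    case True
    thus ?thesis by auto
  next
    case False
    have "(\<Sum>e\<in>F. card {e'\<in>F. e \<in> \<phi> e'}) = (\<Sum>e'\<in>F. card {e\<in>F. e \<in> \<phi> e'})"
      using sum.swap_restrict[OF less.prems(1) less.prems(1), of "\<lambda>_ _. 1::nat" "\<lambda>e e'. e \<in> \<phi> e'"] by simp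
    also have "\<dots> \<le> (\<Sum>e'\<in>F. 2)"
    proof (rule sum_mono)
      fix e' assume e': "e' \<in> F"
      have "card {e\<in>F. e \<in> \<phi> e'} \<le> card (\<phi> e')"
        using less.prems(2)[OF e'] by (intro card_mono) auto
      thus "card {e\<in>F. e \<in> \<phi> e'} \<le> 2" using less.prems(2)[OF e'] by auto
    qed
    finally have S: "(\<Sum>e\<in>F. card {e'\<in>F. e \<in> \<phi> e'}) \<le> 2 * card F" by simp
    obtain e where e: "e \<in> F" "card {e'\<in>F. e \<in> \<phi> e'} \<le> 2"
    proof (rule ccontr)
      assume "\<not> thesis"
      hence "\<forall>e\<in>F. 3 \<le> card {e'\<in>F. e \<in> \<phi> e'}" using that by force
      hence "(\<Sum>e\<in>F. 3) \<le> (\<Sum>e\<in>F. card {e'\<in>F. e \<in> \<phi> e'})" by (intro sum_mono) auto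
      moreover have "0 < card F" using False less.prems(1) by (simp add: card_gt_0_iff)
      ultimately show False using S by simp
    qed
    define B where "B = insert e (\<phi> e \<union> {e'\<in>F. e \<in> \<phi> e'})"
    have fB: "finite B" using less.prems e by (auto simp: B_def)
    have "card B \<le> Suc (card (\<phi> e \<union> {e'\<in>F. e \<in> \<phi> e'}))"
      unfolding B_def by (rule card_insert_le_m1) auto
    also have "\<dots> \<le> Suc (card (\<phi> e) + card {e'\<in>F. e \<in> \<phi> e'})"
      using card_Un_le by auto
    finally have B: "card B \<le> 5" using e less.prems(2)[OF e(1)] by auto
    have "F - B \<subset> F" using e by (auto simp: B_def)
    hence "card (F - B) < card F" using less.prems(1) psubset_card_mono by auto
    from less.hyps[OF this] less.prems obtain F' where
      F': "F' \<subseteq> F - B" "card (F - B) \<le> 5 * card F'" "\<forall>e\<in>F'. \<phi> e \<inter> F' = {}"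
      by auto
    have fF': "finite F'" using F'(1) less.prems(1) by (meson finite_Diff finite_subset)
    have "card F \<le> card (F - B) + card B"
      using order.trans[OF card_mono card_Un_le, of "F - B" B F] fB less.prems(1) by auto
    hence "card F \<le> 5 * card (insert e F')"
      using B F' fF' by (subst card_insert_disjoint) (auto simp: B_def)
    moreover have "\<forall>x\<in>insert e F'. \<phi> x \<inter> insert e F' = {}"
      using F' less.prems(2)[OF e(1)] unfolding B_def by blast
    ultimately show ?thesis using F' e by (intro exI[of _ "insert e F'"]) auto
  qed
qed

text \<open>The boolean is the colour, so one random subset of \<open>cpairs N\<close> is a pair of
  independent random graphs.\<close>

definition cpairs :: "nat \<Rightarrow> (bool \<times> nat set) set" where
  "cpairs N = UNIV \<times> nsets {..<N} 2"

lemma finite_cpairs [simp]: "finite (cpairs N)"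
  by (simp add: cpairs_def finite_imp_finite_nsets)

lemma cpairs_edge: "(c, {u, v}) \<in> cpairs N \<longleftrightarrow> u < N \<and> v < N \<and> u \<noteq> v"
  by (auto simp: cpairs_def nsets_def card_insert_if)

lemma card_nsets_2_le_square: "real (card (nsets A 2)) \<le> (real (card A))\<^sup>2 / 2"
proof -
  have "card (nsets A 2) = (card A * (card A - 1)) div 2" by (simp add: card_nsets choose_two)
  moreover have "2 * ((card A * (card A - 1)) div 2) \<le> card A * (card A - 1)"
    by (rule times_div_less_eq_dividend)
  moreover have "card A * (card A - 1) \<le> card A * card A" by (intro mult_le_mono2) simp
  ultimately have "2 * card (nsets A 2) \<le> card A * card A" by linarith
  hence "real (2 * card (nsets A 2)) \<le> real (card A * card A)" by (rule of_nat_mono)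
  thus ?thesis by (simp add: power2_eq_square)
qed

text \<open>A fixed vertex set \<open>I\<close> with projections \<open>p c\<close> in the two colours \<open>c\<close>. A vertex \<open>v\<close> of
  colour \<open>c\<close> is heavy for \<open>I\<close> if its blown-up neighbourhood \<open>link E c v\<close> has at least \<open>D1\<close> elements.
  The set \<open>T c\<close> below is a transversal of the fibres of \<open>p c\<close> in \<open>I\<close>.\<close>

locale two_bites =
  fixes N k \<kappa> :: nat and p :: "bool \<Rightarrow> nat \<Rightarrow> nat" and I :: "nat set"
    and f d1 g D0 D1 M c1 t1 h :: real
  assumes fin_I: "finite I" and card_I: "card I = k"
    and p_less: "x \<in> I \<Longrightarrow> p c x < N"
    and fibre: "real (card {x\<in>I. p c x = u}) \<le> f"
    and f_ge_1: "1 \<le> f" and M_nonneg: "0 \<le> M" and D0_D1: "f * D0 \<le> D1"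
    and D1_pos: "0 < D1" and h_eq: "h = 2 * M * f / D1" and d1_nonneg: "0 \<le> d1"
begin

definition R :: "bool \<Rightarrow> nat set" where "R c = p c ` I"

definition T :: "bool \<Rightarrow> nat set" where "T c = inv_into I (p c) ` R c"

definition link :: "(bool \<times> nat set) set \<Rightarrow> bool \<Rightarrow> nat \<Rightarrow> nat set" where
  "link E c v = {x\<in>I. (c, {p c x, v}) \<in> E}"

definition rdeg :: "(bool \<times> nat set) set \<Rightarrow> bool \<Rightarrow> nat \<Rightarrow> nat" where
  "rdeg E c v = card {u\<in>R c. (c, {u, v}) \<in> E}"

text \<open>Pairs with equal projections are left out: a single edge would put them into a link,
  with probability \<open>q\<close> instead of the square of \<open>q\<close>. They are counted
  through the fibres instead.\<close>

definition cherries :: "(bool \<times> nat set) set \<Rightarrow> bool \<Rightarrow> nat \<Rightarrow> nat" where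
  "cherries E c v = card {\<tau>\<in>nsets I 2. card (p c ` \<tau>) = 2 \<and> \<tau> \<subseteq> link E c v}"

text \<open>The mean of \<open>rdeg\<close> is at most \<open>q * k\<close>, far below the eventual
  threshold \<open>D0\<close>. The total of the large degrees is limited rather than their number,
  because closed pairs and heavy vertices are both charged by degree.\<close>

definition dense_nbhds :: "(bool \<times> nat set) set \<Rightarrow> bool" where
  "dense_nbhds E \<longleftrightarrow> (\<exists>c. M < (\<Sum>v | v < N \<and> D0 \<le> rdeg E c v. real (rdeg E c v)))"

text \<open>For \<open>v \<notin> R c\<close> the stars from \<open>R c\<close> to different
  \<open>v\<close> are edge-disjoint, hence independent, and they contain no pair of
  \<open>inner\<close>. The at most \<open>k\<close> vertices of \<open>R c\<close> are bounded
  trivially elsewhere.\<close>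

definition many_cherries :: "(bool \<times> nat set) set \<Rightarrow> bool" where
  "many_cherries E \<longleftrightarrow>
    (\<exists>c. c1 < (\<Sum>v | v < N \<and> v \<notin> R c \<and> rdeg E c v < D0. real (cherries E c v)))"

definition light_closed :: "(bool \<times> nat set) set \<Rightarrow> nat set \<Rightarrow> bool" where
  "light_closed E \<tau> \<longleftrightarrow> (\<exists>c v. v < N \<and> card (link E c v) < D1 \<and> \<tau> \<subseteq> link E c v)"

text \<open>The vertex that closes \<open>\<tau>\<close> may have either colour, independently of
  the colour \<open>c\<close> in which the projected pair is recorded. Taking \<open>\<tau>\<close>
  in the transversal makes the projection of pairs injective.\<close>

definition closed_pairs :: "(bool \<times> nat set) set \<Rightarrow> (bool \<times> nat set) set" where
  "closed_pairs E = (\<Union>c. Pair c ` (image (p c)) ` {\<tau>\<in>nsets (T c) 2. light_closed E \<tau>})"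

definition inner :: "(bool \<times> nat set) set" where
  "inner = (\<Union>c. Pair c ` nsets (R c) 2)"

text \<open>Removing \<open>F\<close> before computing the closed pairs makes the events \<open>F \<subseteq> E\<close> and
  \<open>F \<subseteq> closed_pairs (E - F)\<close> independent.\<close>

definition many_closed :: "(bool \<times> nat set) set \<Rightarrow> bool" where
  "many_closed E \<longleftrightarrow> (\<exists>F\<subseteq>inner. F \<subseteq> E \<and> t1 \<le> card F \<and> F \<subseteq> closed_pairs (E - F) \<and>
     \<not> dense_nbhds (E - F) \<and> \<not> many_cherries (E - F))"

text \<open>Computed from the certificate alone, so it is a fixed set of pairs once \<open>H\<close>
  and \<open>A\<close> are fixed. Closing by light vertices is ignored here and paid for by the
  tolerance \<open>5 * t1\<close> in \<open>few_open\<close>.\<close>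

definition open_pairs :: "(bool \<times> nat) set \<Rightarrow> (bool \<times> nat set) set \<Rightarrow> (bool \<times> nat set) set" where
  "open_pairs H A = (\<Union>c. Pair c ` (image (p c)) `
     {\<tau>\<in>nsets (T c) 2. \<forall>(c', v)\<in>H. \<not> \<tau> \<subseteq> link A c' v})"

definition star_edges :: "(bool \<times> nat) set \<Rightarrow> (bool \<times> nat set) set" where
  "star_edges H = (\<Union>(c, v)\<in>H. (\<lambda>u. (c, {u, v})) ` R c)"

text \<open>The pair \<open>(H, A)\<close> is a certificate: \<open>H\<close> is the set of heavy vertices, and \<open>A\<close> consists of
  the edges of \<open>E\<close> between them and the projections of \<open>I\<close>.\<close>

definition admissible :: "(bool \<times> nat) set \<Rightarrow> (bool \<times> nat set) set \<Rightarrow> bool" where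
  "admissible H A \<longleftrightarrow> H \<subseteq> UNIV \<times> {..<N} \<and> card H \<le> h \<and> A \<subseteq> star_edges H \<inter> cpairs N \<and>
    (\<forall>(c, v)\<in>H. card (link A c v) \<le> g \<and> card (T c \<inter> link A c v) \<le> d1) \<and>
    (\<forall>c v w. (c, v) \<in> H \<longrightarrow> (c, w) \<in> H \<longrightarrow> v \<noteq> w \<longrightarrow> card (link A c v \<inter> link A c w) \<le> \<kappa> * f) \<and>
    (\<forall>c. (\<Sum>v | (c, v) \<in> H. real (rdeg A c v)) \<le> M)"

text \<open>The existential over certificates becomes a sum in the union bound. The factor 5 is the
  loss in \<open>independent_subset_outdegree_two\<close>.\<close>

definition few_open :: "(bool \<times> nat set) set \<Rightarrow> bool" where
  "few_open E \<longleftrightarrow> (\<exists>H A. admissible H A \<and> A \<subseteq> E \<and> card (E \<inter> open_pairs H A) \<le> 5 * t1)"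

section \<open>Transversals, links and the number of pairs closed by light vertices\<close>

lemma finite_R [simp]: "finite (R c)" and card_R: "card (R c) \<le> k" and R_less: "R c \<subseteq> {..<N}"
  using fin_I card_I p_less card_image_le[of I "p c"] by (auto simp: R_def)

lemma T_sub: "T c \<subseteq> I"
  by (auto simp: T_def R_def inv_into_into)

lemma finite_T [simp]: "finite (T c)"
  by (rule finite_subset[OF T_sub fin_I])

lemma inj_T: "inj_on (p c) (T c)"
proof (rule inj_onI)
  fix x y assume "x \<in> T c" "y \<in> T c" "p c x = p c y"
  thus "x = y" by (auto simp: T_def R_def f_inv_into_f)
qed

lemma p_T: "p c ` T c = R c"
proof -
  have "p c ` T c = (\<lambda>u. p c (inv_into I (p c) u)) ` R c" by (simp add: T_def image_image)
  also have "\<dots> = (\<lambda>u. u) ` R c" by (intro image_cong) (auto simp: R_def f_inv_into_f)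
  finally show ?thesis by simp
qed

lemma card_T: "card (T c) = card (R c)"
  using card_image[OF inj_T, of c] by (simp add: p_T)

lemma inj_image_T: "inj_on (image (p c)) (nsets (T c) 2)"
proof (rule inj_onI)
  fix \<tau> \<sigma> assume "\<tau> \<in> nsets (T c) 2" "\<sigma> \<in> nsets (T c) 2" and eq: "p c ` \<tau> = p c ` \<sigma>"
  hence "\<tau> \<subseteq> T c" "\<sigma> \<subseteq> T c" by (auto simp: nsets_def)
  from inj_on_image_eq_iff[OF inj_T this] eq show "\<tau> = \<sigma>" by simp
qed

lemma image_T_nsets:
  assumes "\<tau> \<in> nsets (T c) 2"
  shows "p c ` \<tau> \<in> nsets (R c) 2"
proof -
  have \<tau>: "\<tau> \<subseteq> T c" "finite \<tau>" "card \<tau> = 2" using assms by (auto simp: nsets_def)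
  have "card (p c ` \<tau>) = 2" using card_image[OF inj_on_subset[OF inj_T \<tau>(1)]] \<tau>(3) by simp
  moreover have "p c ` \<tau> \<subseteq> R c" using \<tau>(1) p_T[of c] by blast
  ultimately show ?thesis using \<tau>(2) by (simp add: nsets_def)
qed

lemma finite_inner [simp]: "finite inner"
  by (simp add: inner_def finite_imp_finite_nsets)

lemma inner_sub: "inner \<subseteq> cpairs N"
  unfolding inner_def cpairs_def using nsets_mono[OF R_less] by blast

lemma closed_pairs_inner: "closed_pairs E \<subseteq> inner"
  unfolding closed_pairs_def inner_def using image_T_nsets by blast

lemma open_pairs_inner: "open_pairs H A \<subseteq> inner"
  unfolding open_pairs_def inner_def using image_T_nsets by blast

lemma link_sub: "link E c v \<subseteq> I" and finite_link [simp]: "finite (link E c v)"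
  using fin_I by (auto simp: link_def)

lemma link_mono: "E \<subseteq> E' \<Longrightarrow> link E c v \<subseteq> link E' c v"
  by (auto simp: link_def)

lemma card_preimage_le:
  assumes "finite U"
  shows "real (card {x\<in>I. p c x \<in> U}) \<le> f * card U"
proof -
  have "{x\<in>I. p c x \<in> U} = (\<Union>u\<in>U. {x\<in>I. p c x = u})" by auto
  hence "card {x\<in>I. p c x \<in> U} \<le> (\<Sum>u\<in>U. card {x\<in>I. p c x = u})"
    using card_UN_le[OF assms] by metis
  hence "real (card {x\<in>I. p c x \<in> U}) \<le> (\<Sum>u\<in>U. real (card {x\<in>I. p c x = u}))"
    unfolding of_nat_sum[symmetric] by (rule of_nat_mono)
  also have "\<dots> \<le> (\<Sum>u\<in>U. f)" by (intro sum_mono fibre)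
  finally show ?thesis by (simp add: mult.commute)
qed

lemma card_link_le: "real (card (link E c v)) \<le> f * rdeg E c v"
proof -
  have "link E c v = {x\<in>I. p c x \<in> {u\<in>R c. (c, {u, v}) \<in> E}}" by (auto simp: link_def R_def)
  thus ?thesis using card_preimage_le[of "{u\<in>R c. (c, {u, v}) \<in> E}" c] by (simp add: rdeg_def)
qed

lemma cherries_le: "real (cherries E c v) \<le> (real (card (link E c v)))\<^sup>2"
proof -
  have "cherries E c v \<le> card (nsets (link E c v) 2)"
    unfolding cherries_def by (intro card_mono) (auto simp: nsets_def finite_imp_finite_nsets)
  hence "real (cherries E c v) \<le> real (card (nsets (link E c v) 2))" by simp
  also have "\<dots> \<le> (real (card (link E c v)))\<^sup>2 / 2" by (rule card_nsets_2_le_square)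
  finally show ?thesis using zero_le_power2[of "real (card (link E c v))"] by linarith
qed

lemma rdeg_mono: "E \<subseteq> E' \<Longrightarrow> rdeg E c v \<le> rdeg E' c v"
  unfolding rdeg_def by (intro card_mono) auto

lemma dense_nbhds_mono:
  assumes "E \<subseteq> E'" "dense_nbhds E"
  shows "dense_nbhds E'"
proof -
  obtain c where c: "M < (\<Sum>v | v < N \<and> D0 \<le> rdeg E c v. real (rdeg E c v))"
    using assms by (auto simp: dense_nbhds_def)
  have "(\<Sum>v | v < N \<and> D0 \<le> rdeg E c v. real (rdeg E c v))
      \<le> (\<Sum>v | v < N \<and> D0 \<le> rdeg E c v. real (rdeg E' c v))"
    using rdeg_mono[OF assms(1)] by (intro sum_mono) auto
  also have "\<dots> \<le> (\<Sum>v | v < N \<and> D0 \<le> rdeg E' c v. real (rdeg E' c v))"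
    using rdeg_mono[OF assms(1), of c] by (intro sum_mono2) (auto, meson of_nat_le_iff order_trans)
  finally show ?thesis using c unfolding dense_nbhds_def by (intro exI[of _ c]) linarith
qed

text \<open>Both ends of an edge in \<open>F\<close> lie in \<open>R c\<close>, so no star at a
  vertex outside \<open>R c\<close> sees it. This replaces monotonicity, which the cutoff
  \<open>rdeg E c v < D0\<close> destroys.\<close>

lemma many_cherries_outer:
  assumes "F \<subseteq> inner"
  shows "many_cherries (E - F) = many_cherries E"
proof -
  have e: "(c, {u, v}) \<notin> F" if "v \<notin> R c" for c u v
    using assms that by (auto simp: inner_def nsets_def)
  have l: "link (E - F) c v = link E c v" if "v \<notin> R c" for c v
    using e[OF that] by (auto simp: link_def)
  have r: "rdeg (E - F) c v = rdeg E c v" if "v \<notin> R c" for c v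
    using e[OF that] by (auto simp: rdeg_def intro!: arg_cong[of _ _ card])
  have "(\<Sum>v | v < N \<and> v \<notin> R c \<and> rdeg (E - F) c v < D0. real (cherries (E - F) c v))
      = (\<Sum>v | v < N \<and> v \<notin> R c \<and> rdeg E c v < D0. real (cherries E c v))" for c
    using l r by (intro sum.cong) (auto simp: cherries_def)
  thus ?thesis by (simp add: many_cherries_def)
qed

text \<open>In the colour of the closing vertex the pair either collapses (\<open>k * f\<close> such
  pairs) or is a cherry at a light vertex. Vertices of degree at least \<open>D0\<close> have total
  degree at most \<open>M\<close> and links below \<open>D1\<close>; those of small degree inside
  \<open>R c\<close> are at most \<open>k\<close> in number; those outside are covered by
  \<open>c1\<close>. The 4 counts the colour of the closing vertex and the colour in which the pair
  is recorded.\<close>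

lemma card_closed_pairs_le:
  assumes "\<not> dense_nbhds E" "\<not> many_cherries E"
  shows "card (closed_pairs E) \<le> 4 * (k * f + D1 * f * M + k * (f * D0)\<^sup>2 + c1)"
proof -
  define X where "X = {\<tau>\<in>nsets I 2. light_closed E \<tau>}"
  define B where "B = k * f + D1 * f * M + k * (f * D0)\<^sup>2 + c1"
  define Y where "Y c v = {\<tau>\<in>nsets I 2. card (p c ` \<tau>) = 2 \<and> \<tau> \<subseteq> link E c v}" for c v
  define S where "S c = {\<tau>\<in>nsets I 2. card (p c ` \<tau>) = 1}" for c
  define L where "L c = {v. v < N \<and> card (link E c v) < D1}" for c
  have fins: "finite (nsets I 2)" by (simp add: fin_I finite_imp_finite_nsets)
  have fX: "finite X" using fins by (auto simp: X_def)
  have fY: "finite (Y c v)" and fS: "finite (S c)" and fL: "finite (L c)" for c v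
    using fins by (auto simp: Y_def S_def L_def)
  have "X \<subseteq> (\<Union>c. S c \<union> (\<Union>v\<in>L c. Y c v))"
  proof
    fix \<tau> assume \<tau>: "\<tau> \<in> X"
    then obtain c v where cv: "v \<in> L c" "\<tau> \<subseteq> link E c v" by (auto simp: X_def light_closed_def L_def)
    have \<tau>2: "card \<tau> = 2" "finite \<tau>" "\<tau> \<in> nsets I 2" using \<tau> by (auto simp: X_def nsets_def)
    have "card (p c ` \<tau>) \<le> 2" "card (p c ` \<tau>) \<noteq> 0" using card_image_le[of \<tau> "p c"] \<tau>2 by auto
    hence "card (p c ` \<tau>) = 1 \<or> card (p c ` \<tau>) = 2" by linarith
    thus "\<tau> \<in> (\<Union>c. S c \<union> (\<Union>v\<in>L c. Y c v))" using cv \<tau>2 by (auto simp: S_def Y_def)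
  qed
  hence "card X \<le> card (\<Union>c. S c \<union> (\<Union>v\<in>L c. Y c v))"
    using fS fY fL by (intro card_mono) auto
  also have "\<dots> \<le> (\<Sum>c\<in>UNIV. card (S c \<union> (\<Union>v\<in>L c. Y c v)))"
    by (rule card_UN_le) auto
  also have "\<dots> \<le> (\<Sum>c\<in>UNIV. card (S c) + (\<Sum>v\<in>L c. card (Y c v)))"
    by (intro sum_mono order.trans[OF card_Un_le] add_left_mono card_UN_le fL)
  finally have "real (card X) \<le> (\<Sum>c\<in>UNIV. real (card (S c)) + (\<Sum>v\<in>L c. real (card (Y c v))))"
    unfolding of_nat_sum[symmetric] of_nat_add[symmetric] by (rule of_nat_mono)
  also have "\<dots> \<le> (\<Sum>c\<in>(UNIV :: bool set). B)"
  proof (rule sum_mono)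
    fix c
    have "S c \<subseteq> (\<Union>x\<in>I. (\<lambda>y. {x, y}) ` {y\<in>I. p c y = p c x})"
    proof
      fix \<tau> assume "\<tau> \<in> S c"
      then obtain x y where xy: "\<tau> = {x, y}" "x \<in> I" "y \<in> I" "card (p c ` \<tau>) = 1"
        by (auto simp: S_def nsets_def card_2_iff)
      hence "p c y = p c x" by (auto simp: card_1_singleton_iff)
      thus "\<tau> \<in> (\<Union>x\<in>I. (\<lambda>y. {x, y}) ` {y\<in>I. p c y = p c x})" using xy by auto
    qed
    hence "card (S c) \<le> card (\<Union>x\<in>I. (\<lambda>y. {x, y}) ` {y\<in>I. p c y = p c x})"
      using fin_I by (intro card_mono) auto
    also have "\<dots> \<le> (\<Sum>x\<in>I. card ((\<lambda>y. {x, y}) ` {y\<in>I. p c y = p c x}))"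
      by (intro card_UN_le fin_I)
    also have "\<dots> \<le> (\<Sum>x\<in>I. card {y\<in>I. p c y = p c x})"
      using fin_I by (intro sum_mono card_image_le) auto
    finally have "real (card (S c)) \<le> (\<Sum>x\<in>I. real (card {y\<in>I. p c y = p c x}))"
      unfolding of_nat_sum[symmetric] by (rule of_nat_mono)
    also have "\<dots> \<le> (\<Sum>x\<in>I. f)" by (intro sum_mono fibre)
    finally have 1: "real (card (S c)) \<le> k * f" using card_I by simp
    define La where "La = {v\<in>L c. D0 \<le> rdeg E c v}"
    define Lb where "Lb = {v\<in>L c. v \<in> R c \<and> rdeg E c v < D0}"
    define Lc where "Lc = {v\<in>L c. v \<notin> R c \<and> rdeg E c v < D0}"
    have Lsp: "L c = La \<union> (Lb \<union> Lc)" "La \<inter> (Lb \<union> Lc) = {}" "Lb \<inter> Lc = {}"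
      by (auto simp: La_def Lb_def Lc_def)
    have fLs: "finite La" "finite Lb" "finite Lc" using fL by (auto simp: La_def Lb_def Lc_def)
    have y: "card (Y c v) = cherries E c v" for v by (simp add: Y_def cherries_def)
    have "(\<Sum>v\<in>La. real (card (Y c v))) \<le> (\<Sum>v\<in>La. D1 * f * rdeg E c v)"
    proof (rule sum_mono)
      fix v assume v: "v \<in> La"
      have "real (card (Y c v)) \<le> real (card (link E c v)) * real (card (link E c v))"
        using cherries_le[of E c v] y by (simp add: power2_eq_square)
      also have "\<dots> \<le> D1 * (f * rdeg E c v)"
        using v card_link_le[of E c v] D1_pos by (intro mult_mono) (auto simp: La_def L_def)
      finally show "real (card (Y c v)) \<le> D1 * f * rdeg E c v" by simp
    qed
    also have "\<dots> = D1 * f * (\<Sum>v\<in>La. real (rdeg E c v))" by (simp add: sum_distrib_left)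
    also have "\<dots> \<le> D1 * f * (\<Sum>v | v < N \<and> D0 \<le> rdeg E c v. real (rdeg E c v))"
      using D1_pos f_ge_1 by (intro mult_left_mono sum_mono2) (auto simp: La_def L_def)
    also have "\<dots> \<le> D1 * f * M"
      using assms(1) D1_pos f_ge_1 by (intro mult_left_mono) (auto simp: dense_nbhds_def not_less)
    finally have 2: "(\<Sum>v\<in>La. real (card (Y c v))) \<le> D1 * f * M" .
    have "(\<Sum>v\<in>Lb. real (card (Y c v))) \<le> (\<Sum>v\<in>Lb. (f * D0)\<^sup>2)"
    proof (rule sum_mono)
      fix v assume v: "v \<in> Lb"
      have "real (card (link E c v)) \<le> f * D0"
        using order.trans[OF card_link_le[of E c v], of "f * D0"] v f_ge_1 by (auto simp: Lb_def)
      hence "(real (card (link E c v)))\<^sup>2 \<le> (f * D0)\<^sup>2" by (intro power_mono) auto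
      thus "real (card (Y c v)) \<le> (f * D0)\<^sup>2" unfolding y using cherries_le[of E c v] by linarith
    qed
    also have "\<dots> \<le> k * (f * D0)\<^sup>2"
    proof -
      have "card Lb \<le> card (R c)" by (intro card_mono) (auto simp: Lb_def)
      hence "card Lb \<le> k" using card_R[of c] by linarith
      thus ?thesis by (simp add: mult_right_mono)
    qed
    finally have 3: "(\<Sum>v\<in>Lb. real (card (Y c v))) \<le> k * (f * D0)\<^sup>2" .
    have "(\<Sum>v\<in>Lc. real (card (Y c v)))
        \<le> (\<Sum>v | v < N \<and> v \<notin> R c \<and> rdeg E c v < D0. real (card (Y c v)))"
      by (intro sum_mono2) (auto simp: Lc_def L_def)
    also have "\<dots> \<le> c1" using assms(2) y by (auto simp: many_cherries_def not_less)
    finally have 4: "(\<Sum>v\<in>Lc. real (card (Y c v))) \<le> c1" .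
    have "(\<Sum>v\<in>L c. real (card (Y c v))) = (\<Sum>v\<in>La. real (card (Y c v)))
      + ((\<Sum>v\<in>Lb. real (card (Y c v))) + (\<Sum>v\<in>Lc. real (card (Y c v))))"
      unfolding Lsp(1) using Lsp fLs by (simp add: sum.union_disjoint)
    thus "real (card (S c)) + (\<Sum>v\<in>L c. real (card (Y c v))) \<le> B"
      using 1 2 3 4 by (simp add: B_def)
  qed
  finally have X: "card X \<le> 2 * B" by simp
  have "card (closed_pairs E) \<le> (\<Sum>c\<in>UNIV. card (Pair c ` (image (p c)) ` {\<tau>\<in>nsets (T c) 2. light_closed E \<tau>}))"
    unfolding closed_pairs_def by (rule card_UN_le) auto
  also have "\<dots> \<le> (\<Sum>c\<in>(UNIV :: bool set). card X)"
  proof (rule sum_mono)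
    fix c :: bool
    have sub: "{\<tau>\<in>nsets (T c) 2. light_closed E \<tau>} \<subseteq> X"
      using T_sub[of c] by (auto simp: X_def nsets_def)
    have "finite {\<tau>\<in>nsets (T c) 2. light_closed E \<tau>}" using sub fX finite_subset by auto
    hence "card (Pair c ` (image (p c)) ` {\<tau>\<in>nsets (T c) 2. light_closed E \<tau>})
      \<le> card {\<tau>\<in>nsets (T c) 2. light_closed E \<tau>}"
      by (meson card_image_le finite_imageI order_trans)
    also have "\<dots> \<le> card X" using sub fX by (rule card_mono[rotated])
    finally show "card (Pair c ` (image (p c)) ` {\<tau>\<in>nsets (T c) 2. light_closed E \<tau>}) \<le> card X" .
  qed
  also have "\<dots> = 2 * card X" by simp
  finally have "real (card (closed_pairs E)) \<le> 2 * real (card X)" by linarith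
  thus ?thesis using X by (simp add: B_def)
qed

end

section \<open>From an independent set to a certificate with few open edges\<close>

context two_bites
begin

text \<open>The assumption \<open>indep\<close> says that every coloured edge inside
  \<open>I\<close> is closed. An edge of \<open>E\<close> among the open pairs of the full heavy
  certificate is closed by no heavy vertex, hence by a light one. A fifth of these edges can be
  chosen with all closing edges outside the choice \<open>F'\<close>; they stay closed in
  \<open>E - F'\<close>, so failure of \<open>many_closed\<close> bounds their number by
  \<open>t1\<close>.\<close>

lemma few_open_if_no_open_pairs:
  assumes E: "E \<subseteq> cpairs N"
    and deg: "\<And>c v. real (card {u. (c, {u, v}) \<in> E}) \<le> d1"
    and codeg: "\<And>c v w. v \<noteq> w \<Longrightarrow> card {u. (c, {u, v}) \<in> E \<and> (c, {u, w}) \<in> E} \<le> \<kappa>"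
    and linkdeg: "\<And>c v. real (card (link E c v)) \<le> g"
    and indep: "\<And>\<tau> c. \<tau> \<in> nsets I 2 \<Longrightarrow> (c, p c ` \<tau>) \<in> E \<Longrightarrow> \<exists>c' v. \<tau> \<subseteq> link E c' v"
    and nd: "\<not> dense_nbhds E" and nc: "\<not> many_cherries E" and ncl: "\<not> many_closed E"
  shows "few_open E"
proof -
  define H where "H = {(c, v). v < N \<and> D1 \<le> card (link E c v)}"
  define A where "A = E \<inter> star_edges H"
  have finE: "finite E" using E finite_cpairs by (rule finite_subset)
  have fnb: "finite {u. (c, {u, v}) \<in> E}" for c v
  proof (rule finite_subset)
    show "{u. (c, {u, v}) \<in> E} \<subseteq> {..<N}" using E cpairs_edge by blast
  qed simp
  have Hsub: "H \<subseteq> UNIV \<times> {..<N}" by (auto simp: H_def)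
  have A_iff: "(c, {u, v}) \<in> A \<longleftrightarrow> (c, {u, v}) \<in> E" if "(c, v) \<in> H" "u \<in> R c" for c u v
    using that by (auto simp: A_def star_edges_def)
  have linkA: "link A c v = link E c v" if "(c, v) \<in> H" for c v
    using A_iff[OF that] by (auto simp: link_def R_def)
  have rdegA: "rdeg A c v = rdeg E c v" if "(c, v) \<in> H" for c v
    using A_iff[OF that] by (auto simp: rdeg_def intro!: arg_cong[of _ _ card])
  \<comment> \<open>Each neighbour contributes a fibre of at most \<open>f\<close> vertices to the
    link. As \<open>D1 / f\<close> is at least \<open>D0\<close>, the bound \<open>M\<close> applies
    to heavy vertices and limits their number to \<open>h\<close>.\<close>
  have heavy_rdeg: "D1 / f \<le> rdeg E c v" if "(c, v) \<in> H" for c v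
  proof -
    have "D1 \<le> f * rdeg E c v" using that card_link_le[of E c v] by (auto simp: H_def)
    thus ?thesis using f_ge_1 by (simp add: field_simps)
  qed
  have D0_le: "D0 \<le> D1 / f" using D0_D1 f_ge_1 by (simp add: field_simps)
  have sum_rdeg: "(\<Sum>v | (c, v) \<in> H. real (rdeg E c v)) \<le> M" for c
  proof -
    have "(\<Sum>v | (c, v) \<in> H. real (rdeg E c v)) \<le> (\<Sum>v | v < N \<and> D0 \<le> rdeg E c v. real (rdeg E c v))"
    proof (rule sum_mono2)
      show "{v. (c, v) \<in> H} \<subseteq> {v. v < N \<and> D0 \<le> rdeg E c v}"
        using heavy_rdeg[of c] D0_le by (auto simp: H_def intro: order.trans)
    qed auto
    thus ?thesis using nd by (auto simp: dense_nbhds_def not_less intro: order.trans)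
  qed
  have cardH: "real (card H) \<le> h"
  proof -
    have "H = (\<Union>c. Pair c ` {v. (c, v) \<in> H})" by auto
    hence "card H \<le> (\<Sum>c\<in>UNIV. card (Pair c ` {v. (c, v) \<in> H}))"
      using card_UN_le[of "UNIV :: bool set" "\<lambda>c. Pair c ` {v. (c, v) \<in> H}"] by simp
    also have "\<dots> = (\<Sum>c\<in>UNIV. card {v. (c, v) \<in> H})"
      by (intro sum.cong refl card_image) (auto simp: inj_on_def)
    finally have "real (card H) \<le> real (\<Sum>c\<in>UNIV. card {v. (c, v) \<in> H})" by (rule of_nat_mono)
    also have "\<dots> = (\<Sum>c\<in>UNIV. real (card {v. (c, v) \<in> H}))" by simp
    also have "\<dots> \<le> (\<Sum>c\<in>(UNIV :: bool set). M * f / D1)"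
    proof (rule sum_mono)
      fix c
      have "card {v. (c, v) \<in> H} * (D1 / f) = (\<Sum>v | (c, v) \<in> H. D1 / f)" by simp
      also have "\<dots> \<le> (\<Sum>v | (c, v) \<in> H. real (rdeg E c v))"
        using heavy_rdeg by (intro sum_mono) auto
      also have "\<dots> \<le> M" by (rule sum_rdeg)
      finally show "real (card {v. (c, v) \<in> H}) \<le> M * f / D1"
        using f_ge_1 D1_pos by (simp add: field_simps)
    qed
    finally show ?thesis by (simp add: h_eq)
  qed
  have adm: "admissible H A"
    unfolding admissible_def
  proof (intro conjI allI impI)
    show "A \<subseteq> star_edges H \<inter> cpairs N" using E by (auto simp: A_def)
    show "\<forall>(c, v)\<in>H. card (link A c v) \<le> g \<and> card (T c \<inter> link A c v) \<le> d1"
    proof clarify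
      fix c v assume cv: "(c, v) \<in> H"
      have "card (T c \<inter> link A c v) = card (p c ` (T c \<inter> link A c v))"
        by (rule card_image[symmetric], rule inj_on_subset[OF inj_T]) auto
      also have "\<dots> \<le> card {u. (c, {u, v}) \<in> E}"
        using linkA[OF cv] by (intro card_mono fnb) (auto simp: link_def)
      finally have "real (card (T c \<inter> link A c v)) \<le> real (card {u. (c, {u, v}) \<in> E})" by (rule of_nat_mono)
      thus "card (link A c v) \<le> g \<and> card (T c \<inter> link A c v) \<le> d1"
        using deg[of c v] linkdeg[of c v] linkA[OF cv] by simp
    qed
    fix c v w assume cv: "(c, v) \<in> H" and cw: "(c, w) \<in> H" and vw: "v \<noteq> w"
    define U where "U = {u. (c, {u, v}) \<in> E \<and> (c, {u, w}) \<in> E}"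
    have "finite U" using fnb[of c v] by (rule finite_subset[rotated]) (auto simp: U_def)
    moreover have "link A c v \<inter> link A c w = {x\<in>I. p c x \<in> U}"
      unfolding linkA[OF cv] linkA[OF cw] by (auto simp: link_def U_def)
    ultimately have "real (card (link A c v \<inter> link A c w)) \<le> f * card U"
      using card_preimage_le by simp
    also have "\<dots> \<le> f * \<kappa>"
      using codeg[OF vw, of c] f_ge_1 by (intro mult_left_mono) (auto simp: U_def)
    finally show "real (card (link A c v \<inter> link A c w)) \<le> \<kappa> * f" by (simp add: mult.commute)
  next
    fix c
    show "(\<Sum>v | (c, v) \<in> H. real (rdeg A c v)) \<le> M"
      using sum_rdeg[of c] rdegA by simp
  qed (use Hsub cardH in auto)
  define F where "F = E \<inter> open_pairs H A"
  have finF: "finite F" using finE by (simp add: F_def)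
  have "\<forall>e\<in>F. \<exists>c \<tau> c' v. e = (c, p c ` \<tau>) \<and> \<tau> \<in> nsets (T c) 2 \<and> \<tau> \<subseteq> link E c' v \<and> v < N \<and>
      card (link E c' v) < D1"
  proof
    fix e assume e: "e \<in> F"
    then obtain c \<tau> where c: "e = (c, p c ` \<tau>)" "\<tau> \<in> nsets (T c) 2" "\<forall>(c', v)\<in>H. \<not> \<tau> \<subseteq> link A c' v"
      by (auto simp: F_def open_pairs_def)
    have "\<tau> \<in> nsets I 2" using c(2) nsets_mono[OF T_sub] by auto
    then obtain c' v where v: "\<tau> \<subseteq> link E c' v" using indep[of \<tau> c] e c(1) by (auto simp: F_def)
    have "\<tau> \<noteq> {}" using c(2) by (auto simp: nsets_def)
    then obtain x where "x \<in> \<tau>" by auto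
    hence "(c', {p c' x, v}) \<in> E" using v by (auto simp: link_def)
    hence vN: "v < N" using E cpairs_edge by blast
    have "(c', v) \<notin> H"
    proof
      assume *: "(c', v) \<in> H"
      hence "\<not> \<tau> \<subseteq> link A c' v" using c(3) by auto
      thus False using linkA[OF *] v by simp
    qed
    hence "card (link E c' v) < D1" using vN by (auto simp: H_def not_le)
    thus "\<exists>c \<tau> c' v. e = (c, p c ` \<tau>) \<and> \<tau> \<in> nsets (T c) 2 \<and> \<tau> \<subseteq> link E c' v \<and> v < N \<and>
      card (link E c' v) < D1" using c v vN by blast
  qed
  then obtain cc tt dd vv where sel: "\<And>e. e \<in> F \<Longrightarrow> e = (cc e, p (cc e) ` tt e)"
    "\<And>e. e \<in> F \<Longrightarrow> tt e \<in> nsets (T (cc e)) 2" "\<And>e. e \<in> F \<Longrightarrow> tt e \<subseteq> link E (dd e) (vv e)"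
    "\<And>e. e \<in> F \<Longrightarrow> vv e < N" "\<And>e. e \<in> F \<Longrightarrow> card (link E (dd e) (vv e)) < D1"
    by metis
  \<comment> \<open>The two edges from the projections of the ends of \<open>tt e\<close> to the
    light vertex that closes them.\<close>
  define \<phi> where "\<phi> e = (\<lambda>x. (dd e, {p (dd e) x, vv e})) ` tt e" for e
  have \<phi>: "finite (\<phi> e) \<and> card (\<phi> e) \<le> 2 \<and> e \<notin> \<phi> e" if e: "e \<in> F" for e
  proof (intro conjI)
    have t: "finite (tt e)" "card (tt e) = 2" "tt e \<subseteq> T (cc e)" using sel(2)[OF e] by (auto simp: nsets_def)
    show "finite (\<phi> e)" using t by (simp add: \<phi>_def)
    show "card (\<phi> e) \<le> 2" using card_image_le[OF t(1)] t(2) by (simp add: \<phi>_def)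
    \<comment> \<open>If \<open>e\<close> were one of its own closing edges, the closing vertex
      would be the projection of its other end, and the second closing edge would be a loop.\<close>
    show "e \<notin> \<phi> e"
    proof
      assume "e \<in> \<phi> e"
      then obtain x where x: "x \<in> tt e" "e = (dd e, {p (dd e) x, vv e})" by (auto simp: \<phi>_def)
      have "(cc e, p (cc e) ` tt e) = (dd e, {p (dd e) x, vv e})"
        by (rule trans[OF sel(1)[OF e, symmetric] x(2)])
      hence dc: "cc e = dd e" and "p (cc e) ` tt e = {p (dd e) x, vv e}" unfolding prod.inject by blast+
      hence eq: "dd e = cc e" "p (cc e) ` tt e = {p (cc e) x, vv e}" unfolding dc by blast+
      obtain y where y: "tt e = {x, y}" "x \<noteq> y"
      proof -
        obtain a b where ab: "tt e = {a, b}" "a \<noteq> b" using t(2) unfolding card_2_iff by blast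
        show thesis
        proof (cases "x = a")
          case True
          show ?thesis by (rule that[of b]) (simp_all add: ab True)
        next
          case False
          hence xb: "x = b" using x(1) unfolding ab(1) by simp
          show ?thesis by (rule that[of a]) (use ab xb in \<open>simp_all add: insert_commute\<close>)
        qed
      qed
      have "x \<in> T (cc e)" "y \<in> T (cc e)" using t(3) y(1) by auto
      hence "p (cc e) x \<noteq> p (cc e) y" using inj_onD[OF inj_T, of "cc e" x y] y(2) by blast
      moreover have "{p (cc e) x, p (cc e) y} = {p (cc e) x, vv e}" using eq(2) unfolding y(1) by simp
      ultimately have "vv e = p (cc e) y" unfolding doubleton_eq_iff by metis
      moreover have "y \<in> link E (dd e) (vv e)" using sel(3)[OF e] y(1) by blast
      hence "(cc e, {p (cc e) y, vv e}) \<in> E" unfolding eq(1) by (simp add: link_def)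
      ultimately have "(cc e, {p (cc e) y, p (cc e) y}) \<in> cpairs N" using E by auto
      thus False unfolding cpairs_edge by simp
    qed
  qed
  obtain F' where F': "F' \<subseteq> F" "card F \<le> 5 * card F'" "\<forall>e\<in>F'. \<phi> e \<inter> F' = {}"
    using independent_subset_outdegree_two[OF finF \<phi>] by blast
  have F'E: "F' \<subseteq> E" and F'in: "F' \<subseteq> inner" using F'(1) open_pairs_inner[of H A] by (auto simp: F_def)
  have "F' \<subseteq> closed_pairs (E - F')"
  proof
    fix e assume e': "e \<in> F'"
    hence e: "e \<in> F" using F' by auto
    have "tt e \<subseteq> link (E - F') (dd e) (vv e)"
    proof
      fix x assume x: "x \<in> tt e"
      hence "(dd e, {p (dd e) x, vv e}) \<in> \<phi> e" by (auto simp: \<phi>_def)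
      hence "(dd e, {p (dd e) x, vv e}) \<notin> F'" using F'(3) e' by auto
      thus "x \<in> link (E - F') (dd e) (vv e)" using sel(3)[OF e] x by (auto simp: link_def)
    qed
    moreover have "card (link (E - F') (dd e) (vv e)) \<le> card (link E (dd e) (vv e))"
      by (intro card_mono link_mono) auto
    ultimately have "light_closed (E - F') (tt e)"
      unfolding light_closed_def using sel(4,5)[OF e] by (intro exI[of _ "dd e"] exI[of _ "vv e"]) auto
    hence "(cc e, p (cc e) ` tt e) \<in> closed_pairs (E - F')"
      unfolding closed_pairs_def using sel(2)[OF e] by blast
    thus "e \<in> closed_pairs (E - F')" using sel(1)[OF e] by simp
  qed
  moreover have "\<not> dense_nbhds (E - F')" using nd dense_nbhds_mono[of "E - F'" E] by auto
  moreover have "\<not> many_cherries (E - F')" using nc many_cherries_outer[OF F'in] by simp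
  ultimately have "\<not> t1 \<le> card F'" using ncl F'E F'in by (auto simp: many_closed_def)
  hence "real (card F) \<le> 5 * t1" using F'(2) by linarith
  thus ?thesis using adm unfolding few_open_def F_def A_def by blast
qed

section \<open>Counting open pairs of an admissible certificate\<close>

lemma finite_star_edges:
  assumes "finite H"
  shows "finite (star_edges H)" and "card (star_edges H) \<le> card H * k"
proof -
  show "finite (star_edges H)" using assms by (auto simp: star_edges_def)
  have "card (star_edges H) \<le> (\<Sum>x\<in>H. card ((\<lambda>(c, v). (\<lambda>u. (c, {u, v})) ` R c) x))"
    unfolding star_edges_def by (rule card_UN_le[OF assms])
  also have "\<dots> \<le> (\<Sum>x\<in>H. k)"
  proof (rule sum_mono)
    fix x assume "x \<in> H"
    show "card ((\<lambda>(c, v). (\<lambda>u. (c, {u, v})) ` R c) x) \<le> k"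
      using card_image_le[OF finite_R] card_R order_trans by (cases x) (auto, blast)
  qed
  finally show "card (star_edges H) \<le> card H * k" by simp
qed


text \<open>A heavy vertex of colour \<open>c\<close> closes few pairs of the transversal in its own
  colour, since it meets at most \<open>d1\<close> of its elements, but it may close all pairs of
  its link in the other colour; hence the sum of squares \<open>Q\<close>. Small codegrees keep the
  heavy links nearly disjoint, so \<open>S\<close> is close to \<open>card (U c)\<close>. The last
  inequality says that a large union \<open>U\<close> must be bought by collisions or by edges of
  \<open>A\<close>.\<close>

lemma open_pairs_counts:
  fixes a S Q :: "bool \<Rightarrow> real" and U :: "bool \<Rightarrow> nat set"
  assumes adm: "admissible H A"
  defines "a \<equiv> \<lambda>c. real (card {e. (c, e) \<in> A})"
    and "S \<equiv> \<lambda>c. \<Sum>v | (c, v) \<in> H. real (card (link A c v))"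
    and "Q \<equiv> \<lambda>c. \<Sum>v | (c, v) \<in> H. (real (card (link A c v)))\<^sup>2"
    and "U \<equiv> \<lambda>c. \<Union>v\<in>{v. (c, v) \<in> H}. link A c v"
  shows "2 * real (card (open_pairs H A)) \<ge> (\<Sum>c\<in>UNIV. (real (card (R c)))\<^sup>2 - k - d1 * M - Q c)"
    and "a c \<le> M"
    and "card A = (\<Sum>c\<in>UNIV. card {e. (c, e) \<in> A})"
    and "Q c \<le> g * S c"
    and "Q c \<le> (S c)\<^sup>2"
    and "S c \<le> card (U c) + h\<^sup>2 * (\<kappa> * f)"
    and "card (U c) \<le> k"
    and "card (R c) + card (U c) \<le> k + a c + h"
proof -
  have H: "H \<subseteq> UNIV \<times> {..<N}" "card H \<le> h" and A: "A \<subseteq> star_edges H" "A \<subseteq> cpairs N"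
    and deg: "\<And>c v. (c, v) \<in> H \<Longrightarrow> card (link A c v) \<le> g"
      "\<And>c v. (c, v) \<in> H \<Longrightarrow> card (T c \<inter> link A c v) \<le> d1"
    and codeg: "\<And>c v w. (c, v) \<in> H \<Longrightarrow> (c, w) \<in> H \<Longrightarrow> v \<noteq> w \<Longrightarrow> card (link A c v \<inter> link A c w) \<le> \<kappa> * f"
    and rd: "\<And>c. (\<Sum>v | (c, v) \<in> H. real (rdeg A c v)) \<le> M"
    using adm unfolding admissible_def by auto
  have finH: "finite H" by (rule finite_subset[OF H(1)]) simp
  have finA: "finite A" by (rule finite_subset[OF A(2) finite_cpairs])
  define Hc where "Hc c = {v. (c, v) \<in> H}" for c
  have Hc_img: "Hc c = snd ` (H \<inter> ({c} \<times> UNIV))" for c by (force simp: Hc_def)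
  have finHc: "finite (Hc c)" for c unfolding Hc_img using finH by auto
  have cardHc: "real (card (Hc c)) \<le> h" for c
  proof -
    have "card (Hc c) \<le> card (H \<inter> ({c} \<times> UNIV))" unfolding Hc_img using finH by (intro card_image_le) auto
    also have "\<dots> \<le> card H" using finH by (intro card_mono) auto
    finally show ?thesis using H(2) by linarith
  qed
  have fine: "finite {e. (c, e) \<in> A}" for c
  proof -
    have "{e. (c, e) \<in> A} \<subseteq> snd ` A" by force
    thus ?thesis using finA finite_subset by blast
  qed
  have star: "\<exists>u v. e = {u, v} \<and> (c, v) \<in> H \<and> u \<in> R c" if "(c, e) \<in> A" for c e
    using A(1) that by (force simp: star_edges_def)
  show "a c \<le> M"
  proof -
    have "{e. (c, e) \<in> A} \<subseteq> (\<Union>v\<in>Hc c. (\<lambda>u. {u, v}) ` {u\<in>R c. (c, {u, v}) \<in> A})"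
      using star by (fastforce simp: Hc_def)
    hence "card {e. (c, e) \<in> A} \<le> card (\<Union>v\<in>Hc c. (\<lambda>u. {u, v}) ` {u\<in>R c. (c, {u, v}) \<in> A})"
      using finHc by (intro card_mono) auto
    also have "\<dots> \<le> (\<Sum>v\<in>Hc c. card ((\<lambda>u. {u, v}) ` {u\<in>R c. (c, {u, v}) \<in> A}))"
      by (rule card_UN_le[OF finHc])
    also have "\<dots> \<le> (\<Sum>v\<in>Hc c. rdeg A c v)"
      unfolding rdeg_def by (intro sum_mono card_image_le) auto
    finally have "a c \<le> real (\<Sum>v\<in>Hc c. rdeg A c v)" unfolding a_def by (rule of_nat_mono)
    thus ?thesis using rd[of c] by (simp add: Hc_def)
  qed
  show "card A = (\<Sum>c\<in>UNIV. card {e. (c, e) \<in> A})"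
  proof -
    have "A = Pair True ` {e. (True, e) \<in> A} \<union> Pair False ` {e. (False, e) \<in> A}"
      (is "A = ?B")
    proof (rule set_eqI)
      fix x show "x \<in> A \<longleftrightarrow> x \<in> ?B" by (cases x; cases "fst x") auto
    qed
    hence "card A = card (Pair True ` {e. (True, e) \<in> A} \<union> Pair False ` {e. (False, e) \<in> A})" by simp
    also have "\<dots> = card (Pair True ` {e. (True, e) \<in> A}) + card (Pair False ` {e. (False, e) \<in> A})"
      using fine by (intro card_Un_disjoint) auto
    also have "\<dots> = card {e. (True, e) \<in> A} + card {e. (False, e) \<in> A}"
      by (intro arg_cong2[of _ _ _ _ "(+)"] card_image) (auto simp: inj_on_def)
    finally show ?thesis by (simp add: UNIV_bool)
  qed
  have S: "S c = (\<Sum>v\<in>Hc c. real (card (link A c v)))"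
    and Q: "Q c = (\<Sum>v\<in>Hc c. (real (card (link A c v)))\<^sup>2)"
    and U: "U c = (\<Union>v\<in>Hc c. link A c v)" for c
    by (auto simp: S_def Q_def U_def Hc_def)
  show "Q c \<le> g * S c"
    unfolding Q S sum_distrib_left power2_eq_square
    using deg(1) by (intro sum_mono mult_right_mono) (auto simp: Hc_def)
  have S_ge: "real (card (link A c v)) \<le> S c" if "v \<in> Hc c" for v
    unfolding S using that finHc by (intro member_le_sum) auto
  have "Q c \<le> (\<Sum>v\<in>Hc c. S c * real (card (link A c v)))"
    unfolding Q power2_eq_square using S_ge by (intro sum_mono mult_right_mono) auto
  thus "Q c \<le> (S c)\<^sup>2" by (simp add: S sum_distrib_left[symmetric] power2_eq_square)
  show "card (U c) \<le> k"
    unfolding U card_I[symmetric] using link_sub by (intro card_mono fin_I) auto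
  show "S c \<le> card (U c) + h\<^sup>2 * (\<kappa> * f)"
  proof -
    have K0: "0 \<le> real \<kappa> * f" using f_ge_1 by auto
    \<comment> \<open>Inclusion-exclusion to second order: a new link meets the union of the earlier
      ones in at most \<open>card V * (\<kappa> * f)\<close> points.\<close>
    have "(\<Sum>v\<in>V. real (card (link A c v))) \<le> card (\<Union>v\<in>V. link A c v) + (card V)\<^sup>2 * (\<kappa> * f)"
      if "finite V" "V \<subseteq> Hc c" for V
      using that
    proof (induction V rule: finite_induct)
      case (insert w V)
      have "card (link A c w \<inter> (\<Union>v\<in>V. link A c v)) = card (\<Union>v\<in>V. link A c w \<inter> link A c v)"
        by (rule arg_cong[of _ _ card]) auto
      also have "\<dots> \<le> (\<Sum>v\<in>V. card (link A c w \<inter> link A c v))" by (rule card_UN_le[OF insert(1)])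
      finally have "real (card (link A c w \<inter> (\<Union>v\<in>V. link A c v))) \<le> real (\<Sum>v\<in>V. card (link A c w \<inter> link A c v))"
        by (rule of_nat_mono)
      also have "\<dots> = (\<Sum>v\<in>V. real (card (link A c w \<inter> link A c v)))" by simp
      also have "\<dots> \<le> (\<Sum>v\<in>V. \<kappa> * f)"
        using insert codeg[of c w] by (intro sum_mono) (auto simp: Hc_def)
      finally have 1: "real (card (link A c w \<inter> (\<Union>v\<in>V. link A c v))) \<le> card V * (\<kappa> * f)" by simp
      have "card (link A c w) + card (\<Union>v\<in>V. link A c v)
        = card (link A c w \<union> (\<Union>v\<in>V. link A c v)) + card (link A c w \<inter> (\<Union>v\<in>V. link A c v))"
        using insert by (intro card_Un_Int) auto
      hence 2: "real (card (link A c w)) + card (\<Union>v\<in>V. link A c v)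
        = card (\<Union>v\<in>insert w V. link A c v) + card (link A c w \<inter> (\<Union>v\<in>V. link A c v))"
        unfolding UN_insert by linarith
      have "(card V)\<^sup>2 * (\<kappa> * f) + card V * (\<kappa> * f) \<le> (Suc (card V))\<^sup>2 * (\<kappa> * f)"
        unfolding distrib_right[symmetric] using K0 by (intro mult_right_mono) (auto simp: power2_eq_square)
      moreover have "card (insert w V) = Suc (card V)" using insert by simp
      ultimately show ?case using insert 1 2 by simp
    qed simp
    from this[OF finHc order.refl]
    have "S c \<le> card (U c) + (card (Hc c))\<^sup>2 * (\<kappa> * f)" by (simp add: S U)
    also have "\<dots> \<le> card (U c) + h\<^sup>2 * (\<kappa> * f)"
      using cardHc[of c] K0 by (intro add_left_mono mult_right_mono) (auto intro: power_mono)
    finally show ?thesis .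
  qed
  show "card (R c) + card (U c) \<le> k + a c + h"
  proof -
    define W where "W = p c ` U c"
    have Usub: "U c \<subseteq> I" unfolding U using link_sub by auto
    hence finU: "finite (U c)" using fin_I by (rule finite_subset)
    have "R c = p c ` (I - U c) \<union> W" using Usub by (auto simp: R_def W_def)
    hence "card (R c) \<le> card (p c ` (I - U c)) + card W" using card_Un_le by metis
    also have "card (p c ` (I - U c)) \<le> card (I - U c)" using fin_I by (intro card_image_le) auto
    also have "card (I - U c) = k - card (U c)" using Usub finU card_I by (simp add: card_Diff_subset)
    finally have 1: "card (R c) + card (U c) \<le> k + card W"
      using card_mono[OF fin_I Usub] card_I by simp
    have "\<forall>u\<in>W - Hc c. \<exists>v. v \<in> Hc c \<and> (c, {u, v}) \<in> A"
      by (auto simp: W_def U link_def)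
    then obtain s where s: "\<And>u. u \<in> W - Hc c \<Longrightarrow> s u \<in> Hc c \<and> (c, {u, s u}) \<in> A" by metis
    \<comment> \<open>A projection that is not itself heavy owns an edge of \<open>A\<close>: the
      other end \<open>s u\<close> is heavy, so the edge determines \<open>u\<close>. The
      projections that are heavy account for the summand \<open>h\<close>.\<close>
    have "inj_on (\<lambda>u. {u, s u}) (W - Hc c)"
    proof (rule inj_onI)
      fix u u' assume u: "u \<in> W - Hc c" "u' \<in> W - Hc c" "{u, s u} = {u', s u'}"
      thus "u = u'" using s[OF u(1)] s[OF u(2)] by (auto simp: doubleton_eq_iff)
    qed
    hence "card (W - Hc c) \<le> card {e. (c, e) \<in> A}"
      by (rule card_inj_on_le) (use s fine in auto)
    moreover have "card W \<le> card (W - Hc c) + card (Hc c)"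
    proof -
      have "card W \<le> card ((W - Hc c) \<union> Hc c)"
        using finHc finU by (intro card_mono) (auto simp: W_def)
      also have "\<dots> \<le> card (W - Hc c) + card (Hc c)" by (rule card_Un_le)
      finally show ?thesis .
    qed
    ultimately have "real (card W) \<le> a c + card (Hc c)" unfolding a_def by linarith
    thus ?thesis using 1 cardHc[of c] by linarith
  qed
  show "2 * real (card (open_pairs H A)) \<ge> (\<Sum>c\<in>UNIV. (real (card (R c)))\<^sup>2 - k - d1 * M - Q c)"
  proof -
    define P where "P c = {\<tau>\<in>nsets (T c) 2. \<forall>(c', v)\<in>H. \<not> \<tau> \<subseteq> link A c' v}" for c
    have finP: "finite (P c)" for c by (simp add: P_def finite_imp_finite_nsets)
    have "card (open_pairs H A) = card (\<Union>c\<in>UNIV. Pair c ` (image (p c)) ` P c)"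
      by (simp add: open_pairs_def P_def)
    also have "\<dots> = (\<Sum>c\<in>UNIV. card (Pair c ` (image (p c)) ` P c))"
      using finP by (intro card_UN_disjoint) auto
    also have "\<dots> = (\<Sum>c\<in>UNIV. card (P c))"
    proof (rule sum.cong)
      fix c
      have "card (Pair c ` (image (p c)) ` P c) = card ((image (p c)) ` P c)"
        by (rule card_image) (auto simp: inj_on_def)
      also have "\<dots> = card (P c)"
        by (rule card_image, rule inj_on_subset[OF inj_image_T]) (auto simp: P_def)
      finally show "card (Pair c ` (image (p c)) ` P c) = card (P c)" .
    qed simp
    finally have cardO: "card (open_pairs H A) = (\<Sum>c\<in>UNIV. card (P c))" .
    \<comment> \<open>The index is \<open>\<not> c\<close> because whole links are lost to heavy
      vertices of the opposite colour. Summing over both colours restores the sum of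
      \<open>Q c\<close>.\<close>
    have each: "(real (card (R c)))\<^sup>2 - k - d1 * M - Q (\<not> c) \<le> 2 * real (card (P c))" for c
    proof -
      have "nsets (T c) 2 \<subseteq> P c \<union> (\<Union>c'\<in>UNIV. \<Union>v\<in>Hc c'. nsets (T c \<inter> link A c' v) 2)"
        by (auto simp: P_def Hc_def nsets_def)
      hence "card (nsets (T c) 2) \<le> card (P c \<union> (\<Union>c'\<in>UNIV. \<Union>v\<in>Hc c'. nsets (T c \<inter> link A c' v) 2))"
        using finP finHc by (intro card_mono) (auto simp: finite_imp_finite_nsets)
      also have "\<dots> \<le> card (P c) + (\<Sum>c'\<in>UNIV. \<Sum>v\<in>Hc c'. card (nsets (T c \<inter> link A c' v) 2))"
        by (intro order.trans[OF card_Un_le] add_left_mono order.trans[OF card_UN_le] sum_mono card_UN_le finHc) auto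
      finally have "real (card (nsets (T c) 2)) \<le> real (card (P c) + (\<Sum>c'\<in>UNIV. \<Sum>v\<in>Hc c'. card (nsets (T c \<inter> link A c' v) 2)))"
        by (rule of_nat_mono)
      also have "\<dots> = card (P c) + (\<Sum>v\<in>Hc c. real (card (nsets (T c \<inter> link A c v) 2)))
          + (\<Sum>v\<in>Hc (\<not> c). real (card (nsets (T c \<inter> link A (\<not> c) v) 2)))"
        by (cases c) (auto simp: UNIV_bool)
      also have "\<dots> \<le> card (P c) + (\<Sum>v\<in>Hc c. d1 * rdeg A c v / 2)
          + (\<Sum>v\<in>Hc (\<not> c). (real (card (link A (\<not> c) v)))\<^sup>2 / 2)"
      proof (intro add_mono order.refl sum_mono)
        fix v assume v: "v \<in> Hc c"
        have "T c \<inter> link A c v = {x\<in>T c. (c, {p c x, v}) \<in> A}" using T_sub by (auto simp: link_def)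
        hence "p c ` (T c \<inter> link A c v) = {u\<in>R c. (c, {u, v}) \<in> A}" unfolding p_T[symmetric] by auto
        moreover have "card (p c ` (T c \<inter> link A c v)) = card (T c \<inter> link A c v)"
          by (rule card_image, rule inj_on_subset[OF inj_T]) auto
        ultimately have eq: "card (T c \<inter> link A c v) = rdeg A c v" by (simp add: rdeg_def)
        have "real (card (nsets (T c \<inter> link A c v) 2)) \<le> (real (rdeg A c v))\<^sup>2 / 2"
          using card_nsets_2_le_square[of "T c \<inter> link A c v"] eq by simp
        also have "\<dots> \<le> d1 * rdeg A c v / 2"
          using deg(2)[of c v] v eq unfolding power2_eq_square
          by (intro divide_right_mono mult_right_mono) (auto simp: Hc_def)
        finally show "real (card (nsets (T c \<inter> link A c v) 2)) \<le> d1 * rdeg A c v / 2" .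
      next
        fix v assume v: "v \<in> Hc (\<not> c)"
        have "real (card (nsets (T c \<inter> link A (\<not> c) v) 2)) \<le> real (card (nsets (link A (\<not> c) v) 2))"
          by (intro of_nat_mono card_mono) (auto simp: finite_imp_finite_nsets nsets_def)
        also have "\<dots> \<le> (real (card (link A (\<not> c) v)))\<^sup>2 / 2" by (rule card_nsets_2_le_square)
        finally show "real (card (nsets (T c \<inter> link A (\<not> c) v) 2)) \<le> (real (card (link A (\<not> c) v)))\<^sup>2 / 2" .
      qed
      also have "(\<Sum>v\<in>Hc c. d1 * rdeg A c v / 2) = d1 * (\<Sum>v\<in>Hc c. real (rdeg A c v)) / 2"
        by (simp add: sum_distrib_left sum_divide_distrib)
      also have "(\<Sum>v\<in>Hc (\<not> c). (real (card (link A (\<not> c) v)))\<^sup>2 / 2) = Q (\<not> c) / 2"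
        by (simp add: Q sum_divide_distrib)
      finally have 1: "real (card (nsets (T c) 2)) \<le> card (P c) + d1 * (\<Sum>v\<in>Hc c. real (rdeg A c v)) / 2 + Q (\<not> c) / 2" .
      have 2: "d1 * (\<Sum>v\<in>Hc c. real (rdeg A c v)) \<le> d1 * M"
      proof (cases "Hc c = {}")
        case True
        thus ?thesis using M_nonneg d1_nonneg by simp
      next
        case False
        thus ?thesis using rd[of c] d1_nonneg by (intro mult_left_mono) (auto simp: Hc_def)
      qed
      have "2 * real (card (nsets (T c) 2)) \<ge> (real (card (R c)))\<^sup>2 - k"
      proof -
        have "2 * card (nsets (T c) 2) = card (R c) * (card (R c) - 1)"
        proof -
          have "even (card (R c) * (card (R c) - 1))" by (cases "card (R c)") auto
          thus ?thesis unfolding card_nsets choose_two card_T by (rule dvd_mult_div_cancel)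
        qed
        hence "2 * real (card (nsets (T c) 2)) = real (card (R c) * (card (R c) - 1))"
          by (metis of_nat_mult of_nat_numeral)
        also have "\<dots> = (real (card (R c)))\<^sup>2 - card (R c)"
          by (cases "card (R c)") (auto simp: power2_eq_square algebra_simps)
        finally show ?thesis using card_R[of c] by simp
      qed
      thus ?thesis using 1 2 by linarith
    qed
    have "(\<Sum>c\<in>UNIV. (real (card (R c)))\<^sup>2 - k - d1 * M - Q c)
        = (\<Sum>c\<in>UNIV. (real (card (R c)))\<^sup>2 - k - d1 * M - Q (\<not> c))"
      by (simp add: UNIV_bool)
    also have "\<dots> \<le> (\<Sum>c\<in>UNIV. 2 * real (card (P c)))" by (intro sum_mono each)
    also have "\<dots> = 2 * real (card (open_pairs H A))" by (simp add: cardO sum_distrib_left)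
    finally show ?thesis .
  qed
qed

end

subsection \<open>Probability estimates for a fixed vertex set\<close>

context two_bites
begin

text \<open>An edge can be seen from both of its ends, when both lie in \<open>S\<close> and in
  \<open>R c\<close>; this is the factor 2.\<close>

lemma sum_rdeg_le:
  assumes "finite S"
  shows "(\<Sum>v\<in>S. rdeg E c v) \<le> 2 * card (E \<inter> star_edges ({c} \<times> S))"
proof -
  define B where "B = E \<inter> star_edges ({c} \<times> S)"
  have finB: "finite B" unfolding B_def using finite_star_edges(1)[of "{c} \<times> S"] assms by auto
  define X where "X = Sigma S (\<lambda>v. {u\<in>R c. (c, {u, v}) \<in> E})"
  have 1: "(\<Sum>v\<in>S. rdeg E c v) = card X"
    unfolding X_def rdeg_def using assms by (intro card_SigmaI[symmetric]) auto
  have finX: "finite X" using assms by (simp add: X_def)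
  define pre where "pre e = {w\<in>X. (c, {snd w, fst w}) = e}" for e
  have "X \<subseteq> (\<Union>e\<in>B. pre e)"
    by (fastforce simp: X_def B_def star_edges_def pre_def)
  hence "card X \<le> card (\<Union>e\<in>B. pre e)"
    using finB finX by (intro card_mono finite_UN_I) (auto simp: pre_def)
  also have "\<dots> \<le> (\<Sum>e\<in>B. card (pre e))"
    by (rule card_UN_le[OF finB])
  also have "\<dots> \<le> (\<Sum>e\<in>B. 2)"
  proof (rule sum_mono)
    fix e
    show "card (pre e) \<le> 2"
    proof (cases "pre e = {}")
      case False
      then obtain w where w: "(c, {snd w, fst w}) = e" by (auto simp: pre_def)
      have "pre e \<subseteq> {(fst w, snd w), (snd w, fst w)}"
      proof
        fix w' assume "w' \<in> pre e"
        hence "{snd w', fst w'} = {snd w, fst w}" using w by (auto simp: pre_def)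
        hence "snd w' = snd w \<and> fst w' = fst w \<or> snd w' = fst w \<and> fst w' = snd w"
          by (simp add: doubleton_eq_iff)
        thus "w' \<in> {(fst w, snd w), (snd w, fst w)}" by (cases w') auto
      qed
      hence "card (pre e) \<le> card {(fst w, snd w), (snd w, fst w)}" by (intro card_mono) auto
      also have "\<dots> \<le> 2" by (simp add: card_insert_if)
      finally show ?thesis .
    qed simp
  qed
  finally show ?thesis unfolding 1 by (simp add: B_def mult.commute)
qed

text \<open>Union bound over the set \<open>S\<close> of vertices of degree at least
  \<open>D0\<close>. Their total degree is at least \<open>card S * D0\<close> and above
  \<open>M\<close>, hence above the mean of the two; counting edges instead of degrees halves it
  again, which gives the quarter. The part with \<open>D0\<close> pays for the choice of
  \<open>S\<close>, the part with \<open>M\<close> is the gain.\<close>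

lemma prob_dense_nbhds:
  fixes q Z :: real
  assumes q: "0 \<le> q" "q \<le> 1" and Z: "1 \<le> Z"
    and small: "N * (Z powr (- D0 / 4) * exp (q * k * Z)) \<le> 1"
  shows "rs_exp q (cpairs N) (\<lambda>E. of_bool (dense_nbhds E)) \<le> 2 * exp 1 * Z powr (- M / 4)"
proof -
  define B where "B c S = star_edges ({c} \<times> S) \<inter> cpairs N" for c S
  define y where "y = Z powr (- D0 / 4) * exp (q * k * Z)"
  have y0: "0 \<le> y" by (simp add: y_def)
  have le: "\<exists>s\<in>UNIV \<times> Pow {..<N}. (card (snd s) * D0 + M) / 4 \<le> real (card (E \<inter> B (fst s) (snd s)))"
    if E: "E \<subseteq> cpairs N" and "dense_nbhds E" for E
  proof -
    obtain c where c: "M < (\<Sum>v | v < N \<and> D0 \<le> rdeg E c v. real (rdeg E c v))"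
      using \<open>dense_nbhds E\<close> by (auto simp: dense_nbhds_def)
    define S where "S = {v. v < N \<and> D0 \<le> rdeg E c v}"
    have fS: "finite S" and SN: "S \<in> Pow {..<N}" by (auto simp: S_def)
    have EB: "E \<inter> B c S = E \<inter> star_edges ({c} \<times> S)" using E by (auto simp: B_def)
    have "card S * D0 = (\<Sum>v\<in>S. D0)" by simp
    also have "\<dots> \<le> (\<Sum>v\<in>S. real (rdeg E c v))" by (intro sum_mono) (auto simp: S_def)
    finally have "card S * D0 + M \<le> 2 * real (\<Sum>v\<in>S. rdeg E c v)" using c by (simp add: S_def)
    also have "\<dots> \<le> 2 * real (2 * card (E \<inter> B c S))"
      unfolding EB using sum_rdeg_le[OF fS, of E c] by (intro mult_left_mono of_nat_mono) auto
    finally show ?thesis using SN by (intro bexI[of _ "(c, S)"]) auto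
  qed
  have each: "rs_exp q (cpairs N) (\<lambda>E. of_bool (real (card (E \<inter> B c S)) \<ge> (card S * D0 + M) / 4))
      \<le> Z powr (- M / 4) * y ^ card S" if "S \<subseteq> {..<N}" for c S
  proof -
    have fS: "finite S" using that finite_subset by blast
    have cB: "card (B c S) \<le> card S * k"
    proof -
      have "card (B c S) \<le> card (star_edges ({c} \<times> S))"
        unfolding B_def using finite_star_edges(1)[of "{c} \<times> S"] fS by (intro card_mono) auto
      also have "\<dots> \<le> card ({c} \<times> S) * k" using fS by (intro finite_star_edges(2)) auto
      finally show ?thesis by (simp add: card_cartesian_product)
    qed
    have b1: "1 \<le> 1 - q + q * Z" using q Z mult_left_mono[of 1 Z q] by simp
    have "rs_exp q (cpairs N) (\<lambda>E. of_bool (real (card (E \<inter> B c S)) \<ge> (card S * D0 + M) / 4))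
        \<le> Z powr (- ((card S * D0 + M) / 4)) * (1 - q + q * Z) ^ card (B c S)"
      using q Z by (intro rs_exp_upper_tail) (auto simp: B_def)
    also have "\<dots> \<le> Z powr (- ((card S * D0 + M) / 4)) * (1 - q + q * Z) ^ (card S * k)"
      using b1 cB by (intro mult_left_mono power_increasing) auto
    also have "\<dots> \<le> Z powr (- ((card S * D0 + M) / 4)) * (exp (q * Z)) ^ (card S * k)"
    proof (intro mult_left_mono power_mono)
      show "1 - q + q * Z \<le> exp (q * Z)" using exp_ge_add_one_self[of "q * Z"] q by linarith
    qed (use b1 in auto)
    also have "\<dots> = Z powr (- M / 4) * y ^ card S"
    proof -
      have "Z powr (- ((card S * D0 + M) / 4)) = Z powr (- M / 4 + (- D0 / 4) * card S)"
        by (rule arg_cong[of _ _ "(powr) Z"]) (simp add: field_simps)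
      also have "\<dots> = Z powr (- M / 4) * (Z powr (- D0 / 4)) ^ card S"
      proof -
        have "Z powr ((- D0 / 4) * card S) = (Z powr (- D0 / 4)) powr card S" by (simp only: powr_powr)
        also have "\<dots> = (Z powr (- D0 / 4)) ^ card S" by (rule powr_realpow) (use Z in simp)
        finally show ?thesis unfolding powr_add by simp
      qed
      finally have 1: "Z powr (- ((card S * D0 + M) / 4)) = Z powr (- M / 4) * (Z powr (- D0 / 4)) ^ card S" .
      have "(exp (q * Z)) ^ (card S * k) = exp (real (card S * k) * (q * Z))"
        by (rule exp_of_nat_mult[symmetric])
      also have "real (card S * k) * (q * Z) = real (card S) * (q * k * Z)" by simp
      also have "exp \<dots> = (exp (q * k * Z)) ^ card S" by (rule exp_of_nat_mult)
      finally show ?thesis unfolding 1 y_def power_mult_distrib by simp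
    qed
    finally show ?thesis .
  qed
  have "rs_exp q (cpairs N) (\<lambda>E. of_bool (dense_nbhds E)) \<le> (\<Sum>s\<in>UNIV \<times> Pow {..<N}.
      rs_exp q (cpairs N) (\<lambda>E. of_bool ((card (snd s) * D0 + M) / 4 \<le> real (card (E \<inter> B (fst s) (snd s))))))"
    using le by (intro rs_exp_union_bound q) auto
  also have "\<dots> \<le> (\<Sum>s\<in>(UNIV :: bool set) \<times> Pow {..<N}. Z powr (- M / 4) * y ^ card (snd s))"
    using each by (intro sum_mono) auto
  also have "\<dots> = (\<Sum>c\<in>(UNIV :: bool set). \<Sum>S\<in>Pow {..<N}. Z powr (- M / 4) * y ^ card S)"
    by (simp only: sum.cartesian_product case_prod_unfold)
  also have "\<dots> = 2 * (Z powr (- M / 4) * (1 + y) ^ N)"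
    by (simp add: sum_distrib_left[symmetric] sum_Pow_power_card)
  also have "\<dots> \<le> 2 * (Z powr (- M / 4) * exp 1)"
  proof (intro mult_left_mono)
    have "(1 + y) ^ N \<le> (exp y) ^ N" using y0 by (intro power_mono) auto
    also have "\<dots> = exp (N * y)" by (rule exp_of_nat_mult[symmetric])
    also have "\<dots> \<le> exp 1" using small by (simp add: y_def)
    finally show "(1 + y) ^ N \<le> exp 1" .
  qed auto
  finally show ?thesis by (simp add: mult_ac)
qed

lemma prob_many_cherries:
  fixes q \<theta> :: real
  assumes q: "0 \<le> q" "q \<le> 1" and D0: "0 < D0"
  defines "\<theta> \<equiv> 1 / (f * D0)\<^sup>2"
  shows "rs_exp q (cpairs N) (\<lambda>E. of_bool (many_cherries E))
    \<le> 2 * exp (- \<theta> * c1 + N * (\<theta> * q\<^sup>2 * k\<^sup>2))"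
proof -
  have th: "0 < \<theta>" using D0 f_ge_1 by (simp add: \<theta>_def)
  define S where "S c = {..<N} - R c" for c
  define B where "B c v = Pair c ` (\<lambda>u. {u, v}) ` R c" for c :: bool and v
  have finB: "finite (B c v)" for c v by (simp add: B_def)
  have Bsub: "B c v \<subseteq> cpairs N" if "v \<in> S c" for c v
    using that R_less cpairs_edge by (fastforce simp: S_def B_def)
  have Bdisj: "B c v \<inter> B c w = {}" if "v \<in> S c" "w \<in> S c" "v \<noteq> w" for c v w
    using that by (auto simp: S_def B_def doubleton_eq_iff)
  have loc: "cherries E c v = cherries (E \<inter> B c v) c v" for E c v
  proof -
    have "link E c v = link (E \<inter> B c v) c v" by (auto simp: link_def B_def R_def)
    thus ?thesis by (simp add: cherries_def)
  qed
  have le: "of_bool (many_cherries E) \<le> (\<Sum>c\<in>UNIV. exp (- \<theta> * c1) * (\<Prod>v\<in>S c. 1 + 2 * \<theta> * cherries (E \<inter> B c v) c v))"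
    for E
  proof (cases "many_cherries E")
    case True
    then obtain c where c: "c1 < (\<Sum>v | v < N \<and> v \<notin> R c \<and> rdeg E c v < D0. real (cherries E c v))"
      by (auto simp: many_cherries_def)
    define X where "X = {v. v < N \<and> v \<notin> R c \<and> rdeg E c v < D0}"
    have X: "finite X" "X \<subseteq> S c" by (auto simp: X_def S_def)
    have "1 \<le> exp (- \<theta> * c1) * exp (\<theta> * (\<Sum>v\<in>X. real (cherries E c v)))"
      using c th by (simp add: X_def exp_add[symmetric])
    also have "exp (\<theta> * (\<Sum>v\<in>X. real (cherries E c v))) = (\<Prod>v\<in>X. exp (\<theta> * real (cherries E c v)))"
      using X by (simp add: sum_distrib_left exp_sum)
    also have "exp (- \<theta> * c1) * (\<Prod>v\<in>X. exp (\<theta> * real (cherries E c v)))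
      \<le> exp (- \<theta> * c1) * (\<Prod>v\<in>X. 1 + 2 * \<theta> * cherries E c v)"
    proof (intro mult_left_mono prod_mono conjI)
      fix v assume v: "v \<in> X"
      have "real (card (link E c v)) \<le> f * D0"
        using order.trans[OF card_link_le[of E c v], of "f * D0"] v f_ge_1 by (auto simp: X_def)
      hence "(real (card (link E c v)))\<^sup>2 \<le> (f * D0)\<^sup>2" by (intro power_mono) auto
      hence "real (cherries E c v) \<le> (f * D0)\<^sup>2" using cherries_le[of E c v] by linarith
      hence "\<theta> * real (cherries E c v) \<le> 1" using D0 f_ge_1 by (simp add: \<theta>_def field_simps)
      hence "exp (\<theta> * real (cherries E c v)) \<le> 1 + \<theta> * real (cherries E c v) + (\<theta> * real (cherries E c v))\<^sup>2"
        using th by (intro exp_bound) auto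
      also have "(\<theta> * real (cherries E c v))\<^sup>2 \<le> \<theta> * real (cherries E c v)"
        using th \<open>\<theta> * real (cherries E c v) \<le> 1\<close>
        unfolding power2_eq_square by (intro mult_left_le) auto
      finally show "exp (\<theta> * real (cherries E c v)) \<le> 1 + 2 * \<theta> * cherries E c v" by simp
    qed auto
    also have "(\<Prod>v\<in>X. 1 + 2 * \<theta> * cherries E c v) \<le> (\<Prod>v\<in>S c. 1 + 2 * \<theta> * cherries E c v)"
      using X th by (intro prod_mono2) (auto simp: S_def)
    also have "(\<Prod>v\<in>S c. 1 + 2 * \<theta> * cherries E c v) = (\<Prod>v\<in>S c. 1 + 2 * \<theta> * cherries (E \<inter> B c v) c v)"
      using loc[of E c] by (intro prod.cong) auto
    also have "exp (- \<theta> * c1) * \<dots> \<le> (\<Sum>c\<in>UNIV. exp (- \<theta> * c1) * (\<Prod>v\<in>S c. 1 + 2 * \<theta> * cherries (E \<inter> B c v) c v))"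
      using th by (intro member_le_sum[of c]) (auto intro!: mult_nonneg_nonneg prod_nonneg)
    finally show ?thesis using True by simp
  qed (use th in \<open>auto intro!: sum_nonneg mult_nonneg_nonneg prod_nonneg\<close>)
  have one: "rs_exp q (B c v) (\<lambda>X. 1 + 2 * \<theta> * cherries X c v) \<le> exp (\<theta> * q\<^sup>2 * k\<^sup>2)" if v: "v \<in> S c" for c v
  proof -
    define Y where "Y = {\<tau>\<in>nsets I 2. card (p c ` \<tau>) = 2}"
    have finY: "finite Y" by (simp add: Y_def fin_I finite_imp_finite_nsets)
    have "real (card Y) \<le> real (card (nsets I 2))"
      by (intro of_nat_mono card_mono) (auto simp: Y_def fin_I finite_imp_finite_nsets)
    also have "\<dots> \<le> (real k)\<^sup>2 / 2" using card_nsets_2_le_square[of I] card_I by simp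
    finally have cY: "2 * real (card Y) \<le> (real k)\<^sup>2" by simp
    have pr: "rs_exp q (B c v) (\<lambda>X. of_bool (\<tau> \<subseteq> link X c v)) = q\<^sup>2" if \<tau>: "\<tau> \<in> Y" for \<tau>
    proof -
      define A where "A = (\<lambda>x. (c, {p c x, v})) ` \<tau>"
      have tI: "\<tau> \<subseteq> I" using \<tau> by (auto simp: Y_def nsets_def)
      have "A = Pair c ` (\<lambda>u. {u, v}) ` p c ` \<tau>" by (simp add: A_def image_image)
      moreover have "inj_on (\<lambda>u. {u, v}) (p c ` \<tau>)" by (auto simp: inj_on_def doubleton_eq_iff)
      ultimately have cA: "card A = 2" using \<tau> by (simp add: Y_def card_image inj_on_def)
      have AB: "A \<subseteq> B c v" using tI by (auto simp: A_def B_def R_def)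
      have "\<tau> \<subseteq> link X c v \<longleftrightarrow> A \<subseteq> X" for X using tI by (auto simp: A_def link_def)
      thus ?thesis using rs_exp_contains[OF finB AB, of q "\<lambda>_. 1"] cA finB by simp
    qed
    have ch: "real (cherries X c v) = (\<Sum>\<tau>\<in>Y. of_bool (\<tau> \<subseteq> link X c v))" for X
    proof -
      have "{\<tau>\<in>nsets I 2. card (p c ` \<tau>) = 2 \<and> \<tau> \<subseteq> link X c v} = Y \<inter> {\<tau>. \<tau> \<subseteq> link X c v}"
        by (auto simp: Y_def)
      thus ?thesis using finY by (simp add: cherries_def)
    qed
    have "rs_exp q (B c v) (\<lambda>X. 1 + 2 * \<theta> * cherries X c v)
      = 1 + 2 * \<theta> * (\<Sum>\<tau>\<in>Y. rs_exp q (B c v) (\<lambda>X. of_bool (\<tau> \<subseteq> link X c v)))"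
      unfolding ch rs_exp_add rs_exp_cmult rs_exp_sum using finB by simp
    also have "\<dots> = 1 + \<theta> * q\<^sup>2 * (2 * real (card Y))" using pr by simp
    also have "\<dots> \<le> 1 + \<theta> * q\<^sup>2 * (real k)\<^sup>2" using cY th by (intro add_left_mono mult_left_mono) auto
    also have "\<dots> \<le> exp (\<theta> * q\<^sup>2 * (real k)\<^sup>2)" by (rule exp_ge_add_one_self)
    finally show ?thesis by simp
  qed
  have "rs_exp q (cpairs N) (\<lambda>E. of_bool (many_cherries E))
     \<le> rs_exp q (cpairs N) (\<lambda>E. \<Sum>c\<in>UNIV. exp (- \<theta> * c1) * (\<Prod>v\<in>S c. 1 + 2 * \<theta> * cherries (E \<inter> B c v) c v))"
    by (intro rs_exp_mono q le)
  also have "\<dots> = (\<Sum>c\<in>UNIV. exp (- \<theta> * c1) * (\<Prod>v\<in>S c. rs_exp q (B c v) (\<lambda>X. 1 + 2 * \<theta> * cherries X c v)))"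
    unfolding rs_exp_sum rs_exp_cmult
    using Bsub Bdisj by (intro sum.cong refl arg_cong2[of _ _ _ _ "(*)"] rs_exp_prod) (auto simp: S_def)
  also have "\<dots> \<le> (\<Sum>c\<in>(UNIV :: bool set). exp (- \<theta> * c1) * exp (N * (\<theta> * q\<^sup>2 * k\<^sup>2)))"
  proof (intro sum_mono mult_left_mono)
    fix c
    have "(\<Prod>v\<in>S c. rs_exp q (B c v) (\<lambda>X. 1 + 2 * \<theta> * cherries X c v)) \<le> (\<Prod>v\<in>S c. exp (\<theta> * q\<^sup>2 * k\<^sup>2))"
      using one th q by (intro prod_mono) (auto intro!: rs_exp_nonneg)
    also have "\<dots> = exp (card (S c) * (\<theta> * q\<^sup>2 * k\<^sup>2))" by (simp add: exp_of_nat_mult[symmetric])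
    also have "\<dots> \<le> exp (N * (\<theta> * q\<^sup>2 * k\<^sup>2))"
    proof -
      have "card (S c) \<le> N" using card_mono[of "{..<N}" "S c"] by (simp add: S_def)
      thus ?thesis using th by (simp add: mult_right_mono)
    qed
    finally show "(\<Prod>v\<in>S c. rs_exp q (B c v) (\<lambda>X. 1 + 2 * \<theta> * cherries X c v)) \<le> exp (N * (\<theta> * q\<^sup>2 * k\<^sup>2))" .
  qed auto
  also have "\<dots> = 2 * exp (- \<theta> * c1 + N * (\<theta> * q\<^sup>2 * k\<^sup>2))" by (simp add: exp_add[symmetric])
  finally show ?thesis .
qed

text \<open>Summing over \<open>F\<close>, presence of \<open>F\<close> and closedness in
  \<open>E - F\<close> depend on disjoint sets of pairs, and \<open>rs_exp_remove_le\<close> lets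
  the latter be evaluated on an unrestricted random set. For a fixed outcome there are then only
  subsets of a closed set of bounded size to sum, with the size condition encoded as
  \<open>1 \<le> Z powr (card F - t1)\<close>.\<close>

lemma prob_many_closed:
  fixes q Z :: real
  assumes q: "0 \<le> q" "q < 1" and Z: "1 \<le> Z"
  shows "rs_exp q (cpairs N) (\<lambda>E. of_bool (many_closed E))
    \<le> Z powr (- t1) * exp (q / (1 - q) * Z * (4 * (k * f + D1 * f * M + k * (f * D0)\<^sup>2 + c1)))"
proof -
  define cl where "cl = 4 * (k * f + D1 * f * M + k * (f * D0)\<^sup>2 + c1)"
  define ok where "ok E \<longleftrightarrow> \<not> dense_nbhds E \<and> \<not> many_cherries E" for E
  define \<F> where "\<F> = {F\<in>Pow inner. t1 \<le> card F}"
  define \<mu> where "\<mu> = q / (1 - q)"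
  have l0: "0 \<le> \<mu>" using q by (simp add: \<mu>_def)
  have finF: "finite \<F>" by (simp add: \<F>_def)
  define G where "G F E = (of_bool (F \<subseteq> closed_pairs E \<and> ok E) :: real)" for F E
  have le: "of_bool (many_closed E) \<le> (\<Sum>F\<in>\<F>. of_bool (F \<subseteq> E) * G F (E - F))" for E
  proof (cases "many_closed E")
    case True
    then obtain F where F: "F \<in> \<F>" "F \<subseteq> E" "F \<subseteq> closed_pairs (E - F)" "ok (E - F)"
      by (auto simp: many_closed_def \<F>_def ok_def)
    hence "1 \<le> of_bool (F \<subseteq> E) * G F (E - F)" by (simp add: G_def)
    also have "\<dots> \<le> (\<Sum>F\<in>\<F>. of_bool (F \<subseteq> E) * G F (E - F))"
      using F finF by (intro member_le_sum) (auto simp: G_def)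
    finally show ?thesis using True by simp
  qed (auto intro!: sum_nonneg simp: G_def)
  have "rs_exp q (cpairs N) (\<lambda>E. of_bool (many_closed E))
      \<le> (\<Sum>F\<in>\<F>. rs_exp q (cpairs N) (\<lambda>E. of_bool (F \<subseteq> E) * G F (E - F)))"
    unfolding rs_exp_sum[symmetric] using q by (intro rs_exp_mono le) auto
  also have "\<dots> \<le> (\<Sum>F\<in>\<F>. \<mu> ^ card F * rs_exp q (cpairs N) (G F))"
  proof (rule sum_mono)
    fix F assume "F \<in> \<F>"
    hence F: "F \<subseteq> cpairs N" using inner_sub by (auto simp: \<F>_def)
    have "rs_exp q (cpairs N) (\<lambda>E. of_bool (F \<subseteq> E) * G F (E - F)) = q ^ card F * rs_exp q (cpairs N - F) (G F)"
      using F by (intro rs_exp_contains) auto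
    also have "\<dots> \<le> q ^ card F * ((1 / (1 - q)) ^ card F * rs_exp q (cpairs N) (G F))"
      using q F by (intro mult_left_mono rs_exp_remove_le) (auto simp: G_def)
    also have "\<dots> = \<mu> ^ card F * rs_exp q (cpairs N) (G F)"
      by (simp add: \<mu>_def power_divide)
    finally show "rs_exp q (cpairs N) (\<lambda>E. of_bool (F \<subseteq> E) * G F (E - F)) \<le> \<mu> ^ card F * rs_exp q (cpairs N) (G F)" .
  qed
  also have "\<dots> = rs_exp q (cpairs N) (\<lambda>E. \<Sum>F\<in>\<F>. \<mu> ^ card F * G F E)"
    by (simp only: rs_exp_sum rs_exp_cmult)
  also have "\<dots> \<le> rs_exp q (cpairs N) (\<lambda>_. Z powr (- t1) * exp (\<mu> * Z * cl))"
  proof (rule rs_exp_mono)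
    fix E
    show "(\<Sum>F\<in>\<F>. \<mu> ^ card F * G F E) \<le> Z powr (- t1) * exp (\<mu> * Z * cl)"
    proof (cases "ok E")
      case False
      thus ?thesis by (simp add: G_def)
    next
      case True
      have fc: "finite (closed_pairs E)" using closed_pairs_inner finite_inner by (rule finite_subset)
      have cc: "card (closed_pairs E) \<le> cl"
        using True card_closed_pairs_le[of E] by (simp add: ok_def cl_def)
      have "(\<Sum>F\<in>\<F>. \<mu> ^ card F * G F E) \<le> (\<Sum>F\<in>\<F>. of_bool (F \<subseteq> closed_pairs E) * (Z powr (- t1) * (\<mu> * Z) ^ card F))"
      proof (rule sum_mono)
        fix F assume "F \<in> \<F>"
        hence "1 \<le> Z powr (real (card F) - t1)" using Z by (intro ge_one_powr_ge_zero) (auto simp: \<F>_def)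
        also have "\<dots> = Z powr (- t1) * Z ^ card F"
          using Z by (simp add: powr_realpow[symmetric] powr_add[symmetric])
        finally have "\<mu> ^ card F * 1 \<le> \<mu> ^ card F * (Z powr (- t1) * Z ^ card F)"
          using l0 by (intro mult_left_mono) auto
        thus "\<mu> ^ card F * G F E \<le> of_bool (F \<subseteq> closed_pairs E) * (Z powr (- t1) * (\<mu> * Z) ^ card F)"
          using l0 Z by (auto simp: G_def power_mult_distrib mult_ac)
      qed
      also have "\<dots> \<le> (\<Sum>F\<in>Pow (closed_pairs E). Z powr (- t1) * (\<mu> * Z) ^ card F)"
      proof -
        have "(\<Sum>F\<in>\<F>. of_bool (F \<subseteq> closed_pairs E) * (Z powr (- t1) * (\<mu> * Z) ^ card F))
          = (\<Sum>F\<in>\<F> \<inter> Pow (closed_pairs E). Z powr (- t1) * (\<mu> * Z) ^ card F)"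
          unfolding sum.inter_restrict[OF finF] by (intro sum.cong) auto
        also have "\<dots> \<le> (\<Sum>F\<in>Pow (closed_pairs E). Z powr (- t1) * (\<mu> * Z) ^ card F)"
          using fc l0 Z by (intro sum_mono2) auto
        finally show ?thesis .
      qed
      also have "\<dots> = Z powr (- t1) * (1 + \<mu> * Z) ^ card (closed_pairs E)"
        using fc by (simp add: sum_distrib_left[symmetric] sum_Pow_power_card)
      also have "\<dots> \<le> Z powr (- t1) * (exp (\<mu> * Z)) ^ card (closed_pairs E)"
        using l0 Z by (intro mult_left_mono power_mono) auto
      also have "(exp (\<mu> * Z)) ^ card (closed_pairs E) = exp (\<mu> * Z * card (closed_pairs E))"
        by (simp add: exp_of_nat_mult[symmetric] mult_ac)
      also have "Z powr (- t1) * \<dots> \<le> Z powr (- t1) * exp (\<mu> * Z * cl)"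
        using cc l0 Z by (intro mult_left_mono) (auto intro!: mult_left_mono)
      finally show ?thesis .
    qed
  qed (use q in auto)
  also have "\<dots> = Z powr (- t1) * exp (\<mu> * Z * cl)" by simp
  finally show ?thesis by (simp add: \<mu>_def cl_def)
qed

text \<open>Union bound over certificates. The probability \<open>q ^ card A\<close> of
  \<open>A \<subseteq> E\<close> cancels the \<open>q\<close> in \<open>key\<close> and leaves the
  weight \<open>(1 / h) ^ card A\<close>; since \<open>A\<close> is a subset of at most
  \<open>h * k\<close> star edges, these weights sum to at most \<open>exp k\<close>. Choosing
  \<open>H\<close> costs \<open>(2 * N) powr h * exp 1\<close>. Open pairs outside \<open>A\<close>
  are independent of the event \<open>A \<subseteq> E\<close>, so the lower tail applies to
  them.\<close>

lemma prob_few_open: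
  fixes q z W :: real
  assumes q: "0 < q" "q < 1" and z: "0 < z" "z \<le> 1" and h0: "0 < h" and N0: "0 < N" and W0: "0 \<le> W"
    and key: "\<And>H A. admissible H A \<Longrightarrow>
      exp (- (q * (1 - z) * (real (card (open_pairs H A)) - card A))) \<le> W * (1 / (q * h)) ^ card A"
  shows "rs_exp q (cpairs N) (\<lambda>E. of_bool (few_open E))
    \<le> z powr (- 5 * t1) * W * ((2 * N) powr h * exp (1 + k))"
proof -
  define \<H> where "\<H> = {H\<in>Pow ((UNIV :: bool set) \<times> {..<N}). card H \<le> h}"
  define \<A> where "\<A> H = Pow (star_edges H \<inter> cpairs N)" for H
  have finH: "finite \<H>" by (simp add: \<H>_def)
  have finH': "finite H" if "H \<in> \<H>" for H
    by (rule finite_subset[of _ "UNIV \<times> {..<N}"]) (use that in \<open>auto simp: \<H>_def\<close>)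
  have finA: "finite (\<A> H)" for H by (simp add: \<A>_def)
  define G where "G H A E = (of_bool (A \<subseteq> E) * of_bool (real (card ((E - A) \<inter> (open_pairs H A - A))) \<le> 5 * t1) :: real)"
    for H A E
  have le: "of_bool (few_open E) \<le> (\<Sum>H\<in>\<H>. \<Sum>A\<in>\<A> H. of_bool (admissible H A) * G H A E)" if "E \<subseteq> cpairs N" for E
  proof (cases "few_open E")
    case True
    then obtain H A where HA: "admissible H A" "A \<subseteq> E" "card (E \<inter> open_pairs H A) \<le> 5 * t1"
      by (auto simp: few_open_def)
    have H: "H \<in> \<H>" and A: "A \<in> \<A> H" using HA(1) by (auto simp: \<H>_def \<A>_def admissible_def)
    have "card ((E - A) \<inter> (open_pairs H A - A)) \<le> card (E \<inter> open_pairs H A)"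
      using that finite_subset[OF that] by (intro card_mono) auto
    hence "1 \<le> of_bool (admissible H A) * G H A E" using HA by (simp add: G_def)
    also have "\<dots> \<le> (\<Sum>A\<in>\<A> H. of_bool (admissible H A) * G H A E)"
      using A finA by (intro member_le_sum) (auto simp: G_def)
    also have "\<dots> \<le> (\<Sum>H\<in>\<H>. \<Sum>A\<in>\<A> H. of_bool (admissible H A) * G H A E)"
      using H finH by (intro member_le_sum[of H]) (auto simp: G_def intro!: sum_nonneg)
    finally show ?thesis using True by simp
  qed (auto intro!: sum_nonneg simp: G_def)
  define P where "P = z powr (- 5 * t1) * W"
  have P0: "0 \<le> P" using W0 by (simp add: P_def)
  have each: "of_bool (admissible H A) * rs_exp q (cpairs N) (G H A) \<le> P * (1 / h) ^ card A" if HA: "A \<in> \<A> H" for H A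
  proof (cases "admissible H A")
    case False
    thus ?thesis using P0 h0 by simp
  next
    case True
    have A: "A \<subseteq> cpairs N" using HA by (auto simp: \<A>_def)
    have O: "open_pairs H A - A \<subseteq> cpairs N - A" using open_pairs_inner inner_sub by blast
    have fA: "finite A" using A finite_cpairs by (rule finite_subset)
    have "rs_exp q (cpairs N) (G H A) = q ^ card A *
        rs_exp q (cpairs N - A) (\<lambda>E. of_bool (real (card (E \<inter> (open_pairs H A - A))) \<le> 5 * t1))"
      unfolding G_def using A by (intro rs_exp_contains) auto
    also have "\<dots> \<le> q ^ card A * (z powr (- (5 * t1)) * (1 - q + q * z) ^ card (open_pairs H A - A))"
      using q z O by (intro mult_left_mono rs_exp_lower_tail) auto
    also have "(1 - q + q * z) ^ card (open_pairs H A - A) \<le> (exp (- (q * (1 - z)))) ^ card (open_pairs H A - A)"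
    proof (rule power_mono)
      show "1 - q + q * z \<le> exp (- (q * (1 - z)))"
        using exp_ge_add_one_self[of "- (q * (1 - z))"] by (simp add: algebra_simps)
      have "0 \<le> q * z" using q z by simp
      thus "0 \<le> 1 - q + q * z" using q by linarith
    qed
    also have "\<dots> = exp (- (q * (1 - z) * card (open_pairs H A - A)))"
      by (simp add: exp_of_nat_mult[symmetric] mult_ac)
    also have "\<dots> \<le> exp (- (q * (1 - z) * (real (card (open_pairs H A)) - card A)))"
    proof -
      have "card (open_pairs H A) - card A \<le> card (open_pairs H A - A)" by (rule diff_card_le_card_Diff[OF fA])
      hence "real (card (open_pairs H A)) - card A \<le> card (open_pairs H A - A)" by linarith
      hence "q * (1 - z) * (real (card (open_pairs H A)) - card A) \<le> q * (1 - z) * card (open_pairs H A - A)"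
        using q z by (intro mult_left_mono) auto
      thus ?thesis by simp
    qed
    also have "\<dots> \<le> W * (1 / (q * h)) ^ card A" by (rule key[OF True])
    finally have "rs_exp q (cpairs N) (G H A) \<le> q ^ card A * (z powr (- (5 * t1)) * (W * (1 / (q * h)) ^ card A))"
      using q by (simp add: mult_left_mono)
    also have "\<dots> = P * (q * (1 / (q * h))) ^ card A" unfolding power_mult_distrib by (simp add: P_def)
    also have "q * (1 / (q * h)) = 1 / h" using q by simp
    finally show ?thesis using True by simp
  qed
  have sumA: "(\<Sum>A\<in>\<A> H. P * (1 / h) ^ card A) \<le> P * exp k" if H: "H \<in> \<H>" for H
  proof -
    have "(\<Sum>A\<in>\<A> H. P * (1 / h) ^ card A) = P * (1 + 1 / h) ^ card (star_edges H \<inter> cpairs N)"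
      unfolding \<A>_def sum_distrib_left[symmetric] by (subst sum_Pow_power_card) auto
    also have "\<dots> \<le> P * (exp (1 / h)) ^ card (star_edges H \<inter> cpairs N)"
      using P0 h0 by (intro mult_left_mono power_mono) auto
    also have "(exp (1 / h)) ^ card (star_edges H \<inter> cpairs N) = exp (card (star_edges H \<inter> cpairs N) * (1 / h))"
      by (simp add: exp_of_nat_mult[symmetric])
    also have "P * \<dots> \<le> P * exp k"
    proof (intro mult_left_mono P0)
      have "card (star_edges H \<inter> cpairs N) \<le> card (star_edges H)"
        by (intro card_mono finite_star_edges finH' H) auto
      also have "\<dots> \<le> card H * k" by (intro finite_star_edges finH' H)
      finally have "real (card (star_edges H \<inter> cpairs N)) \<le> real (card H) * k"
        by (metis of_nat_le_iff of_nat_mult)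
      also have "\<dots> \<le> h * k" using H by (intro mult_right_mono) (auto simp: \<H>_def)
      finally show "exp (card (star_edges H \<inter> cpairs N) * (1 / h)) \<le> exp k" using h0 by (simp add: field_simps)
    qed
    finally show ?thesis .
  qed
  have cardH: "real (card \<H>) \<le> (2 * N) powr h * exp 1"
  proof -
    have "real (card \<H>) = (\<Sum>H\<in>\<H>. 1)" by simp
    also have "\<dots> \<le> (\<Sum>H\<in>\<H>. (2 * N) powr h * (1 / (2 * N)) ^ card H)"
    proof (rule sum_mono)
      fix H assume "H \<in> \<H>"
      hence "1 \<le> (2 * real N) powr (h - card H)" using N0 by (intro ge_one_powr_ge_zero) (auto simp: \<H>_def)
      also have "\<dots> = (2 * N) powr h * (1 / (2 * N)) ^ card H"
        using N0 by (simp add: powr_diff powr_realpow power_divide)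
      finally show "1 \<le> (2 * N) powr h * (1 / (2 * N)) ^ card H" .
    qed
    also have "\<dots> \<le> (\<Sum>H\<in>Pow ((UNIV :: bool set) \<times> {..<N}). (2 * N) powr h * (1 / (2 * N)) ^ card H)"
      by (intro sum_mono2) (auto simp: \<H>_def)
    also have "\<dots> = (2 * N) powr h * (1 + 1 / (2 * N)) ^ (2 * N)"
      unfolding sum_distrib_left[symmetric] by (subst sum_Pow_power_card) (auto simp: card_cartesian_product)
    also have "\<dots> \<le> (2 * N) powr h * (exp (1 / (2 * N))) ^ (2 * N)"
      by (intro mult_left_mono power_mono exp_ge_add_one_self) auto
    also have "(exp (1 / real (2 * N))) ^ (2 * N) = exp 1"
      using N0 by (simp add: exp_of_nat_mult[symmetric])
    finally show ?thesis by simp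
  qed
  have "rs_exp q (cpairs N) (\<lambda>E. of_bool (few_open E))
      \<le> rs_exp q (cpairs N) (\<lambda>E. \<Sum>H\<in>\<H>. \<Sum>A\<in>\<A> H. of_bool (admissible H A) * G H A E)"
    using q by (intro rs_exp_mono le) auto
  also have "\<dots> = (\<Sum>H\<in>\<H>. \<Sum>A\<in>\<A> H. of_bool (admissible H A) * rs_exp q (cpairs N) (G H A))"
    by (simp only: rs_exp_sum rs_exp_cmult)
  also have "\<dots> \<le> (\<Sum>H\<in>\<H>. \<Sum>A\<in>\<A> H. P * (1 / h) ^ card A)" using each by (intro sum_mono) auto
  also have "\<dots> \<le> (\<Sum>H\<in>\<H>. P * exp k)" using sumA by (intro sum_mono) auto
  also have "\<dots> = real (card \<H>) * (P * exp k)" by simp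
  also have "\<dots> \<le> ((2 * N) powr h * exp 1) * (P * exp k)"
    using P0 cardH by (intro mult_right_mono) auto
  also have "\<dots> = P * ((2 * N) powr h * exp (1 + k))" by (simp add: exp_add)
  finally show ?thesis by (simp add: P_def)
qed

end

subsection \<open>Existence of a good pair of projections and colourings\<close>

lemma prob_degree:
  fixes q Z d1 :: real
  assumes q: "0 \<le> q" "q \<le> 1" and Z: "1 \<le> Z" and d1: "0 \<le> d1"
  shows "rs_exp q (cpairs N) (\<lambda>E. of_bool (\<exists>c v. d1 < card {u. (c, {u, v}) \<in> E}))
    \<le> 2 * N * (Z powr (- d1) * exp (q * N * (Z - 1)))"
proof -
  define B where "B c v = {(c, {u, v}) |u. u < N \<and> u \<noteq> v}" for c :: bool and v
  have B_img: "B c v = (\<lambda>u. (c, {u, v})) ` ({..<N} - {v})" for c v by (auto simp: B_def)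
  have finB: "finite (B c v)" for c v unfolding B_img by simp
  have cB: "card (B c v) \<le> N" for c v
  proof -
    have "card (B c v) \<le> card ({..<N} - {v})" unfolding B_img by (rule card_image_le) simp
    also have "\<dots> \<le> card {..<N}" by (rule card_mono) auto
    finally show ?thesis by simp
  qed
  have le: "\<exists>s\<in>UNIV \<times> {..<N}. d1 \<le> real (card (E \<inter> B (fst s) (snd s)))"
    if E: "E \<subseteq> cpairs N" and ex: "\<exists>c v. d1 < card {u. (c, {u, v}) \<in> E}" for E
  proof -
    obtain c v where cv: "d1 < card {u. (c, {u, v}) \<in> E}" using ex by auto
    have "{u. (c, {u, v}) \<in> E} \<noteq> {}"
    proof
      assume "{u. (c, {u, v}) \<in> E} = {}"
      thus False using cv d1 by simp
    qed
    then obtain u where "(c, {u, v}) \<in> cpairs N" using E by auto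
    hence v: "v < N" unfolding cpairs_edge by simp
    have "card {u. (c, {u, v}) \<in> E} \<le> card (E \<inter> B c v)"
    proof (rule card_inj_on_le[of "\<lambda>u. (c, {u, v})"])
      show "inj_on (\<lambda>u. (c, {u, v})) {u. (c, {u, v}) \<in> E}" by (auto simp: inj_on_def doubleton_eq_iff)
      show "(\<lambda>u. (c, {u, v})) ` {u. (c, {u, v}) \<in> E} \<subseteq> E \<inter> B c v"
      proof
        fix x assume "x \<in> (\<lambda>u. (c, {u, v})) ` {u. (c, {u, v}) \<in> E}"
        then obtain u where u: "x = (c, {u, v})" "(c, {u, v}) \<in> E" by auto
        hence "(c, {u, v}) \<in> cpairs N" using E by auto
        thus "x \<in> E \<inter> B c v" using u unfolding cpairs_edge B_def by auto
      qed
    qed (use finB in auto)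
    thus ?thesis using cv v by (intro bexI[of _ "(c, v)"]) auto
  qed
  have each: "rs_exp q (cpairs N) (\<lambda>E. of_bool (d1 \<le> real (card (E \<inter> B c v)))) \<le> Z powr (- d1) * exp (q * N * (Z - 1))"
    if v: "v < N" for c v
  proof -
    have sub: "B c v \<subseteq> cpairs N" using v cpairs_edge by (auto simp: B_def)
    have b1: "1 \<le> 1 - q + q * Z" using q Z mult_left_mono[of 1 Z q] by simp
    have "rs_exp q (cpairs N) (\<lambda>E. of_bool (d1 \<le> real (card (E \<inter> B c v)))) \<le> Z powr (- d1) * (1 - q + q * Z) ^ card (B c v)"
      using rs_exp_upper_tail[OF finite_cpairs sub q Z, of d1] by simp
    also have "\<dots> \<le> Z powr (- d1) * exp (q * N * (Z - 1))"
    proof (rule mult_left_mono)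
      have "(1 - q + q * Z) ^ card (B c v) \<le> (1 - q + q * Z) ^ N" using b1 cB by (intro power_increasing) auto
      also have "\<dots> \<le> (exp (q * (Z - 1))) ^ N"
        using b1 exp_ge_add_one_self[of "q * (Z - 1)"] by (intro power_mono) (auto simp: algebra_simps)
      also have "\<dots> = exp (real N * (q * (Z - 1)))" by (rule exp_of_nat_mult[symmetric])
      finally show "(1 - q + q * Z) ^ card (B c v) \<le> exp (q * N * (Z - 1))" by (simp add: mult_ac)
    qed simp
    finally show ?thesis .
  qed
  have "rs_exp q (cpairs N) (\<lambda>E. of_bool (\<exists>c v. d1 < card {u. (c, {u, v}) \<in> E})) \<le> (\<Sum>s\<in>UNIV \<times> {..<N}.
      rs_exp q (cpairs N) (\<lambda>E. of_bool (d1 \<le> real (card (E \<inter> B (fst s) (snd s))))))"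
    using le by (intro rs_exp_union_bound q) auto
  also have "\<dots> \<le> (\<Sum>s\<in>(UNIV :: bool set) \<times> {..<N}. Z powr (- d1) * exp (q * N * (Z - 1)))"
    using each by (intro sum_mono) auto
  finally show ?thesis by (simp add: card_cartesian_product mult_ac)
qed

text \<open>First moment over \<open>v\<close>, \<open>w\<close> and \<open>Suc \<kappa>\<close>
  common neighbours. The \<open>2 * Suc \<kappa>\<close> edges involved are distinct because the
  common neighbours differ from \<open>v\<close> and \<open>w\<close>. A constant
  \<open>\<kappa>\<close> suffices once \<open>N * q\<^sup>2\<close> is a negative power of
  \<open>n\<close>.\<close>

lemma prob_codegree:
  fixes q :: real
  assumes q: "0 \<le> q" "q \<le> 1"
  shows "rs_exp q (cpairs N) (\<lambda>E. of_bool (\<exists>c v w. v \<noteq> w \<and> \<kappa> < card {u. (c, {u, v}) \<in> E \<and> (c, {u, w}) \<in> E}))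
    \<le> 2 * (real N)\<^sup>2 * (N * q\<^sup>2) ^ Suc \<kappa>"
proof -
  define m where "m = Suc \<kappa>"
  define U where "U v w = {X. X \<subseteq> {..<N} - {v, w} \<and> card X = m}" for v w
  define A where "A c v w X = (\<lambda>u. (c, {u, v})) ` X \<union> (\<lambda>u. (c, {u, w})) ` X" for c :: bool and v w :: nat and X
  have finU: "finite (U v w)" for v w by (rule finite_subset[of _ "Pow {..<N}"]) (auto simp: U_def)
  have cU: "real (card (U v w)) \<le> real N ^ m" for v w
  proof -
    have "card (U v w) \<le> card {X. X \<subseteq> {..<N} \<and> card X = m}"
      by (rule card_mono) (auto simp: U_def)
    also have "\<dots> = N choose m" by (simp add: n_subsets)
    also have "\<dots> \<le> N ^ m" by (cases "m \<le> N") (auto intro: binomial_le_pow simp: binomial_eq_0)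
    finally have "real (card (U v w)) \<le> real (N ^ m)" by (rule of_nat_mono)
    thus ?thesis by simp
  qed
  define D where "D = ({..<N} \<times> {..<N}) \<inter> {(v, w). v \<noteq> w}"
  have finD: "finite D" by (simp add: D_def)
  have "card D \<le> card ({..<N} \<times> {..<N})" by (rule card_mono) (auto simp: D_def)
  hence "real (card D) \<le> real (N * N)" by (intro of_nat_mono) (simp add: card_cartesian_product)
  hence cD: "real (card D) \<le> (real N)\<^sup>2" by (simp add: power2_eq_square)
  define S where "S = (SIGMA d:(UNIV :: bool set) \<times> D. U (fst (snd d)) (snd (snd d)))"
  have fUD: "finite ((UNIV :: bool set) \<times> D)" using finD by simp
  have finS: "finite S" unfolding S_def by (rule finite_SigmaI[OF fUD finU])
  have le: "\<exists>s\<in>S. A (fst (fst s)) (fst (snd (fst s))) (snd (snd (fst s))) (snd s) \<subseteq> E"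
    if E: "E \<subseteq> cpairs N" and ex: "\<exists>c v w. v \<noteq> w \<and> \<kappa> < card {u. (c, {u, v}) \<in> E \<and> (c, {u, w}) \<in> E}" for E
  proof -
    obtain c v w where cv: "v \<noteq> w" "m \<le> card {u. (c, {u, v}) \<in> E \<and> (c, {u, w}) \<in> E}"
      using ex by (auto simp: m_def Suc_le_eq)
    obtain X where X: "X \<subseteq> {u. (c, {u, v}) \<in> E \<and> (c, {u, w}) \<in> E}" "card X = m"
      by (rule obtain_subset_with_card_n[OF cv(2)])
    have XX: "u < N \<and> v < N \<and> w < N \<and> u \<noteq> v \<and> u \<noteq> w" if "u \<in> X" for u
    proof -
      have "(c, {u, v}) \<in> cpairs N" "(c, {u, w}) \<in> cpairs N" using that X E by auto
      thus ?thesis unfolding cpairs_edge by auto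
    qed
    have "X \<noteq> {}" using X by (auto simp: m_def)
    hence "(v, w) \<in> D" using XX cv by (auto simp: D_def)
    moreover have "X \<in> U v w" using XX X by (auto simp: U_def)
    moreover have "A c v w X \<subseteq> E" using X by (auto simp: A_def)
    ultimately show ?thesis by (intro bexI[of _ "((c, v, w), X)"]) (auto simp: S_def)
  qed
  have each: "rs_exp q (cpairs N) (\<lambda>E. of_bool (A c v w X \<subseteq> E)) = q ^ (2 * m)" if vw: "(v, w) \<in> D" and X: "X \<in> U v w" for c v w X
  proof -
    have sub: "A c v w X \<subseteq> cpairs N"
    proof
      fix y assume "y \<in> A c v w X"
      then obtain u where "u \<in> X" "y = (c, {u, v}) \<or> y = (c, {u, w})" by (auto simp: A_def)
      moreover have "u < N \<and> v < N \<and> w < N \<and> u \<noteq> v \<and> u \<noteq> w" if "u \<in> X" for u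
        using that vw X by (auto simp: U_def D_def)
      ultimately show "y \<in> cpairs N" by (metis cpairs_edge)
    qed
    have fX: "finite X" using X finite_subset[of X "{..<N} - {v, w}"] by (auto simp: U_def)
    have i: "inj_on (\<lambda>u. (c, {u, y})) X" for y by (auto simp: inj_on_def doubleton_eq_iff)
    have XX: "v \<noteq> w" "u \<noteq> v" "u \<noteq> w" if "u \<in> X" for u
      using that vw X by (auto simp: U_def D_def)
    have "(\<lambda>u. (c, {u, v})) ` X \<inter> (\<lambda>u. (c, {u, w})) ` X = {}"
    proof (intro equals0I)
      fix y assume "y \<in> (\<lambda>u. (c, {u, v})) ` X \<inter> (\<lambda>u. (c, {u, w})) ` X"
      then obtain u u' where "u \<in> X" "u' \<in> X" "{u, v} = {u', w}" by auto
      thus False using XX[of u] XX[of u'] unfolding doubleton_eq_iff by auto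
    qed
    hence "card (A c v w X) = 2 * m"
      unfolding A_def using fX X by (subst card_Un_disjoint) (auto simp: card_image[OF i] U_def)
    moreover have "finite (cpairs N - A c v w X)" by simp
    ultimately show ?thesis using rs_exp_contains[OF finite_cpairs sub, of q "\<lambda>_. 1"] by simp
  qed
  have "rs_exp q (cpairs N) (\<lambda>E. of_bool (\<exists>c v w. v \<noteq> w \<and> \<kappa> < card {u. (c, {u, v}) \<in> E \<and> (c, {u, w}) \<in> E}))
    \<le> (\<Sum>s\<in>S. rs_exp q (cpairs N) (\<lambda>E. of_bool (A (fst (fst s)) (fst (snd (fst s))) (snd (snd (fst s))) (snd s) \<subseteq> E)))"
    using le finS by (intro rs_exp_union_bound q) auto
  also have "\<dots> = (\<Sum>s\<in>S. q ^ (2 * m))"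
    using each by (intro sum.cong refl) (auto simp: S_def)
  also have "\<dots> = (\<Sum>d\<in>(UNIV :: bool set) \<times> D. card (U (fst (snd d)) (snd (snd d))) * q ^ (2 * m))"
    unfolding S_def using fUD finU by (simp add: sum.Sigma[symmetric] sum_distrib_right)
  also have "\<dots> \<le> (\<Sum>d\<in>(UNIV :: bool set) \<times> D. real N ^ m * q ^ (2 * m))"
    using cU q by (intro sum_mono mult_right_mono) auto
  also have "\<dots> = 2 * real (card D) * (N * q\<^sup>2) ^ m"
    by (simp add: power_mult_distrib power_mult card_cartesian_product)
  also have "\<dots> \<le> 2 * (real N)\<^sup>2 * (N * q\<^sup>2) ^ m" using cD by (intro mult_right_mono) auto
  finally show ?thesis by (simp add: m_def)
qed

lemma prob_fibre:
  fixes Z f :: real and n N :: nat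
  assumes N: "0 < N" and Z: "1 \<le> Z"
  shows "rf_avg N (UNIV \<times> {..<n}) (\<lambda>g. of_bool (\<exists>c u. u < N \<and> f < card {x. x < n \<and> g (c :: bool, x) = u}))
    \<le> 2 * N * (Z powr (- f) * exp ((Z - 1) * n / N))"
proof -
  define D where "D = (UNIV :: bool set) \<times> {..<n}"
  define J where "J c = {c} \<times> {..<n}" for c :: bool
  have cJ: "card {x. x < n \<and> g (c, x) = u} = card {y\<in>J c. g y = u}" for g :: "bool \<times> nat \<Rightarrow> nat" and c u
  proof -
    have "{y\<in>J c. g y = u} = Pair c ` {x. x < n \<and> g (c, x) = u}" by (auto simp: J_def)
    thus ?thesis by (simp add: card_image inj_on_def)
  qed
  have le: "of_bool (\<exists>c u. u < N \<and> f < card {x. x < n \<and> g (c, x) = u})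
      \<le> (\<Sum>c\<in>UNIV. \<Sum>u<N. Z powr (- f) * Z ^ card {y\<in>J c. g y = u})" for g
  proof (cases "\<exists>c u. u < N \<and> f < card {x. x < n \<and> g (c, x) = u}")
    case True
    then obtain c u where cu': "u < N" "f < card {x. x < n \<and> g (c, x) = u}" by auto
    have cu: "u < N" "f < card {y\<in>J c. g y = u}" using cu' cJ[of g c u] by simp_all
    have "1 \<le> Z powr (real (card {y\<in>J c. g y = u}) - f)" using Z cu by (intro ge_one_powr_ge_zero) auto
    also have "\<dots> = Z powr (- f) * Z ^ card {y\<in>J c. g y = u}"
      using Z by (simp add: powr_realpow[symmetric] powr_add[symmetric])
    also have "\<dots> \<le> (\<Sum>u<N. Z powr (- f) * Z ^ card {y\<in>J c. g y = u})"
      using cu Z by (intro member_le_sum) auto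
    also have "\<dots> \<le> (\<Sum>c\<in>UNIV. \<Sum>u<N. Z powr (- f) * Z ^ card {y\<in>J c. g y = u})"
      using Z by (intro member_le_sum[of c]) (auto intro!: sum_nonneg)
    finally show ?thesis using True by (simp only: of_bool_eq)
  qed (use Z in \<open>auto intro!: sum_nonneg\<close>)
  have "rf_avg N D (\<lambda>g. of_bool (\<exists>c u. u < N \<and> f < card {x. x < n \<and> g (c, x) = u}))
    \<le> rf_avg N D (\<lambda>g. \<Sum>c\<in>UNIV. \<Sum>u<N. Z powr (- f) * Z ^ card {y\<in>J c. g y = u})"
    by (intro rf_avg_mono le)
  also have "\<dots> = (\<Sum>c\<in>UNIV. \<Sum>u<N. Z powr (- f) * rf_avg N D (\<lambda>g. Z ^ card {y\<in>J c. g y = u}))"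
    by (simp only: rf_avg_sum rf_avg_cmult)
  also have "\<dots> = (\<Sum>c\<in>UNIV. \<Sum>u<N. Z powr (- f) * (1 + (Z - 1) / N) ^ card (J c))"
  proof (intro sum.cong refl arg_cong2[of _ _ _ _ "(*)"])
    fix c u assume "u \<in> {..<N}"
    thus "rf_avg N D (\<lambda>g. Z ^ card {y\<in>J c. g y = u}) = (1 + (Z - 1) / N) ^ card (J c)"
      using N by (intro rf_avg_mgf) (auto simp: D_def J_def)
  qed
  also have "\<dots> \<le> (\<Sum>c\<in>(UNIV :: bool set). \<Sum>u<N. Z powr (- f) * exp ((Z - 1) * n / N))"
  proof (intro sum_mono mult_left_mono)
    fix c
    have cJ: "card (J c) = n" by (simp add: J_def card_cartesian_product)
    have "(1 + (Z - 1) / N) ^ card (J c) \<le> (exp ((Z - 1) / N)) ^ card (J c)"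
      using Z N by (intro power_mono exp_ge_add_one_self) auto
    also have "\<dots> = exp (card (J c) * ((Z - 1) / N))" by (rule exp_of_nat_mult[symmetric])
    finally show "(1 + (Z - 1) / N) ^ card (J c) \<le> exp ((Z - 1) * n / N)"
      unfolding cJ by (simp add: mult_ac)
  qed auto
  finally show ?thesis by (simp add: D_def mult_ac)
qed

text \<open>Seven kinds of failure, each of total expected count at most \<open>1 / 8\<close>: large
  fibres, degrees, codegrees, and four events summed over all \<open>k\<close>-sets. The four are
  estimated for fixed projections. Only the bound for \<open>few_open\<close> still depends on the
  projections, through collision weights, and averaging these costs \<open>4 ^ k\<close>.\<close>

lemma exists_construction:
  fixes n N k \<kappa> :: nat and q f d1 D0 D1 M c1 t1 h z Z1 Z2 Z3 Mx :: real
  assumes N: "0 < N" and k: "0 < k" and q: "0 < q" "q < 1"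
    and pos: "1 \<le> f" "0 \<le> M" "0 < D0" "f * D0 \<le> D1" "0 < D1" "h = 2 * M * f / D1" "0 \<le> d1" "0 < h"
      "0 < z" "z \<le> 1" "1 \<le> Z1" "1 \<le> Z2" "1 \<le> Z3" "0 \<le> Mx"
    and fib: "2 * N * (Z1 powr (- f) * exp ((Z1 - 1) * n / N)) \<le> 1 / 8"
    and deg: "2 * N * (Z1 powr (- d1) * exp (q * N * (Z1 - 1))) \<le> 1 / 8"
    and codeg: "2 * (real N)\<^sup>2 * (N * q\<^sup>2) ^ Suc \<kappa> \<le> 1 / 8"
    and dns: "N * (Z2 powr (- D0 / 4) * exp (q * k * Z2)) \<le> 1"
      "(n choose k) * (2 * exp 1 * Z2 powr (- M / 4)) \<le> 1 / 8"
    and chr: "(n choose k) * (2 * exp (- (1 / (f * D0)\<^sup>2) * c1 + N * (1 / (f * D0)\<^sup>2 * q\<^sup>2 * k\<^sup>2))) \<le> 1 / 8"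
    and cls: "(n choose k) * (Z3 powr (- t1) * exp (q / (1 - q) * Z3 * (4 * (k * f + D1 * f * M + k * (f * D0)\<^sup>2 + c1)))) \<le> 1 / 8"
    and opn: "(n choose k) * (z powr (- 5 * t1) * Mx * ((2 * N) powr h * exp (1 + k)) * 4 ^ k) \<le> 1 / 8"
    and key: "\<And>p I H A. two_bites N k p I f d1 D0 D1 M h \<Longrightarrow>
      two_bites.admissible N \<kappa> p I f d1 (f * d1) M h H A \<Longrightarrow>
      exp (- (q * (1 - z) * (real (card (two_bites.open_pairs p I H A)) - card A)))
        \<le> Mx * (\<Prod>c\<in>UNIV. (N / k) ^ (k - card (p c ` I))) * (1 / (q * h)) ^ card A"
  shows "\<exists>p E. E \<subseteq> cpairs N \<and> (\<forall>I\<subseteq>{..<n}. card I = k \<longrightarrow>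
    (\<exists>c. \<exists>\<tau>\<in>nsets I 2. (c, p c ` \<tau>) \<in> E \<and> \<not> (\<exists>c' v. \<forall>x\<in>\<tau>. (c', {p c' x, v}) \<in> E)))"
proof -
  define D where "D = (UNIV :: bool set) \<times> {..<n}"
  have finD: "finite D" by (simp add: D_def)
  define \<I> where "\<I> = {I. I \<subseteq> {..<n} \<and> card I = k}"
  have cI: "card \<I> = n choose k" by (simp add: \<I>_def n_subsets)
  have finI: "finite \<I>" by (rule finite_subset[of _ "Pow {..<n}"]) (auto simp: \<I>_def)
  define P where "P g = (\<lambda>c x. g (c :: bool, x :: nat) :: nat)" for g
  define bf where "bf g \<longleftrightarrow> (\<exists>c u. u < N \<and> f < card {x. x < n \<and> g (c :: bool, x :: nat) = u})" for g
  define bd where "bd E \<longleftrightarrow> (\<exists>c v. d1 < card {u. (c :: bool, {u :: nat, v}) \<in> E})" for E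
  define bc where "bc E \<longleftrightarrow> (\<exists>c v w. v \<noteq> w \<and> \<kappa> < card {u. (c :: bool, {u :: nat, v}) \<in> E \<and> (c, {u, w}) \<in> E})" for E
  define ev where "ev g I E = (of_bool (two_bites.dense_nbhds N (P g) I D0 M E) +
     of_bool (two_bites.many_cherries N (P g) I D0 c1 E) +
     of_bool (two_bites.many_closed N (P g) I D0 D1 M c1 t1 E) +
     of_bool (two_bites.few_open N \<kappa> (P g) I f d1 (f * d1) M t1 h E) :: real)" for g I E
  \<comment> \<open>Every failure makes \<open>X\<close> at least 1, so an outcome with
    \<open>X g E < 1\<close> is good. The factor \<open>of_bool (\<not> bf g)\<close> confines the
    four events to projections with small fibres, where their estimates are valid.\<close>
  define X where "X g E = of_bool (bf g) + (of_bool (bd E) + of_bool (bc E)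
     + (\<Sum>I\<in>\<I>. of_bool (\<not> bf g) * ev g I E))" for g E
  have tb: "two_bites N k (P g) I f d1 D0 D1 M h" if g: "g \<in> D \<rightarrow>\<^sub>E {..<N}" "\<not> bf g" and I: "I \<in> \<I>" for g I
  proof
    have In: "I \<subseteq> {..<n}" "card I = k" using I by (auto simp: \<I>_def)
    show "finite I" using In finite_subset by blast
    show "card I = k" by fact
    show less: "P g c x < N" if "x \<in> I" for c x
      using g(1) that In by (auto simp: P_def D_def)
    show "real (card {x\<in>I. P g c x = u}) \<le> f" for c u
    proof (cases "u < N")
      case True
      have "card {x\<in>I. P g c x = u} \<le> card {x. x < n \<and> g (c, x) = u}"
        using In by (intro card_mono) (auto simp: P_def)
      moreover have "real (card {x. x < n \<and> g (c, x) = u}) \<le> f"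
      proof (rule ccontr)
        assume "\<not> ?thesis"
        hence "bf g" unfolding bf_def using True by (intro exI[of _ c] exI[of _ u]) auto
        thus False using g(2) by simp
      qed
      ultimately show ?thesis by linarith
    next
      case False
      hence e: "{x\<in>I. P g c x = u} = {}" using less by auto
      show ?thesis unfolding e using pos(1) by simp
    qed
  qed (use pos in auto)
  define W where "W g I = Mx * (\<Prod>c\<in>UNIV. (N / k) ^ (k - card (P g c ` I)))" for g I
  define e1 where "e1 = 2 * exp 1 * Z2 powr (- M / 4)"
  define e2 where "e2 = 2 * exp (- (1 / (f * D0)\<^sup>2) * c1 + N * (1 / (f * D0)\<^sup>2 * q\<^sup>2 * k\<^sup>2))"
  define e3 where "e3 = Z3 powr (- t1) * exp (q / (1 - q) * Z3 * (4 * (k * f + D1 * f * M + k * (f * D0)\<^sup>2 + c1)))"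
  define e4 where "e4 = z powr (- 5 * t1) * ((2 * N) powr h * exp (1 + k))"
  have W0: "0 \<le> W g I" for g I using pos by (auto simp: W_def intro!: mult_nonneg_nonneg prod_nonneg)
  have e0: "0 \<le> e1" "0 \<le> e2" "0 \<le> e3" "0 \<le> e4" by (auto simp: e1_def e2_def e3_def e4_def)
  have evb: "rs_exp q (cpairs N) (\<lambda>E. of_bool (\<not> bf g) * ev g I E) \<le> e1 + e2 + e3 + e4 * W g I"
    if g: "g \<in> D \<rightarrow>\<^sub>E {..<N}" and I: "I \<in> \<I>" for g I
  proof (cases "bf g")
    case True
    thus ?thesis using e0 W0[of g I] by simp
  next
    case False
    \<comment> \<open>The link bound \<open>g\<close> becomes \<open>f * d1\<close>: at most
      \<open>d1\<close> neighbours, each with a fibre of size at most \<open>f\<close>.\<close>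
    interpret two_bites N k \<kappa> "P g" I f d1 "f * d1" D0 D1 M c1 t1 h
      by (rule tb[OF g False I])
    have q1: "0 \<le> q" "q \<le> 1" using q by auto
    have 1: "rs_exp q (cpairs N) (\<lambda>E. of_bool (dense_nbhds E)) \<le> e1"
      unfolding e1_def using prob_dense_nbhds[OF q1, of Z2] pos dns(1) by simp
    have 2: "rs_exp q (cpairs N) (\<lambda>E. of_bool (many_cherries E)) \<le> e2"
      unfolding e2_def using prob_many_cherries[OF q1] pos by simp
    have 3: "rs_exp q (cpairs N) (\<lambda>E. of_bool (many_closed E)) \<le> e3"
      unfolding e3_def using q1 q pos by (intro prob_many_closed) auto
    have 4: "rs_exp q (cpairs N) (\<lambda>E. of_bool (few_open E)) \<le> z powr (- 5 * t1) * W g I * ((2 * N) powr h * exp (1 + k))"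
    proof (rule prob_few_open)
      fix H A assume "admissible H A"
      from key[OF tb[OF g False I] this]
      show "exp (- (q * (1 - z) * (real (card (open_pairs H A)) - card A))) \<le> W g I * (1 / (q * h)) ^ card A"
        by (simp add: W_def)
    qed (use q pos N W0 in auto)
    show ?thesis
      unfolding ev_def using False 1 2 3 4 by (simp add: rs_exp_add e4_def mult_ac)
  qed
  have Wavg: "rf_avg N D (\<lambda>g. W g I) \<le> Mx * 4 ^ k" if I: "I \<in> \<I>" for I
  proof -
    define J where "J c = {c} \<times> I" for c :: bool
    have cJ: "card (J c) = k" for c using I by (simp add: J_def \<I>_def card_cartesian_product)
    have im: "P g c ` I = g ` J c" for g c by (force simp: P_def J_def)
    have "W g I = Mx * ((N / k) ^ (card (J True) - card (g ` J True)) * (N / k) ^ (card (J False) - card (g ` J False)))" for g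
      unfolding W_def im cJ by (simp add: UNIV_bool mult_ac)
    hence "rf_avg N D (\<lambda>g. W g I) = Mx * rf_avg N D (\<lambda>g. (N / k) ^ (card (J True) - card (g ` J True)) * (N / k) ^ (card (J False) - card (g ` J False)))"
      by (simp only: rf_avg_cmult)
    also have "\<dots> \<le> Mx * 2 ^ (card (J True) + card (J False))"
      using I N k cJ finD pos by (intro mult_left_mono rf_avg_collisions) (auto simp: J_def D_def \<I>_def)
    also have "\<dots> = Mx * 4 ^ k" unfolding cJ by (simp add: power_add power_mult_distrib[symmetric])
    finally show ?thesis .
  qed
  have avgX: "rf_avg N D (\<lambda>g. rs_exp q (cpairs N) (X g)) \<le> 7 / 8"
  proof -
    have "rs_exp q (cpairs N) (X g) \<le> of_bool (bf g) + (2 / 8 + (\<Sum>I\<in>\<I>. e1 + e2 + e3 + e4 * W g I))"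
      if g: "g \<in> D \<rightarrow>\<^sub>E {..<N}" for g
    proof -
      have "rs_exp q (cpairs N) (X g) = of_bool (bf g) + (rs_exp q (cpairs N) (\<lambda>E. of_bool (bd E))
         + rs_exp q (cpairs N) (\<lambda>E. of_bool (bc E)) + (\<Sum>I\<in>\<I>. rs_exp q (cpairs N) (\<lambda>E. of_bool (\<not> bf g) * ev g I E)))"
        unfolding X_def rs_exp_add rs_exp_sum by simp
      moreover have "rs_exp q (cpairs N) (\<lambda>E. of_bool (bd E)) \<le> 1 / 8"
        unfolding bd_def using prob_degree[of q Z1 d1 N] q pos deg by auto
      moreover have "rs_exp q (cpairs N) (\<lambda>E. of_bool (bc E)) \<le> 1 / 8"
        unfolding bc_def using prob_codegree[of q N \<kappa>] q codeg by auto
      moreover have "(\<Sum>I\<in>\<I>. rs_exp q (cpairs N) (\<lambda>E. of_bool (\<not> bf g) * ev g I E)) \<le> (\<Sum>I\<in>\<I>. e1 + e2 + e3 + e4 * W g I)"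
        by (intro sum_mono evb g)
      ultimately show ?thesis by linarith
    qed
    hence "rf_avg N D (\<lambda>g. rs_exp q (cpairs N) (X g))
      \<le> rf_avg N D (\<lambda>g. of_bool (bf g) + (2 / 8 + (\<Sum>I\<in>\<I>. e1 + e2 + e3 + e4 * W g I)))"
      by (rule rf_avg_mono)
    also have "\<dots> = rf_avg N D (\<lambda>g. of_bool (bf g)) + (2 / 8 + (\<Sum>I\<in>\<I>. e1 + e2 + e3 + e4 * rf_avg N D (\<lambda>g. W g I)))"
      unfolding rf_avg_add rf_avg_sum rf_avg_cmult rf_avg_const[OF finD N] by simp
    also have "\<dots> \<le> 1 / 8 + (2 / 8 + (\<Sum>I\<in>\<I>. e1 + e2 + e3 + e4 * (Mx * 4 ^ k)))"
    proof (intro add_mono sum_mono order.refl mult_left_mono Wavg e0)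
      show "rf_avg N D (\<lambda>g. of_bool (bf g)) \<le> 1 / 8"
        unfolding bf_def D_def using prob_fibre[of N Z1 n f] N pos fib by auto
    qed
    also have "(\<Sum>I\<in>\<I>. e1 + e2 + e3 + e4 * (Mx * 4 ^ k)) = (n choose k) * e1 + (n choose k) * e2 + (n choose k) * e3
        + (n choose k) * (e4 * (Mx * 4 ^ k))"
      by (simp add: cI algebra_simps)
    also have "\<dots> \<le> 1 / 8 + 1 / 8 + 1 / 8 + 1 / 8"
    proof (intro add_mono)
      show "(n choose k) * e1 \<le> 1 / 8" using dns(2) by (simp add: e1_def)
      show "(n choose k) * e2 \<le> 1 / 8" using chr by (simp add: e2_def)
      show "(n choose k) * e3 \<le> 1 / 8" using cls by (simp add: e3_def)
      show "(n choose k) * (e4 * (Mx * 4 ^ k)) \<le> 1 / 8" using opn by (simp add: e4_def mult_ac)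
    qed
    finally show ?thesis by simp
  qed
  have X0: "0 \<le> ev g I E" for g I E by (simp add: ev_def)
  have "\<exists>g\<in>D \<rightarrow>\<^sub>E {..<N}. \<exists>E\<subseteq>cpairs N. X g E < 1"
  proof (rule ccontr)
    assume neg: "\<not> ?thesis"
    have 1: "1 \<le> X g E" if "g \<in> D \<rightarrow>\<^sub>E {..<N}" "E \<subseteq> cpairs N" for g E
    proof (rule ccontr)
      assume "\<not> 1 \<le> X g E"
      hence "X g E < 1" by simp
      thus False using neg that by blast
    qed
    have "1 = rf_avg N D (\<lambda>g. rs_exp q (cpairs N) (\<lambda>_. 1))"
      using rf_avg_const[OF finD N, of 1] by simp
    also have "\<dots> \<le> rf_avg N D (\<lambda>g. rs_exp q (cpairs N) (X g))"
      using q 1 by (intro rf_avg_mono rs_exp_mono) auto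
    finally show False using avgX by simp
  qed
  then obtain g E where gE: "g \<in> D \<rightarrow>\<^sub>E {..<N}" "E \<subseteq> cpairs N" "X g E < 1" by blast
  have sum0: "0 \<le> (\<Sum>I\<in>\<I>. of_bool (\<not> bf g) * ev g I E)"
    by (intro sum_nonneg mult_nonneg_nonneg X0) simp
  have "of_bool (bf g) + of_bool (bd E) + of_bool (bc E) < (1 :: real)"
    using gE(3) sum0 unfolding X_def by linarith
  hence nb: "\<not> bf g" and nd: "\<not> bd E" and nc: "\<not> bc E" by (auto simp: of_bool_def split: if_splits)
  have evI: "ev g I E < 1" if "I \<in> \<I>" for I
  proof -
    have "of_bool (\<not> bf g) * ev g I E \<le> (\<Sum>I\<in>\<I>. of_bool (\<not> bf g) * ev g I E)"
      using that finI X0 by (intro member_le_sum) auto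
    thus ?thesis using gE(3) nb nd nc by (simp add: X_def)
  qed
  have "\<exists>c. \<exists>\<tau>\<in>nsets I 2. (c, P g c ` \<tau>) \<in> E \<and> \<not> (\<exists>c' v. \<forall>x\<in>\<tau>. (c', {P g c' x, v}) \<in> E)"
    if I: "I \<subseteq> {..<n}" "card I = k" for I
  proof (rule ccontr)
    assume neg: "\<not> ?thesis"
    have II: "I \<in> \<I>" using I by (simp add: \<I>_def)
    interpret two_bites N k \<kappa> "P g" I f d1 "f * d1" D0 D1 M c1 t1 h
      by (rule tb[OF gE(1) nb II])
    have "of_bool (dense_nbhds E) + of_bool (many_cherries E) + of_bool (many_closed E) + of_bool (few_open E) < (1 :: real)"
      using evI[OF II] unfolding ev_def .
    hence n1: "\<not> dense_nbhds E" and n2: "\<not> many_cherries E" and n3: "\<not> many_closed E" and n4: "\<not> few_open E"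
      by (auto simp: of_bool_def split: if_splits)
    have degE: "real (card {u. (c, {u, v}) \<in> E}) \<le> d1" for c v
      using nd unfolding bd_def not_ex not_less by blast
    have "few_open E"
    proof (rule few_open_if_no_open_pairs[OF gE(2) degE _ _ _ n1 n2 n3])
      fix c :: bool and v w :: nat assume "v \<noteq> w"
      thus "card {u. (c, {u, v}) \<in> E \<and> (c, {u, w}) \<in> E} \<le> \<kappa>"
        using nc unfolding bc_def not_ex de_Morgan_conj not_less by blast
    next
      fix c v
      have "finite {u. (c, {u, v}) \<in> E}"
        by (rule finite_subset[of _ "{..<N}"]) (use gE(2) cpairs_edge in blast)+
      hence "rdeg E c v \<le> card {u. (c, {u, v}) \<in> E}" unfolding rdeg_def by (intro card_mono) auto
      hence "real (rdeg E c v) \<le> d1" using degE[of c v] by linarith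
      hence "f * rdeg E c v \<le> f * d1" using pos by (intro mult_left_mono) auto
      thus "real (card (link E c v)) \<le> f * d1" using card_link_le[of E c v] by linarith
    next
      fix \<tau> c assume \<tau>: "\<tau> \<in> nsets I 2" "(c, P g c ` \<tau>) \<in> E"
      then obtain c' v where "\<forall>x\<in>\<tau>. (c', {P g c' x, v}) \<in> E" using neg by blast
      thus "\<exists>c' v. \<tau> \<subseteq> link E c' v"
        using \<tau>(1) by (intro exI[of _ c'] exI[of _ v]) (auto simp: link_def nsets_def)
    qed
    thus False using n4 by simp
  qed
  thus ?thesis using gE(2) by (intro exI[of _ "P g"] exI[of _ E]) auto
qed

subsection \<open>The exponent inequality\<close>

text \<open>Here \<open>\<rho>\<close> is the relative size of the projection of a \<open>k\<close>-set \<open>I\<close> in one colour, \<open>x\<close> the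
  proportion of \<open>I\<close> inside heavy neighbourhoods, and \<open>L\<close> the proportion of pairs these close.
  The two bounds on \<open>L\<close> come from the total size and from the maximum size of the neighbourhoods;
  neither suffices alone near \<open>x = 1 / 2\<close>.\<close>

lemma colour_exponent_bound:
  fixes \<epsilon> B \<rho> x s L \<eta> :: real
  assumes e: "0 < \<epsilon>" "\<epsilon> \<le> 1 / 10" and B: "1 + \<epsilon> / 2 \<le> B" "B \<le> 2" and r: "0 \<le> \<rho>" "1 - s \<le> \<rho>"
    and x: "0 \<le> x" "x \<le> s" "x \<le> 1 + \<eta>" and eta: "0 \<le> \<eta>" "\<eta> \<le> 1 / 4"
    and L: "L \<le> x\<^sup>2" "B * L \<le> x / 2"
  shows "1 / 2 + \<epsilon>\<^sup>2 / 64 \<le> B / 2 * (\<rho>\<^sup>2 - L) + s"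
proof -
  have ee: "\<epsilon>\<^sup>2 \<le> \<epsilon> / 10" using e mult_left_mono[of \<epsilon> "1 / 10" \<epsilon>] by (simp add: power2_eq_square)
  have s0: "0 \<le> s" using x by simp
  show ?thesis
  \<comment> \<open>For \<open>1 \<le> s\<close> the summand \<open>s\<close> suffices alone, since
    heavy vertices cost at most \<open>(1 + \<eta>) / 4\<close>.\<close>
  proof (cases "1 \<le> s")
    case True
    have "0 \<le> B * \<rho>\<^sup>2" using B e by simp
    moreover have "B / 2 * (\<rho>\<^sup>2 - L) = (B * \<rho>\<^sup>2 - B * L) / 2" by (simp add: algebra_simps)
    moreover have "B * L \<le> (1 + \<eta>) / 2" using L x by argo
    ultimately have "- (1 + \<eta>) / 4 \<le> B / 2 * (\<rho>\<^sup>2 - L)" by argo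
    thus ?thesis using True eta ee e by simp
  next
    case False
    have rs: "(1 - s)\<^sup>2 \<le> \<rho>\<^sup>2" using r False by (intro power_mono) auto
    have Brs: "B * (1 - s)\<^sup>2 \<le> B * \<rho>\<^sup>2" using rs B e by (intro mult_left_mono) auto
    show ?thesis
    \<comment> \<open>Up to this point \<open>L \<le> s\<^sup>2\<close> leaves
      \<open>1 / 2 + (B - 1) * (1 / 2 - s)\<close>, whose gain vanishes at \<open>1 / 2\<close>.
      Beyond it \<open>B * L \<le> s / 2\<close> leaves \<open>1 / 2 + s * (2 * s - 1) / 4 +
      \<epsilon> / 4 * (1 - s)\<^sup>2\<close>; the cut lies close enough to \<open>1 / 2\<close>
      for the last term to outweigh the negative middle one.\<close>
    proof (cases "s \<le> 1 / 2 - \<epsilon> / 8")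
      case True
      have "L \<le> s\<^sup>2" using L(1) power_mono[OF x(2,1), of 2] by simp
      hence "B * L \<le> B * s\<^sup>2" using B e by (intro mult_left_mono) auto
      hence "B * ((1 - s)\<^sup>2 - s\<^sup>2) \<le> B * (\<rho>\<^sup>2 - L)" using Brs by (simp add: algebra_simps)
      also have "(1 - s)\<^sup>2 - s\<^sup>2 = 1 - 2 * s" by (simp add: power2_eq_square algebra_simps)
      finally have 1: "B / 2 * (1 - 2 * s) + s \<le> B / 2 * (\<rho>\<^sup>2 - L) + s" by simp
      have "(\<epsilon> / 2) * (\<epsilon> / 8) \<le> (B - 1) * (1 / 2 - s)" using B True e by (intro mult_mono) auto
      moreover have "(\<epsilon> / 2) * (\<epsilon> / 8) = \<epsilon>\<^sup>2 / 16" by (simp add: power2_eq_square)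
      moreover have "(B - 1) * (1 / 2 - s) = B / 2 * (1 - 2 * s) + s - 1 / 2" by (simp add: field_simps)
      moreover have "0 \<le> \<epsilon>\<^sup>2" by simp
      ultimately show ?thesis using 1 by linarith
    next
      case s2: False
      have "B * L \<le> s / 2" using L x by linarith
      hence 1: "B / 2 * (1 - s)\<^sup>2 - s / 4 + s \<le> B / 2 * (\<rho>\<^sup>2 - L) + s" using Brs by (simp add: algebra_simps)
      have "(1 + \<epsilon> / 2) * (1 - s)\<^sup>2 \<le> B * (1 - s)\<^sup>2" using B by (intro mult_right_mono) auto
      hence 2: "(1 + \<epsilon> / 2) / 2 * (1 - s)\<^sup>2 - s / 4 + s \<le> B / 2 * (\<rho>\<^sup>2 - L) + s" using 1 by simp
      have 3: "(1 + \<epsilon> / 2) / 2 * (1 - s)\<^sup>2 - s / 4 + s = 1 / 2 + s * (2 * s - 1) / 4 + \<epsilon> / 4 * (1 - s)\<^sup>2"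
        by (simp add: power2_eq_square field_simps)
      have "\<epsilon> / 128 \<le> s * (2 * s - 1) / 4 + \<epsilon> / 4 * (1 - s)\<^sup>2"
      proof (cases "s \<le> 1 / 2")
        case True
        have "s * (1 - 2 * s) \<le> (1 / 2) * (\<epsilon> / 4)" using True s2 e s0 by (intro mult_mono) auto
        hence a: "- \<epsilon> / 32 \<le> s * (2 * s - 1) / 4" by (simp add: algebra_simps)
        have "(1 / 2)\<^sup>2 \<le> (1 - s)\<^sup>2" using True by (intro power_mono) auto
        hence "\<epsilon> / 4 * (1 / 2)\<^sup>2 \<le> \<epsilon> / 4 * (1 - s)\<^sup>2" using e by (intro mult_left_mono) auto
        hence b: "\<epsilon> / 16 \<le> \<epsilon> / 4 * (1 - s)\<^sup>2" by (simp add: power2_eq_square)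
        show ?thesis using a b e by linarith
      next
        case s3: False
        show ?thesis
        proof (cases "s \<le> 3 / 4")
          case True
          have "(1 / 4)\<^sup>2 \<le> (1 - s)\<^sup>2" using True by (intro power_mono) auto
          hence "\<epsilon> / 4 * (1 / 4)\<^sup>2 \<le> \<epsilon> / 4 * (1 - s)\<^sup>2" using e by (intro mult_left_mono) auto
          hence b: "\<epsilon> / 64 \<le> \<epsilon> / 4 * (1 - s)\<^sup>2" by (simp add: power2_eq_square)
          have "0 \<le> s * (2 * s - 1)" using s3 by (intro mult_nonneg_nonneg) auto
          thus ?thesis using b e by linarith
        next
          case False
          have "(3 / 4) * (1 / 2) \<le> s * (2 * s - 1)" using False by (intro mult_mono) auto
          moreover have "0 \<le> \<epsilon> / 4 * (1 - s)\<^sup>2" using e by simp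
          ultimately show ?thesis using e by linarith
        qed
      qed
      moreover have "\<epsilon>\<^sup>2 / 64 \<le> \<epsilon> / 128" using ee e by linarith
      ultimately show ?thesis using 2 3 by linarith
    qed
  qed
qed

section \<open>The exponent of an admissible certificate\<close>

context two_bites
begin

text \<open>After taking logarithms the claim is a sum of one inequality per colour. By
  \<open>lnN\<close> and \<open>lnq\<close> a collision and an edge of \<open>A\<close> are each
  worth nearly \<open>l\<close>, so both enter through the single quantity
  \<open>\<sigma> = 1 - \<rho> + \<alpha>\<close>, the role of \<open>s\<close> in
  \<open>colour_exponent_bound\<close>.\<close>

lemma admissible_exponent_bound:
  fixes \<epsilon> \<eta> q z B l :: real
  assumes adm: "admissible H A" and k0: "0 < k" and N0: "0 < N"
    and e: "0 < \<epsilon>" "\<epsilon> \<le> 1 / 10" and eta: "\<eta> = \<epsilon>\<^sup>2 / 1280"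
    and q: "0 < q" and z: "z \<le> 1" and l: "0 < l" and h0: "0 < h"
    and B_def: "B = (1 - z) * q * k / l"
    and B: "1 + \<epsilon> / 2 \<le> B" "B \<le> 2" "B * g \<le> k / 2"
    and lnN: "(1 - \<eta>) * l \<le> ln (N / k)"
    and lnq: "(1 - \<eta>) * l \<le> ln (1 / (q * h)) - q * (1 - z)"
    and err: "q * (1 - z) / 2 * (k + d1 * M) \<le> \<eta> * (k * l)"
    and h: "h \<le> \<eta> * k" "h\<^sup>2 * (\<kappa> * f) \<le> \<eta> * k"
  shows "exp (- (q * (1 - z) * (real (card (open_pairs H A)) - card A)))
    \<le> exp (- (k * l * (1 + \<epsilon>\<^sup>2 / 64))) * (\<Prod>c\<in>UNIV. (N / k) ^ (k - card (R c))) * (1 / (q * h)) ^ card A"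
proof -
  define a where "a c = real (card {e. (c, e) \<in> A})" for c
  define S where "S c = (\<Sum>v | (c, v) \<in> H. real (card (link A c v)))" for c
  define Q where "Q c = (\<Sum>v | (c, v) \<in> H. (real (card (link A c v)))\<^sup>2)" for c
  define U where "U c = (\<Union>v\<in>{v. (c, v) \<in> H}. link A c v)" for c
  note cnt = open_pairs_counts[OF adm, folded a_def S_def Q_def U_def]
  have eta0: "0 \<le> \<eta>" "\<eta> \<le> 1 / 4" "\<eta> \<le> 1"
  proof -
    have "\<epsilon>\<^sup>2 \<le> (1 / 10)\<^sup>2" using e by (intro power_mono) auto
    thus "0 \<le> \<eta>" "\<eta> \<le> 1 / 4" "\<eta> \<le> 1" unfolding eta by (simp_all add: power2_eq_square)
  qed
  have kl: "0 < real k * l" using k0 l by simp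
  define w where "w = q * (1 - z)"
  have w0: "0 \<le> w" using q z by (simp add: w_def)
  have wB: "w * (real k)\<^sup>2 = B * (k * l)" using l by (simp add: w_def B_def power2_eq_square)
  have each: "k * l * (1 / 2 + \<epsilon>\<^sup>2 / 128)
    \<le> w / 2 * ((real (card (R c)))\<^sup>2 - k - d1 * M - Q c) - w * a c + real (k - card (R c)) * ln (N / k) + a c * ln (1 / (q * h))" for c
  proof -
    define \<rho> where "\<rho> = card (R c) / k"
    define \<alpha> where "\<alpha> = a c / k"
    define \<sigma> where "\<sigma> = 1 - \<rho> + \<alpha>"
    define x where "x = S c / k"
    define L where "L = Q c / (real k)\<^sup>2"
    have a0: "0 \<le> a c" by (simp add: a_def)
    have S0: "0 \<le> S c" unfolding S_def by (intro sum_nonneg) auto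
    have al0: "0 \<le> \<alpha>" using a0 by (simp add: \<alpha>_def)
    have rho: "0 \<le> \<rho>" "\<rho> \<le> 1" using k0 card_R[of c] by (auto simp: \<rho>_def)
    have x0: "0 \<le> x" using S0 by (simp add: x_def)
    have SU: "S c \<le> card (U c) + \<eta> * k" using cnt(6)[of c] h by linarith
    have x1: "x \<le> 1 + \<eta>"
    proof -
      have "S c \<le> (1 + \<eta>) * k" using SU cnt(7)[of c] by (simp add: algebra_simps)
      thus ?thesis using k0 by (simp add: x_def field_simps)
    qed
    have x2: "x \<le> \<sigma> + 2 * \<eta>"
    proof -
      have "S c \<le> real k - card (R c) + a c + 2 * \<eta> * k" using SU cnt(8)[of c] h by linarith
      also have "\<dots> = (\<sigma> + 2 * \<eta>) * k" using k0 by (simp add: \<sigma>_def \<rho>_def \<alpha>_def field_simps)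
      finally show ?thesis using k0 by (simp add: x_def field_simps)
    qed
    have L1: "L \<le> x\<^sup>2" using cnt(5)[of c] k0 by (simp add: L_def x_def power_divide divide_right_mono)
    have L2: "B * L \<le> x / 2"
    proof -
      have B0: "0 \<le> B" using B e by linarith
      have "B * Q c \<le> B * (g * S c)" using cnt(4)[of c] B0 by (intro mult_left_mono)
      also have "\<dots> = (B * g) * S c" by simp
      also have "\<dots> \<le> (k / 2) * S c" using B S0 by (intro mult_right_mono) auto
      finally show ?thesis using k0 by (simp add: L_def x_def field_simps power2_eq_square)
    qed
    \<comment> \<open>The losses are \<open>2 * \<eta>\<close> from \<open>x2\<close>,
      \<open>\<eta>\<close> from the error term and
      \<open>\<eta> * \<sigma> \<le> 2 * \<eta>\<close>, together \<open>5 * \<eta>\<close>, which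
      the choice of \<open>\<eta>\<close> keeps below half of the gain. For
      \<open>\<sigma> > 2\<close> the last loss is not bounded, but \<open>\<sigma>\<close> itself
      is then ample.\<close>
    have main: "1 / 2 + \<epsilon>\<^sup>2 / 128 \<le> B / 2 * (\<rho>\<^sup>2 - L) - \<eta> + (1 - \<eta>) * \<sigma>"
    proof (cases "\<sigma> \<le> 2")
      case True
      have "1 / 2 + \<epsilon>\<^sup>2 / 64 \<le> B / 2 * (\<rho>\<^sup>2 - L) + (\<sigma> + 2 * \<eta>)"
        using e B rho x0 x1 x2 eta0 L1 L2 al0
        by (intro colour_exponent_bound[of \<epsilon> B \<rho> "\<sigma> + 2 * \<eta>" x \<eta> L]) (auto simp: \<sigma>_def)
      moreover have "\<eta> * \<sigma> \<le> \<eta> * 2" using True eta0 by (intro mult_left_mono) auto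
      moreover have "5 * \<eta> \<le> \<epsilon>\<^sup>2 / 128" unfolding eta by simp
      ultimately show ?thesis by (simp add: algebra_simps)
    next
      case False
      have "0 \<le> B * \<rho>\<^sup>2" using B e by simp
      moreover have "B / 2 * (\<rho>\<^sup>2 - L) = (B * \<rho>\<^sup>2 - B * L) / 2" by (simp add: algebra_simps)
      moreover have "B * L \<le> (1 + \<eta>) / 2" using L2 x1 by argo
      ultimately have 1: "- (1 + \<eta>) / 4 \<le> B / 2 * (\<rho>\<^sup>2 - L)" by argo
      have "(1 - \<eta>) * 2 \<le> (1 - \<eta>) * \<sigma>" using False eta0 by (intro mult_left_mono) auto
      moreover have "\<epsilon>\<^sup>2 \<le> (1 / 10)\<^sup>2" using e by (intro power_mono) auto
      hence "\<epsilon>\<^sup>2 \<le> 1 / 100" "\<eta> \<le> 1 / 1000" unfolding eta by (simp_all add: power2_eq_square)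
      ultimately show ?thesis using 1 by argo
    qed
    have t1: "B / 2 * (\<rho>\<^sup>2 - L) * (k * l) = w / 2 * ((real (card (R c)))\<^sup>2 - Q c)"
    proof -
      have "B / 2 * (\<rho>\<^sup>2 - L) * (k * l) = (w * (real k)\<^sup>2) / 2 * (\<rho>\<^sup>2 - L)" unfolding wB by simp
      also have "\<dots> = w / 2 * ((real k)\<^sup>2 * (\<rho>\<^sup>2 - L))" by simp
      also have "(real k)\<^sup>2 * (\<rho>\<^sup>2 - L) = (real (card (R c)))\<^sup>2 - Q c"
        using k0 by (simp add: \<rho>_def L_def field_simps power_divide)
      finally show ?thesis .
    qed
    have t2: "w / 2 * (k + d1 * M) \<le> \<eta> * (k * l)" using err by (simp add: w_def)
    have t3: "(1 - \<eta>) * \<sigma> * (k * l) \<le> real (k - card (R c)) * ln (N / k) + a c * (ln (1 / (q * h)) - w)"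
    proof -
      have "\<sigma> * k = real (k - card (R c)) + a c"
      proof -
        have "\<sigma> * k = (real k - real (card (R c))) + a c" using k0 by (simp add: \<sigma>_def \<rho>_def \<alpha>_def field_simps)
        thus ?thesis using of_nat_diff[OF card_R[of c], where 'a = real] by linarith
      qed
      hence "(1 - \<eta>) * \<sigma> * (k * l) = real (k - card (R c)) * ((1 - \<eta>) * l) + a c * ((1 - \<eta>) * l)"
        by (metis (no_types, lifting) distrib_right mult.assoc mult.commute)
      also have "\<dots> \<le> real (k - card (R c)) * ln (N / k) + a c * (ln (1 / (q * h)) - w)"
        using lnN lnq a0 by (intro add_mono mult_left_mono) (auto simp: w_def)
      finally show ?thesis .
    qed
    have "k * l * (1 / 2 + \<epsilon>\<^sup>2 / 128) \<le> k * l * (B / 2 * (\<rho>\<^sup>2 - L) - \<eta> + (1 - \<eta>) * \<sigma>)"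
      using main kl by (intro mult_left_mono) auto
    also have "\<dots> = B / 2 * (\<rho>\<^sup>2 - L) * (k * l) - \<eta> * (k * l) + (1 - \<eta>) * \<sigma> * (k * l)"
      by (simp add: algebra_simps)
    also have "\<dots> \<le> w / 2 * ((real (card (R c)))\<^sup>2 - Q c) - w / 2 * (k + d1 * M)
        + (real (k - card (R c)) * ln (N / k) + a c * (ln (1 / (q * h)) - w))"
      using t1 t2 t3 by linarith
    finally show ?thesis by (simp add: algebra_simps)
  qed
  have cA: "real (card A) = (\<Sum>c\<in>UNIV. a c)" unfolding a_def cnt(3) by simp
  have "k * l * (1 + \<epsilon>\<^sup>2 / 64) = (\<Sum>c\<in>(UNIV :: bool set). k * l * (1 / 2 + \<epsilon>\<^sup>2 / 128))"
    by (simp add: algebra_simps)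
  also have "\<dots> \<le> (\<Sum>c\<in>UNIV. w / 2 * ((real (card (R c)))\<^sup>2 - k - d1 * M - Q c) - w * a c + real (k - card (R c)) * ln (N / k) + a c * ln (1 / (q * h)))"
    by (intro sum_mono each)
  also have "\<dots> = w / 2 * (\<Sum>c\<in>UNIV. (real (card (R c)))\<^sup>2 - k - d1 * M - Q c) - w * card A
      + (\<Sum>c\<in>UNIV. real (k - card (R c)) * ln (N / k)) + card A * ln (1 / (q * h))"
    unfolding cA by (simp add: UNIV_bool algebra_simps)
  also have "\<dots> \<le> w / 2 * (2 * real (card (open_pairs H A))) - w * card A
      + (\<Sum>c\<in>UNIV. real (k - card (R c)) * ln (N / k)) + card A * ln (1 / (q * h))"
    using cnt(1) w0 by (intro add_right_mono diff_right_mono mult_left_mono) auto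
  finally have fin: "- (w * (real (card (open_pairs H A)) - card A)) \<le> - (k * l * (1 + \<epsilon>\<^sup>2 / 64))
      + (\<Sum>c\<in>UNIV. real (k - card (R c)) * ln (N / k)) + card A * ln (1 / (q * h))"
    by (simp add: algebra_simps)
  have p1: "exp (real m * ln y) = y ^ m" if "0 < y" for y :: real and m
    using that by (simp add: exp_of_nat_mult)
  have "exp (- (w * (real (card (open_pairs H A)) - card A))) \<le> exp (- (k * l * (1 + \<epsilon>\<^sup>2 / 64))
      + (\<Sum>c\<in>UNIV. real (k - card (R c)) * ln (N / k)) + card A * ln (1 / (q * h)))"
    using fin by simp
  also have "\<dots> = exp (- (k * l * (1 + \<epsilon>\<^sup>2 / 64))) * (\<Prod>c\<in>UNIV. (N / k) ^ (k - card (R c))) * (1 / (q * h)) ^ card A"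
    unfolding exp_add using k0 N0 q h0 by (simp add: exp_sum p1)
  finally show ?thesis by (simp add: w_def)
qed

end

subsection \<open>Choice of parameters\<close>

text \<open>Only the term \<open>k ^ k / fact k\<close> of the exponential series at
  \<open>k\<close> is used.\<close>

lemma binomial_le_exp:
  assumes "0 < k"
  shows "real (n choose k) \<le> exp k * (n / k) ^ k"
proof -
  have "real k ^ k /\<^sub>R fact k \<le> (\<Sum>i. real k ^ i /\<^sub>R fact i)"
    using sum_le_suminf[OF summable_exp_generic[of "real k"], of "{k}"] by simp
  hence 1: "real k ^ k \<le> exp k * fact k" by (simp add: exp_def divide_simps mult_ac)
  have 2: "real (n choose k) * fact k \<le> real n ^ k"
    using of_nat_mono[OF binomial_fact_pow[of n k], where 'a = real] by simp
  have "real (n choose k) * fact k * real k ^ k \<le> real n ^ k * (exp k * fact k)"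
    using 1 2 by (intro mult_mono) auto
  thus ?thesis using assms by (simp add: power_divide field_simps)
qed

text \<open>The Chernoff rate for exceeding a mean by the factor \<open>1 + x\<close> is
  \<open>(1 + x) * ln (1 + x) - x\<close>. Its positivity is strictness of
  \<open>ln t \<le> t - 1\<close> at \<open>t = 1 / (1 + x)\<close>.\<close>

lemma ln_gain_pos:
  fixes x :: real
  assumes "0 < x"
  shows "x < (1 + x) * ln (1 + x)"
proof -
  have "ln (1 / (1 + x)) \<noteq> 1 / (1 + x) - 1" using ln_eq_minus_one[of "1 / (1 + x)"] assms by auto
  moreover have "ln (1 / (1 + x)) \<le> 1 / (1 + x) - 1" using assms by (intro ln_le_minus_one) auto
  ultimately have "ln (1 / (1 + x)) < 1 / (1 + x) - 1" by simp
  hence "1 - 1 / (1 + x) < ln (1 + x)" using assms by (simp add: ln_div)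
  thus ?thesis using assms by (simp add: field_simps)
qed

text \<open>Conditions on \<open>n\<close> imposed by the choice of parameters, with
  \<open>x\<close> for \<open>n\<close>. The bound on \<open>\<delta>\<close> keeps the accumulated
  multiples of \<open>\<delta>\<close>, up to \<open>11 * \<delta>\<close>, well below the exponent
  \<open>1 / 2\<close> of \<open>sqrt x\<close>.\<close>

lemma large_parameter_estimates:
  fixes \<delta> \<psi> C \<kappa> \<eta> :: real
  assumes "0 < \<delta>" "\<delta> < 1 / 100" "0 < \<psi>" "0 < C" "0 < \<kappa>" "0 < \<eta>"
  shows "\<forall>\<^sub>F x::real in at_top. 2 * x powr (2 * \<delta>) \<le> sqrt x * x powr (- 4 * \<delta>)" 
    and "\<forall>\<^sub>F x::real in at_top. 4 * x powr (1 - \<delta>) * exp (- \<psi> * x powr \<delta> / 2) \<le> 1 / 8"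
    and "\<forall>\<^sub>F x::real in at_top. 4 * x powr (1 - \<delta>) * exp (- \<psi> * (1 / 2 * sqrt (ln x / x) * x powr (1 - \<delta>))) \<le> 1 / 8"
    and "\<forall>\<^sub>F x::real in at_top. 2 * x powr (1 - \<delta>) * (ln x / (4 * x)) \<le> x powr (- \<delta> / 2) / 2"
    and "\<forall>\<^sub>F x::real in at_top. 2 * x powr (1 - \<delta>) * exp (- (\<delta> / 8 * ln x * x powr \<delta>) + ln x * x powr (\<delta> / 2)) \<le> 1"
    and "\<forall>\<^sub>F x::real in at_top. 24 * ln x \<le> sqrt x * x powr (- 5 * \<delta>)"
    and "\<forall>\<^sub>F x::real in at_top. 8 * x powr (\<delta> / 8) * (1 / 2 * sqrt (ln x / x) * (2 * x powr \<delta> + 4 * x powr (4 * \<delta>))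
          + ln x * (2 * C * x powr (- 3 * \<delta>) + x powr (- \<delta> / 2))) \<le> 1"
    and "\<forall>\<^sub>F x::real in at_top. 4 * C * x powr (5 * \<delta>) * ln (4 * x) \<le> sqrt x"
    and "\<forall>\<^sub>F x::real in at_top. x powr (1 / 2 - 10 * \<delta>) \<le> x powr (1 - \<delta>) / (3 * sqrt (x * ln x))"
    and "\<forall>\<^sub>F x::real in at_top. exp 1 * x powr (1 / 2 - 10 * \<delta>) \<le> 1 / (1 / 2 * sqrt (ln x / x) * (4 * C * x powr (5 * \<delta>)))"
    and "\<forall>\<^sub>F x::real in at_top. 1 + C * x powr (- \<delta> / 2) \<le> \<eta> * ln x / 2"
    and "\<forall>\<^sub>F x::real in at_top. 4 * C * x powr (5 * \<delta>) \<le> \<eta> * sqrt x"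
    and "\<forall>\<^sub>F x::real in at_top. 32 * C\<^sup>2 * \<kappa> * x powr (11 * \<delta>) \<le> \<eta> * sqrt x"
    and "\<forall>\<^sub>F x::real in at_top. x powr (1 - \<delta>) + 1 \<le> x"
  using assms by real_asymp+


section \<open>Triangle-freeness of the two-colour graph\<close>

lemma triangle_free_two_colour:
  fixes p :: "bool \<Rightarrow> 'a \<Rightarrow> 'b"
  shows "triangle_free V {\<tau>\<in>nsets V 2. (\<exists>c. (c, p c ` \<tau>) \<in> E) \<and> \<not> (\<exists>c v. \<forall>x\<in>\<tau>. (c, {p c x, v}) \<in> E)}"
    (is "triangle_free V ?G")
  unfolding triangle_free_def
proof
  assume "\<exists>T\<subseteq>V. card T = 3 \<and> clique T ?G"
  then obtain T where T: "card T = 3" "clique T ?G" by blast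
  then obtain x y z where xyz: "T = {x, y, z}" "x \<noteq> y" "y \<noteq> z" "x \<noteq> z" by (auto simp: card_3_iff)
  have edge: "\<exists>c. (c, {p c u, p c w}) \<in> E" and notclosed: "\<not> ((c, {p c u, v}) \<in> E \<and> (c, {p c w, v}) \<in> E)"
    if "u \<in> T" "w \<in> T" "u \<noteq> w" for u w c v
  proof -
    have "{u, w} \<in> ?G" using T(2) that by (auto simp: clique_def)
    thus "\<exists>c. (c, {p c u, p c w}) \<in> E" "\<not> ((c, {p c u, v}) \<in> E \<and> (c, {p c w, v}) \<in> E)" by auto
  qed
  \<comment> \<open>The projection \<open>p c b\<close> of the shared endpoint is the common
    neighbour that closes the pair \<open>a\<close>, \<open>d\<close>.\<close>
  have no: False if "(c, {p c a, p c b}) \<in> E" "(c, {p c b, p c d}) \<in> E" "a \<in> T" "d \<in> T" "a \<noteq> d" for a b c d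
    using notclosed[OF that(3-5), of c "p c b"] that(1,2) by (simp add: insert_commute)
  obtain c1 where c1: "(c1, {p c1 x, p c1 y}) \<in> E" using edge[of x y] xyz by auto
  obtain c2 where c2: "(c2, {p c2 y, p c2 z}) \<in> E" using edge[of y z] xyz by auto
  obtain c3 where c3: "(c3, {p c3 z, p c3 x}) \<in> E" using edge[of z x] xyz by auto
  have T3: "x \<in> T" "y \<in> T" "z \<in> T" using xyz by auto
  have "c1 \<noteq> c2" using no[OF c1, of z] c2 T3 xyz by blast
  moreover have "c2 \<noteq> c3" using no[OF c2, of x] c3 T3 xyz by blast
  moreover have "c3 \<noteq> c1" using no[OF c3, of y] c1 T3 xyz by blast
  ultimately show False by (cases c1; cases c2; cases c3) auto
qed

lemma eventually_construction:
  fixes \<epsilon> :: real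
  assumes e: "0 < \<epsilon>" "\<epsilon> \<le> 1 / 10"
  shows "\<forall>\<^sub>F n in sequentially. \<exists>p E. \<forall>I\<subseteq>{..<n}. card I = nat \<lceil>(1 + \<epsilon>) * sqrt (real n * ln (real n))\<rceil> \<longrightarrow>
    (\<exists>c :: bool. \<exists>\<tau>\<in>nsets I 2. (c, (p c :: nat \<Rightarrow> nat) ` \<tau>) \<in> E \<and> \<not> (\<exists>c' v. \<forall>x\<in>\<tau>. (c', {p c' x, v}) \<in> E))"
proof -
  define \<eta> where "\<eta> = \<epsilon>\<^sup>2 / 1280"
  \<comment> \<open>The factor 20 turns \<open>(1 - \<eta>) / 2\<close> into
    \<open>1 / 2 - 10 * \<delta>\<close>, room for the powers of \<open>n\<close> lost in
    \<open>N / k\<close> and in \<open>1 / (q * h)\<close>.\<close>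
  define \<delta> where "\<delta> = \<eta> / 20"
  \<comment> \<open>Relative excess allowed for fibres and degrees. With \<open>z = 2 * e1\<close>
    the product \<open>(1 - z) * (1 + e1)\<^sup>2\<close> is at most 1, while
    \<open>(1 - z) * (1 + \<epsilon>)\<close> still exceeds
    \<open>1 + \<epsilon> / 2\<close>.\<close>
  define e1 where "e1 = \<epsilon> / 8"
  define \<psi> where "\<psi> = (1 + e1) * ln (1 + e1) - e1"
  \<comment> \<open>With \<open>M = C * k\<close> and \<open>t1 = K * k\<close> these constants make
    \<open>Z2 powr (- M / 4)\<close> equal to \<open>n powr (- 8 * k)\<close> and
    \<open>Z3 powr (- t1)\<close> equal to \<open>n powr (- 4 * k)\<close>, against at most
    \<open>n ^ k\<close> sets.\<close>
  define C where "C = 64 / \<delta>"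
  define K where "K = 32 / \<delta>"
  define z where "z = \<epsilon> / 4"
  \<comment> \<open>As \<open>N * q\<^sup>2\<close> is at most
    \<open>n powr (- \<delta> / 2)\<close>, this many common neighbours give the factor
    \<open>n powr (- 3)\<close>, which beats the number of vertex pairs.\<close>
  define \<kappa> where "\<kappa> = nat \<lceil>6 / \<delta>\<rceil>"
  \<comment> \<open>Once \<open>ln n\<close> exceeds \<open>G\<close>, the gain
    \<open>k * l * (\<epsilon>\<^sup>2 / 64)\<close> absorbs all factors that are exponential in
    \<open>k\<close> only.\<close>
  define G where "G = max 3 ((14 + 5 * K * ln (1 / z)) / (\<epsilon>\<^sup>2 / 128))"
  have ee: "0 < \<epsilon>\<^sup>2" "\<epsilon>\<^sup>2 \<le> 1 / 100" using e power_mono[of \<epsilon> "1 / 10" 2] by (auto simp: power2_eq_square)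
  have eta: "0 < \<eta>" "\<eta> \<le> 1 / 1000" using ee by (auto simp: \<eta>_def)
  have delta: "0 < \<delta>" "\<delta> < 1 / 100" using eta by (auto simp: \<delta>_def)
  have eta_delta: "(1 - \<eta>) / 2 = 1 / 2 - 10 * \<delta>" by (simp add: \<delta>_def)
  have e1: "0 < e1" "e1 \<le> 1 / 80" using e by (auto simp: e1_def)
  have psi: "0 < \<psi>" using ln_gain_pos[OF e1(1)] by (simp add: \<psi>_def)
  have C0: "0 < C" and K0: "0 < K" and z0: "0 < z" "z \<le> 1" using delta e by (auto simp: C_def K_def z_def)
  have kap: "6 / \<delta> \<le> real \<kappa>" by (simp add: \<kappa>_def real_nat_ceiling_ge)
  have kap0: "0 < real \<kappa>" using order.strict_trans2[OF _ kap, of 0] delta by simp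
  have "\<forall>\<^sub>F x::real in at_top. G \<le> ln x" by real_asymp
  note A = large_parameter_estimates(1-8)[OF delta psi C0 kap0 eta(1)] this
    large_parameter_estimates(9-)[OF delta psi C0 kap0 eta(1)]
  note A' = A[THEN eventually_compose_filterlim[OF _ filterlim_real_sequentially]]
  show ?thesis
    using A' eventually_gt_at_top[of "16 :: nat"]
  proof eventually_elim
    case (elim n)
    note R = elim
    define x where "x = real n"
    define L where "L = ln x"
    define q where "q = 1 / 2 * sqrt (L / x)"
    define N where "N = nat \<lceil>x powr (1 - \<delta>)\<rceil>"
    define s where "s = sqrt (x * L)"
    define k where "k = nat \<lceil>(1 + \<epsilon>) * s\<rceil>"
    define f where "f = (1 + e1) * x / N"
    define d1 where "d1 = (1 + e1) * N * q"
    define D0 where "D0 = x powr \<delta>"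
    \<comment> \<open>A balance: the threshold is high enough to leave only
      \<open>O(n powr (5 * \<delta>))\<close> heavy vertices, and low enough that
      \<open>q * D1 * f * M\<close>, the cost of the light ones, stays below
      \<open>k\<close>.\<close>
    define D1 where "D1 = k * x powr (- 4 * \<delta>)"
    define M where "M = C * k"
    define h where "h = 2 * M * f / D1"
    \<comment> \<open>At least twice \<open>N * q\<^sup>2 * k\<^sup>2\<close>, which makes the
      exponent in \<open>prob_many_cherries\<close> negative, while \<open>q * c1\<close> is still
      small against \<open>k\<close>.\<close>
    define c1 where "c1 = (real k)\<^sup>2 * x powr (- \<delta> / 2)"
    define t1 where "t1 = K * k"
    define Z1 where "Z1 = 1 + e1"
    define Z2 where "Z2 = x powr (\<delta> / 2)"
    define Z3 where "Z3 = x powr (\<delta> / 8)"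
    \<comment> \<open>Since \<open>n / k\<close> is at most \<open>sqrt n\<close>, there are at most
      \<open>exp (k + k * l)\<close> sets of size \<open>k\<close>, so \<open>k * l\<close> is the
      natural unit of all exponents.\<close>
    define l where "l = L / 2"
    define Mx where "Mx = exp (- (k * l * (1 + \<epsilon>\<^sup>2 / 64)))"
    define y where "y = x powr (1 - \<delta>)"
    note R = R[folded x_def, folded L_def, folded y_def, folded q_def]
    have x16: "16 < x" using R by (simp add: x_def)
    have x0: "0 < x" using x16 by simp
    have L3: "3 \<le> L" and LG: "(14 + 5 * K * ln (1 / z)) / (\<epsilon>\<^sup>2 / 128) \<le> L" using R(9) by (auto simp: G_def)
    have y1: "1 \<le> y" unfolding y_def using x16 delta by (intro ge_one_powr_ge_zero) auto
    have Nlo: "y \<le> N" unfolding N_def y_def by (rule real_nat_ceiling_ge)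
    have Nup: "N \<le> y + 1" unfolding N_def y_def[symmetric] using y1 by (simp add: of_nat_nat)
    have N2: "N \<le> 2 * y" using Nup y1 by simp
    have N0: "0 < N" using Nlo y1 by simp
    have N1: "0 < real N" using N0 by simp
    have Nx: "N \<le> x" using Nup R(15) by simp
    have xp: "x powr a * x powr b = x powr (a + b)" for a b by (simp add: powr_add)
    have yx: "y * x powr \<delta> = x" unfolding y_def xp using x0 by simp
    have s0: "0 < s" using x0 L3 by (simp add: s_def)
    have sx: "sqrt x \<le> s" unfolding s_def using x0 L3 by (intro real_sqrt_le_mono) simp
    have sqx: "1 < sqrt x" using x16 by simp
    have klo: "(1 + \<epsilon>) * s \<le> k" unfolding k_def by (rule real_nat_ceiling_ge)
    have kup: "k \<le> (1 + \<epsilon>) * s + 1"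
    proof -
      have "0 \<le> (1 + \<epsilon>) * s" using s0 e by simp
      thus ?thesis unfolding k_def by (simp add: of_nat_nat)
    qed
    have "1 * s \<le> (1 + \<epsilon>) * s" using e s0 by (intro mult_right_mono) auto
    hence ks: "s \<le> k" using klo by simp
    have kx: "sqrt x \<le> k" using ks sx by simp
    have k3: "k \<le> 3 * s"
    proof -
      have "(1 + \<epsilon>) * s \<le> 2 * s" using e s0 by (intro mult_right_mono) auto
      thus ?thesis using kup sx sqx by linarith
    qed
    have k1: "1 \<le> real k" using kx sqx by linarith
    have k0: "0 < k" using k1 by simp
    have q0: "0 < q" using x0 L3 by (simp add: q_def)
    have Lx: "L \<le> x" unfolding L_def using ln_le_minus_one[OF x0] by simp
    have q12: "q \<le> 1 / 2" unfolding q_def using Lx x0 by simp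
    have qs: "q * s = L / 2"
    proof -
      have "sqrt (L / x) * sqrt (x * L) = sqrt (L * L)" using x0 by (simp add: real_sqrt_mult[symmetric])
      thus ?thesis using L3 by (simp add: q_def s_def)
    qed
    have qq: "q\<^sup>2 = L / (4 * x)" unfolding q_def using x0 L3 by (simp add: power_mult_distrib power_divide)
    have qklo: "(1 + \<epsilon>) * L / 2 \<le> q * k"
    proof -
      have "q * ((1 + \<epsilon>) * s) \<le> q * k" using klo q0 by (intro mult_left_mono) auto
      thus ?thesis using qs by (simp add: algebra_simps)
    qed
    have qkL: "q * k \<le> L"
    proof -
      have "q * k \<le> q * ((1 + \<epsilon>) * s + 1)" using kup q0 by (intro mult_left_mono) auto
      also have "\<dots> = (1 + \<epsilon>) * (q * s) + q" by (simp add: algebra_simps)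
      also have "\<dots> \<le> (1 + 1 / 10) * (L / 2) + 1 / 2"
        unfolding qs using e L3 q12 by (intro add_mono mult_right_mono) auto
      also have "\<dots> \<le> L" using L3 by simp
      finally show ?thesis .
    qed
    have kL: "3 \<le> k * L" using mult_mono[of 1 "real k" 3 L] k1 L3 by simp
    have xNlo: "x powr \<delta> / 2 \<le> x / N"
    proof -
      have "x powr \<delta> * N \<le> x powr \<delta> * (2 * y)" using N2 by (intro mult_left_mono) auto
      also have "\<dots> = 2 * x" using yx by (simp add: mult_ac)
      finally show ?thesis using N1 by (simp add: field_simps)
    qed
    have xNup: "x / N \<le> x powr \<delta>"
    proof -
      have "x powr \<delta> * y \<le> x powr \<delta> * N" using Nlo by (intro mult_left_mono) auto
      hence "x \<le> x powr \<delta> * N" using yx by (simp add: mult_ac)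
      thus ?thesis using N1 by (simp add: field_simps)
    qed
    have fup: "f \<le> 2 * x powr \<delta>"
    proof -
      have "f = (1 + e1) * (x / N)" by (simp add: f_def)
      also have "\<dots> \<le> 2 * x powr \<delta>" using xNup e1 x0 N1 by (intro mult_mono) auto
      finally show ?thesis .
    qed
    have f1: "1 \<le> f"
    proof -
      have "1 \<le> x / N" using Nx N1 by simp
      hence "1 * 1 \<le> (1 + e1) * (x / N)" using e1 by (intro mult_mono) auto
      thus ?thesis by (simp add: f_def)
    qed
    have D0: "0 < D0" and D1: "0 < D1" using x0 k0 by (auto simp: D0_def D1_def)
    have fD: "f * D0 \<le> D1"
    proof -
      have "f * D0 \<le> 2 * x powr \<delta> * x powr \<delta>" unfolding D0_def using fup by (intro mult_right_mono) auto
      also have "\<dots> = 2 * x powr (2 * \<delta>)" by (simp add: xp)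
      also have "\<dots> \<le> sqrt x * x powr (- 4 * \<delta>)" by (rule R(1))
      also have "\<dots> \<le> D1" unfolding D1_def using kx by (intro mult_right_mono) auto
      finally show ?thesis .
    qed
    have M0: "0 < M" using C0 k1 by (simp add: M_def)
    have h_eq: "h = 2 * C * f * x powr (4 * \<delta>)"
      using k0 x0 by (simp add: h_def M_def D1_def powr_minus field_simps)
    have h0: "0 < h" unfolding h_eq using C0 f1 x0 by simp
    have hup: "h \<le> 4 * C * x powr (5 * \<delta>)"
    proof -
      have "h \<le> 2 * C * (2 * x powr \<delta>) * x powr (4 * \<delta>)"
        unfolding h_eq using fup C0 by (intro mult_right_mono mult_left_mono) auto
      also have "\<dots> = 4 * C * (x powr \<delta> * x powr (4 * \<delta>))" by simp
      finally show ?thesis unfolding xp by simp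
    qed
    have Nqq: "N * q\<^sup>2 \<le> x powr (- \<delta> / 2) / 2"
    proof -
      have "N * q\<^sup>2 \<le> 2 * y * (L / (4 * x))" unfolding qq using N2 L3 x0 by (intro mult_right_mono) auto
      thus ?thesis using R(4) by linarith
    qed
    have lnZ1: "Z1 powr (- a * (1 + e1)) * exp (a * (Z1 - 1)) = exp (- \<psi> * a)" for a
    proof -
      have "Z1 powr (- a * (1 + e1)) = exp (- a * (1 + e1) * ln (1 + e1))" using e1 by (simp add: Z1_def powr_def)
      thus ?thesis by (simp add: exp_add[symmetric] \<psi>_def Z1_def algebra_simps)
    qed
    have fib: "2 * N * (Z1 powr (- f) * exp ((Z1 - 1) * n / N)) \<le> 1 / 8"
    proof -
      have "Z1 powr (- f) * exp ((Z1 - 1) * n / N) = exp (- \<psi> * (x / N))"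
        using lnZ1[of "x / N"] by (simp add: f_def x_def mult_ac)
      also have "2 * N * \<dots> \<le> 4 * y * exp (- \<psi> * x powr \<delta> / 2)"
      proof (rule mult_mono)
        have "\<psi> * (x powr \<delta> / 2) \<le> \<psi> * (x / N)" using xNlo psi by (intro mult_left_mono) auto
        thus "exp (- \<psi> * (x / N)) \<le> exp (- \<psi> * x powr \<delta> / 2)" by simp
      qed (use N2 y1 in auto)
      also have "\<dots> \<le> 1 / 8" by (rule R(2))
      finally show ?thesis .
    qed
    have deg: "2 * N * (Z1 powr (- d1) * exp (q * N * (Z1 - 1))) \<le> 1 / 8"
    proof -
      have "Z1 powr (- d1) * exp (q * N * (Z1 - 1)) = exp (- \<psi> * (q * N))"
        using lnZ1[of "q * N"] by (simp add: d1_def mult_ac)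
      also have "2 * N * \<dots> \<le> 4 * y * exp (- \<psi> * (q * y))"
      proof (rule mult_mono)
        have "\<psi> * (q * y) \<le> \<psi> * (q * N)" using Nlo q0 psi by (intro mult_left_mono) auto
        thus "exp (- \<psi> * (q * N)) \<le> exp (- \<psi> * (q * y))" by simp
      qed (use N2 y1 in auto)
      also have "\<dots> \<le> 1 / 8" by (rule R(3))
      finally show ?thesis .
    qed
    have codeg: "2 * (real N)\<^sup>2 * (N * q\<^sup>2) ^ Suc \<kappa> \<le> 1 / 8"
    proof -
      have "(N * q\<^sup>2) ^ Suc \<kappa> \<le> (x powr (- \<delta> / 2)) ^ Suc \<kappa>"
      proof (rule power_mono)
        show "N * q\<^sup>2 \<le> x powr (- \<delta> / 2)" using Nqq powr_ge_zero[of x "- \<delta> / 2"] by linarith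
      qed simp
      also have "\<dots> = (x powr (- \<delta> / 2)) powr Suc \<kappa>" by (rule powr_realpow[symmetric]) (use x0 in simp)
      also have "\<dots> = x powr (- \<delta> / 2 * Suc \<kappa>)" by (rule powr_powr)
      also have "\<dots> \<le> x powr (- 3)"
      proof (rule powr_mono)
        have "6 \<le> \<delta> * real \<kappa>" using kap delta by (simp add: field_simps)
        thus "- \<delta> / 2 * real (Suc \<kappa>) \<le> - 3" using delta by (simp add: algebra_simps)
      qed (use x16 in auto)
      finally have 1: "(N * q\<^sup>2) ^ Suc \<kappa> \<le> x powr (- 3)" .
      have "(real N)\<^sup>2 \<le> x\<^sup>2" using Nx by (intro power_mono) auto
      hence "2 * (real N)\<^sup>2 * (N * q\<^sup>2) ^ Suc \<kappa> \<le> 2 * x\<^sup>2 * x powr (- 3)"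
        using 1 N1 q0 by (intro mult_mono) auto
      also have "\<dots> = 2 / x" 
      proof -
        have "x powr (- 3) = 1 / x ^ 3" using x0 by (simp add: powr_minus_divide)
        thus ?thesis using x0 by (simp add: power2_eq_square power3_eq_cube)
      qed
      also have "\<dots> \<le> 1 / 8" using x16 by (simp add: field_simps)
      finally show ?thesis .
    qed
    have exp4: "exp (- 4) \<le> (1 / 16 :: real)"
    proof -
      have "(2 :: real) ^ 4 \<le> exp 1 ^ 4" using exp_ge_add_one_self[of 1] by (intro power_mono) auto
      also have "exp 1 ^ 4 = (exp 4 :: real)" by (simp add: exp_of_nat_mult[symmetric])
      finally show ?thesis by (simp add: exp_minus field_simps)
    qed
    have binom1: "real (n choose k) \<le> exp (k * L)"
    proof -
      have "n choose k \<le> n ^ k" by (cases "k \<le> n") (auto intro: binomial_le_pow simp: binomial_eq_0)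
      hence "real (n choose k) \<le> real (n ^ k)" by (rule of_nat_mono)
      also have "\<dots> = exp (k * L)" using x0 by (simp add: L_def x_def exp_of_nat_mult)
      finally show ?thesis .
    qed
    have dns1: "N * (Z2 powr (- D0 / 4) * exp (q * k * Z2)) \<le> 1"
    proof -
      have Z2D: "Z2 powr (- D0 / 4) = exp (- (\<delta> / 8 * L * x powr \<delta>))"
      proof -
        have "Z2 powr (- D0 / 4) = x powr (\<delta> / 2 * (- D0 / 4))" by (simp add: Z2_def powr_powr)
        also have "\<dots> = exp (\<delta> / 2 * (- D0 / 4) * L)" using x0 by (simp add: powr_def L_def)
        finally show ?thesis by (simp add: D0_def mult_ac)
      qed
      have "q * k * Z2 \<le> L * x powr (\<delta> / 2)" unfolding Z2_def using qkL by (intro mult_right_mono) auto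
      hence "Z2 powr (- D0 / 4) * exp (q * k * Z2) \<le> exp (- (\<delta> / 8 * L * x powr \<delta>) + L * x powr (\<delta> / 2))"
        unfolding Z2D exp_add by (intro mult_left_mono) auto
      hence "N * (Z2 powr (- D0 / 4) * exp (q * k * Z2)) \<le> 2 * y * exp (- (\<delta> / 8 * L * x powr \<delta>) + L * x powr (\<delta> / 2))"
        using N2 y1 by (intro mult_mono) auto
      thus ?thesis using R(5) by linarith
    qed
    have dns2: "(n choose k) * (2 * exp 1 * Z2 powr (- M / 4)) \<le> 1 / 8"
    proof -
      have "Z2 powr (- M / 4) = x powr (\<delta> / 2 * (- M / 4))" by (simp add: Z2_def powr_powr)
      also have "\<delta> / 2 * (- M / 4) = - 8 * k" using delta by (simp add: M_def C_def)
      also have "x powr (- 8 * k) = exp (- 8 * (k * L))" using x0 by (simp add: powr_def L_def)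
      finally have "(n choose k) * (2 * exp 1 * Z2 powr (- M / 4)) \<le> exp (k * L) * (2 * exp 1 * exp (- 8 * (k * L)))"
        using binom1 by (intro mult_mono) auto
      also have "\<dots> = 2 * exp (1 - 7 * (k * L))" by (simp add: exp_add[symmetric] exp_diff field_simps exp_minus)
      also have "\<dots> \<le> 2 * exp (- 4)" using kL by (simp add: mult.commute[of L])
      finally show ?thesis using exp4 by simp
    qed
    have chr: "(n choose k) * (2 * exp (- (1 / (f * D0)\<^sup>2) * c1 + N * (1 / (f * D0)\<^sup>2 * q\<^sup>2 * k\<^sup>2))) \<le> 1 / 8"
    proof -
      define \<theta> where "\<theta> = 1 / (f * D0)\<^sup>2"
      have "(f * D0)\<^sup>2 \<le> (2 * x powr \<delta> * x powr \<delta>)\<^sup>2"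
        unfolding D0_def using fup f1 by (intro power_mono mult_right_mono) auto
      also have "\<dots> = 4 * x powr (4 * \<delta>)" by (simp add: power2_eq_square xp)
      finally have "1 / (4 * x powr (4 * \<delta>)) \<le> \<theta>" unfolding \<theta>_def using f1 D0 x0 by (intro divide_left_mono) auto
      hence th: "x powr (- 4 * \<delta>) / 4 \<le> \<theta>" by (simp add: powr_minus field_simps)
      have "c1 - N * (q\<^sup>2 * k\<^sup>2) = (real k)\<^sup>2 * (x powr (- \<delta> / 2) - N * q\<^sup>2)" by (simp add: c1_def algebra_simps)
      also have "\<dots> \<ge> (real k)\<^sup>2 * (x powr (- \<delta> / 2) / 2)" using Nqq by (intro mult_left_mono) auto
      finally have d: "(real k)\<^sup>2 * (x powr (- \<delta> / 2) / 2) \<le> c1 - N * (q\<^sup>2 * k\<^sup>2)" .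
      have "x powr (- 4 * \<delta>) / 4 * ((real k)\<^sup>2 * (x powr (- \<delta> / 2) / 2)) \<le> \<theta> * (c1 - N * (q\<^sup>2 * k\<^sup>2))"
        using th d by (intro mult_mono) (auto simp: \<theta>_def)
      moreover have "x powr (- 4 * \<delta>) / 4 * ((real k)\<^sup>2 * (x powr (- \<delta> / 2) / 2))
          = (real k)\<^sup>2 / 8 * x powr (- 4 * \<delta> - \<delta> / 2)"
        using xp[of "- 4 * \<delta>" "- \<delta> / 2"] by simp
      moreover have "(real k)\<^sup>2 / 8 * x powr (- 5 * \<delta>) \<le> (real k)\<^sup>2 / 8 * x powr (- 4 * \<delta> - \<delta> / 2)"
        using delta x16 by (intro mult_left_mono powr_mono) auto
      moreover have "3 * (k * L) \<le> (real k)\<^sup>2 / 8 * x powr (- 5 * \<delta>)"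
      proof -
        have "24 * L \<le> sqrt x * x powr (- 5 * \<delta>)" by (rule R(6))
        also have "\<dots> \<le> k * x powr (- 5 * \<delta>)" using kx by (intro mult_right_mono) auto
        finally have "k * (24 * L) \<le> k * (k * x powr (- 5 * \<delta>))" by (intro mult_left_mono) auto
        thus ?thesis by (simp add: power2_eq_square)
      qed
      ultimately have "3 * (k * L) \<le> \<theta> * (c1 - N * (q\<^sup>2 * k\<^sup>2))" by linarith
      hence ex: "- \<theta> * c1 + N * (\<theta> * q\<^sup>2 * k\<^sup>2) \<le> - 3 * (k * L)" by (simp add: algebra_simps)
      have "(n choose k) * (2 * exp (- \<theta> * c1 + N * (\<theta> * q\<^sup>2 * k\<^sup>2))) \<le> exp (k * L) * (2 * exp (- 3 * (k * L)))"
        using binom1 ex by (intro mult_mono) auto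
      also have "\<dots> = 2 * exp (- 2 * (k * L))" by (simp add: exp_add[symmetric])
      also have "\<dots> \<le> 2 * exp (- 4)" using kL by (simp add: mult.commute[of L])
      finally show ?thesis using exp4 by (simp add: \<theta>_def)
    qed
    have q1: "q < 1" using q12 by simp
    have cls: "(n choose k) * (Z3 powr (- t1) * exp (q / (1 - q) * Z3 * (4 * (k * f + D1 * f * M + k * (f * D0)\<^sup>2 + c1)))) \<le> 1 / 8"
    proof -
      define cl where "cl = k * f + D1 * f * M + k * (f * D0)\<^sup>2 + c1"
      have "(f * D0)\<^sup>2 \<le> (2 * x powr \<delta> * x powr \<delta>)\<^sup>2"
        unfolding D0_def using fup f1 by (intro power_mono mult_right_mono) auto
      also have "\<dots> = 4 * x powr (4 * \<delta>)" by (simp add: power2_eq_square xp)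
      finally have b1: "k * (f * D0)\<^sup>2 \<le> k * (4 * x powr (4 * \<delta>))" by (intro mult_left_mono) auto
      have "D1 * f * M \<le> D1 * (2 * x powr \<delta>) * M" using fup D1 M0 by (intro mult_right_mono mult_left_mono) auto
      also have "\<dots> = k * (k * (2 * C * (x powr (- 4 * \<delta>) * x powr \<delta>)))" by (simp add: D1_def M_def)
      also have "x powr (- 4 * \<delta>) * x powr \<delta> = x powr (- 3 * \<delta>)" unfolding xp by simp
      finally have b2: "D1 * f * M \<le> k * (k * (2 * C * x powr (- 3 * \<delta>)))" .
      have b3: "k * f \<le> k * (2 * x powr \<delta>)" using fup by (intro mult_left_mono) auto
      have cl: "cl \<le> k * ((2 * x powr \<delta> + 4 * x powr (4 * \<delta>)) + k * (2 * C * x powr (- 3 * \<delta>) + x powr (- \<delta> / 2)))"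
        using b1 b2 b3 unfolding cl_def c1_def power2_eq_square[of "real k"] by (simp add: algebra_simps)
      have cl0: "0 \<le> cl" unfolding cl_def c1_def using f1 D1 M0 by (intro add_nonneg_nonneg mult_nonneg_nonneg) auto
      have qq2: "q / (1 - q) \<le> 2 * q"
      proof -
        have "q / (1 - q) \<le> q / (1 / 2)" using q12 q0 by (intro divide_left_mono) auto
        thus ?thesis by simp
      qed
      have "q / (1 - q) * Z3 * (4 * cl) \<le> 2 * q * Z3 * (4 * (k * ((2 * x powr \<delta> + 4 * x powr (4 * \<delta>)) + k * (2 * C * x powr (- 3 * \<delta>) + x powr (- \<delta> / 2)))))"
        using qq2 cl cl0 q0 by (intro mult_mono) (auto simp: Z3_def)
      also have "\<dots> = k * (8 * Z3 * (q * (2 * x powr \<delta> + 4 * x powr (4 * \<delta>)) + (q * k) * (2 * C * x powr (- 3 * \<delta>) + x powr (- \<delta> / 2))))"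
        by (simp add: algebra_simps)
      also have "\<dots> \<le> k * (8 * Z3 * (q * (2 * x powr \<delta> + 4 * x powr (4 * \<delta>)) + L * (2 * C * x powr (- 3 * \<delta>) + x powr (- \<delta> / 2))))"
        using qkL C0 by (intro mult_left_mono add_left_mono mult_right_mono) (auto simp: Z3_def)
      also have "\<dots> \<le> real k * 1" using R(7) unfolding Z3_def by (intro mult_left_mono) auto
      finally have ex: "q / (1 - q) * Z3 * (4 * cl) \<le> k" by simp
      have "Z3 powr (- t1) = x powr (\<delta> / 8 * (- t1))" by (simp add: Z3_def powr_powr)
      also have "\<delta> / 8 * (- t1) = - 4 * k" using delta by (simp add: t1_def K_def)
      also have "x powr (- 4 * k) = exp (- 4 * (k * L))" using x0 by (simp add: powr_def L_def)
      finally have Z: "Z3 powr (- t1) = exp (- 4 * (k * L))" .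
      have kk: "real k \<le> k * L" using mult_left_mono[of 1 L "real k"] L3 by simp
      have "(n choose k) * (Z3 powr (- t1) * exp (q / (1 - q) * Z3 * (4 * cl))) \<le> exp (k * L) * (exp (- 4 * (k * L)) * exp (k * L))"
        unfolding Z using binom1 ex kk by (intro mult_mono) auto
      also have "\<dots> = exp (- 2 * (k * L))" by (simp add: exp_add[symmetric])
      also have "\<dots> \<le> exp (- 4)" using kL by (simp add: mult.commute[of L])
      finally show ?thesis using exp4 by (simp add: cl_def)
    qed
    \<comment> \<open>The only tight estimate: the \<open>k * l\<close> from the binomial
      coefficient cancels against \<open>Mx\<close> up to the gain
      \<open>k * l * (\<epsilon>\<^sup>2 / 64)\<close>. All other factors are exponentials of
      multiples of \<open>k\<close>, including the choice of \<open>H\<close>, since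
      \<open>h * ln (2 * N) \<le> k\<close>.\<close>
    have opn: "(n choose k) * (z powr (- 5 * t1) * Mx * ((2 * N) powr h * exp (1 + k)) * 4 ^ k) \<le> 1 / 8"
    proof -
      have b: "real (n choose k) \<le> exp (k + k * l)"
      proof -
        have "x / k \<le> x / sqrt x" using kx sqx x0 k1 by (intro divide_left_mono) auto
        also have "\<dots> = sqrt x" using x0 by (simp add: real_div_sqrt)
        also have "\<dots> = exp l" using x0 by (simp add: l_def L_def powr_half_sqrt[symmetric] powr_def)
        finally have "(x / k) ^ k \<le> exp l ^ k" using x0 by (intro power_mono) auto
        hence "exp k * (x / k) ^ k \<le> exp k * exp (k * l)"
          unfolding exp_of_nat_mult by (intro mult_left_mono) auto
        thus ?thesis using binomial_le_exp[OF k0, of n] unfolding x_def[symmetric] exp_add by linarith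
      qed
      have hh: "h * ln (2 * N) \<le> k"
      proof -
        have "h * ln (2 * N) \<le> (4 * C * x powr (5 * \<delta>)) * ln (4 * x)"
          using hup h0 N1 Nx x16 y1 Nlo by (intro mult_mono) auto
        also have "\<dots> \<le> sqrt x" by (rule R(8))
        finally show ?thesis using kx by linarith
      qed
      have "z powr (- 5 * t1) = exp (5 * K * k * ln (1 / z))" using z0 by (simp add: powr_def t1_def ln_div)
      moreover have "(2 * real N) powr h = exp (h * ln (2 * N))" using N1 by (simp add: powr_def)
      moreover have "(4 :: real) ^ k \<le> exp (k * 2)"
      proof -
        have "(2 :: real) ^ 2 \<le> exp 1 ^ 2" using exp_ge_add_one_self[of 1] by (intro power_mono) auto
        also have "exp 1 ^ 2 = (exp 2 :: real)" by (simp add: exp_of_nat_mult[symmetric])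
        finally have "(4 :: real) ^ k \<le> exp 2 ^ k" by (intro power_mono) auto
        thus ?thesis by (simp add: exp_of_nat_mult[symmetric])
      qed
      ultimately have "z powr (- 5 * t1) * Mx * ((2 * N) powr h * exp (1 + k)) * 4 ^ k
        \<le> exp (5 * K * k * ln (1 / z)) * Mx * (exp (h * ln (2 * N)) * exp (1 + k)) * exp (k * 2)"
        by (intro mult_mono) (auto simp: Mx_def)
      hence "(n choose k) * (z powr (- 5 * t1) * Mx * ((2 * N) powr h * exp (1 + k)) * 4 ^ k)
        \<le> exp (k + k * l) * (exp (5 * K * k * ln (1 / z)) * Mx * (exp (h * ln (2 * N)) * exp (1 + k)) * exp (k * 2))"
        by (rule mult_mono[OF b]) (auto simp: Mx_def)
      also have "\<dots> = exp (k + k * l + 5 * K * k * ln (1 / z) - k * l * (1 + \<epsilon>\<^sup>2 / 64) + h * ln (2 * N) + (1 + k) + k * 2)"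
        unfolding Mx_def mult_exp_exp by (rule arg_cong[of _ _ exp]) simp
      also have "\<dots> \<le> exp (- 4)"
      proof -
        have "14 + 5 * K * ln (1 / z) \<le> L * (\<epsilon>\<^sup>2 / 128)" using LG ee by (simp add: field_simps)
        hence "k * (14 + 5 * K * ln (1 / z)) \<le> k * (L * (\<epsilon>\<^sup>2 / 128))" by (intro mult_left_mono) auto
        also have "\<dots> = k * l * (\<epsilon>\<^sup>2 / 64)" by (simp add: l_def)
        finally have "14 * k + 5 * K * k * ln (1 / z) \<le> k * l * (\<epsilon>\<^sup>2 / 64)" by (simp add: algebra_simps)
        moreover have "k * l * (1 + \<epsilon>\<^sup>2 / 64) = k * l + k * l * (\<epsilon>\<^sup>2 / 64)" by (simp add: algebra_simps)
        ultimately show ?thesis using hh k1 by simp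
      qed
      finally show ?thesis using exp4 by simp
    qed
    have key: "exp (- (q * (1 - z) * (real (card (two_bites.open_pairs p I H A)) - card A)))
        \<le> Mx * (\<Prod>c\<in>UNIV. (N / k) ^ (k - card (p c ` I))) * (1 / (q * h)) ^ card A"
      if tb: "two_bites N k p I f d1 D0 D1 M h" and adm: "two_bites.admissible N \<kappa> p I f d1 (f * d1) M h H A"
      for p I H A
    proof -
      interpret two_bites N k \<kappa> p I f d1 "f * d1" D0 D1 M c1 t1 h by (rule tb)
      define B where "B = (1 - z) * q * k / l"
      have l0: "0 < l" using L3 by (simp add: l_def)
      have Blo: "1 + \<epsilon> / 2 \<le> B"
      proof -
        have "(1 - z) * ((1 + \<epsilon>) * L / 2) \<le> (1 - z) * (q * k)" using qklo z0 by (intro mult_left_mono) auto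
        hence "(1 - z) * (1 + \<epsilon>) \<le> B" using l0 by (simp add: B_def l_def field_simps)
        moreover have "1 + \<epsilon> / 2 \<le> (1 - z) * (1 + \<epsilon>)"
        proof -
          have "\<epsilon> * \<epsilon> \<le> \<epsilon> * 1" using e by (intro mult_left_mono) auto
          moreover have "(1 - z) * (1 + \<epsilon>) = 1 + 3 * \<epsilon> / 4 - \<epsilon> * \<epsilon> / 4" by (simp add: z_def field_simps)
          ultimately show ?thesis by simp
        qed
        ultimately show ?thesis by simp
      qed
      have Bup: "B \<le> 2"
      proof -
        have "(1 - z) * (q * k) \<le> 1 * L" using qkL z0 q0 by (intro mult_mono) auto
        thus ?thesis using l0 by (simp add: B_def l_def field_simps)
      qed
      \<comment> \<open>Here the density is critical: \<open>q\<^sup>2 * x / l\<close> is exactly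
        \<open>1 / 2\<close>, so the largest links reach the allowed half of \<open>k\<close> up to
        the factor \<open>(1 - z) * (1 + e1)\<^sup>2\<close>.\<close>
      have Bg: "B * (f * d1) \<le> k / 2"
      proof -
        have "f * d1 = (1 + e1)\<^sup>2 * x * q" using N1 by (simp add: f_def d1_def power2_eq_square)
        hence "B * (f * d1) = (1 - z) * (1 + e1)\<^sup>2 * k * (q\<^sup>2 * x / l)"
          by (simp add: B_def power2_eq_square)
        also have "q\<^sup>2 * x / l = 1 / 2" unfolding qq l_def using x0 L3 by simp
        also have "(1 - z) * (1 + e1)\<^sup>2 * k * (1 / 2) \<le> 1 * real k * (1 / 2)"
        proof (intro mult_right_mono)
          have "(1 - z) * (1 + e1)\<^sup>2 = 1 - 3 * \<epsilon>\<^sup>2 / 64 - \<epsilon> ^ 3 / 256"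
            by (simp add: z_def e1_def power2_eq_square power3_eq_cube field_simps)
          moreover have "0 \<le> \<epsilon> ^ 3" using e by simp
          ultimately show "(1 - z) * (1 + e1)\<^sup>2 \<le> 1" using ee by linarith
        qed auto
        finally show ?thesis by simp
      qed
      have lnN: "(1 - \<eta>) * l \<le> ln (N / k)"
      proof -
        have "y / (3 * s) \<le> N / k" using Nlo k3 k1 y1 by (intro frac_le) auto
        hence "x powr ((1 - \<eta>) / 2) \<le> N / k" unfolding eta_delta using R(10) by (simp add: s_def)
        hence "ln (x powr ((1 - \<eta>) / 2)) \<le> ln (N / k)" using x0 by (intro ln_mono) auto
        thus ?thesis using x0 by (simp add: l_def L_def ln_powr)
      qed
      have lnq: "(1 - \<eta>) * l \<le> ln (1 / (q * h)) - q * (1 - z)"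
      proof -
        have "1 / (q * (4 * C * x powr (5 * \<delta>))) \<le> 1 / (q * h)"
          using hup h0 q0 C0 x0 by (intro divide_left_mono mult_left_mono) auto
        hence "exp 1 * x powr ((1 - \<eta>) / 2) \<le> 1 / (q * h)" unfolding eta_delta using R(11) by linarith
        hence "ln (exp 1 * x powr ((1 - \<eta>) / 2)) \<le> ln (1 / (q * h))" using x0 by (intro ln_mono) auto
        hence "1 + (1 - \<eta>) * l \<le> ln (1 / (q * h))" using x0 by (simp add: l_def L_def ln_powr ln_mult)
        moreover have "q * (1 - z) \<le> 1 * 1" using q12 z0 q0 by (intro mult_mono) auto
        ultimately show ?thesis by simp
      qed
      have err: "q * (1 - z) / 2 * (k + d1 * M) \<le> \<eta> * (k * l)"
      proof -
        have d0: "0 \<le> d1 * M" using M0 e1 q0 by (simp add: d1_def)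
        have "q * (1 - z) / 2 * (k + d1 * M) \<le> q * 1 / 2 * (k + d1 * M)"
          using z0 q0 d0 by (intro mult_right_mono divide_right_mono mult_left_mono) auto
        also have "\<dots> = k * (q / 2 + (1 + e1) / 2 * C * (N * q\<^sup>2))"
          by (simp add: d1_def M_def power2_eq_square algebra_simps)
        also have "\<dots> \<le> k * (1 + 1 * C * (x powr (- \<delta> / 2)))"
        proof (intro mult_left_mono add_mono mult_mono)
          show "N * q\<^sup>2 \<le> x powr (- \<delta> / 2)" using Nqq powr_ge_zero[of x "- \<delta> / 2"] by linarith
        qed (use q12 e1 C0 in auto)
        also have "\<dots> \<le> k * (\<eta> * L / 2)" using R(12) by (intro mult_left_mono) auto
        finally show ?thesis by (simp add: l_def mult_ac)
      qed
      have hk1: "h \<le> \<eta> * k"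
      proof -
        have "\<eta> * sqrt x \<le> \<eta> * k" using kx eta by (intro mult_left_mono) auto
        thus ?thesis using hup R(13) by linarith
      qed
      have hk2: "h\<^sup>2 * (\<kappa> * f) \<le> \<eta> * k"
      proof -
        have "h\<^sup>2 * (\<kappa> * f) \<le> (4 * C * x powr (5 * \<delta>))\<^sup>2 * (\<kappa> * (2 * x powr \<delta>))"
          using hup h0 fup f1 by (intro mult_mono power_mono mult_left_mono) auto
        also have "\<dots> = 32 * C\<^sup>2 * \<kappa> * (x powr (5 * \<delta>) * x powr (5 * \<delta>) * x powr \<delta>)"
          by (simp add: power2_eq_square)
        also have "\<dots> = 32 * C\<^sup>2 * \<kappa> * x powr (11 * \<delta>)" unfolding xp by simp
        also have "\<dots> \<le> \<eta> * sqrt x" by (rule R(14))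
        also have "\<dots> \<le> \<eta> * k" using kx eta by (intro mult_left_mono) auto
        finally show ?thesis .
      qed
      show ?thesis
        using admissible_exponent_bound[OF adm k0 N0 e \<eta>_def q0 z0(2) l0 h0 B_def Blo Bup Bg lnN lnq err hk1 hk2]
        unfolding Mx_def R_def .
    qed
    have "\<exists>p E. E \<subseteq> cpairs N \<and> (\<forall>I\<subseteq>{..<n}. card I = k \<longrightarrow>
      (\<exists>c. \<exists>\<tau>\<in>nsets I 2. (c, p c ` \<tau>) \<in> E \<and> \<not> (\<exists>c' v. \<forall>x\<in>\<tau>. (c', {p c' x, v}) \<in> E)))"
    proof (rule exists_construction[where f = f and ?d1.0 = d1 and ?D0.0 = D0 and ?D1.0 = D1 and M = M and ?c1.0 = c1
          and ?t1.0 = t1 and h = h and z = z and ?Z1.0 = Z1 and ?Z2.0 = Z2 and ?Z3.0 = Z3 and Mx = Mx and \<kappa> = \<kappa> and q = q and N = N])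
      show "1 \<le> Z1" "1 \<le> Z2" "1 \<le> Z3" using e1 x16 delta by (auto simp: Z1_def Z2_def Z3_def intro!: ge_one_powr_ge_zero)
      show "0 \<le> d1" "0 \<le> Mx" using e1 q0 by (auto simp: d1_def Mx_def)
      show "h = 2 * M * f / D1" by (rule h_def)
    qed (use N0 k0 q0 q1 f1 M0 D0 fD D1 h0 z0 fib deg codeg dns1 dns2 chr cls opn key in auto)
    thus ?case unfolding k_def s_def L_def x_def by blast
  qed
qed

theorem theorem1p3:
  fixes \<epsilon> :: real
  assumes "\<epsilon> > 0"
  shows "\<exists>n\<^sub>0::nat. \<forall>n::nat. n \<ge> n\<^sub>0 \<longrightarrow>
    (\<exists>(V::nat set) (E::nat set set). simple_graph V E \<and> card V = n \<and> triangle_free V E \<and>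
      real (independence_number V E) < (1 + \<epsilon>) * sqrt (real n * ln (real n)))"
proof -
  \<comment> \<open>The exponent inequality needs \<open>\<epsilon>\<close> at most
    \<open>1 / 10\<close>; a smaller value only strengthens the conclusion.\<close>
  define \<epsilon>' where "\<epsilon>' = min \<epsilon> (1 / 10)"
  have e: "0 < \<epsilon>'" "\<epsilon>' \<le> 1 / 10" "\<epsilon>' \<le> \<epsilon>" using assms by (auto simp: \<epsilon>'_def)
  have "\<forall>\<^sub>F n in sequentially. \<exists>(V::nat set) (E::nat set set). simple_graph V E \<and> card V = n \<and> triangle_free V E \<and>
      real (independence_number V E) < (1 + \<epsilon>) * sqrt (real n * ln (real n))"
    using eventually_construction[OF e(1,2)] eventually_gt_at_top[of "1 :: nat"]
  proof eventually_elim
    case (elim n)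
    define K where "K = (1 + \<epsilon>') * sqrt (real n * ln (real n))"
    define k where "k = nat \<lceil>K\<rceil>"
    have K0: "0 < K" using elim(2) e by (simp add: K_def)
    obtain p E where pE: "\<And>I. I \<subseteq> {..<n} \<Longrightarrow> card I = k \<Longrightarrow>
      \<exists>c :: bool. \<exists>\<tau>\<in>nsets I 2. (c, (p c :: nat \<Rightarrow> nat) ` \<tau>) \<in> E \<and> \<not> (\<exists>c' v. \<forall>x\<in>\<tau>. (c', {p c' x, v}) \<in> E)"
      using elim(1) unfolding k_def K_def by blast
    define G where "G = {\<tau>\<in>nsets {..<n} 2. (\<exists>c. (c, p c ` \<tau>) \<in> E) \<and> \<not> (\<exists>c v. \<forall>x\<in>\<tau>. (c, {p c x, v}) \<in> E)}"
    have "card S < k" if S: "S \<subseteq> {..<n}" "indep S G" for S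
    proof (rule ccontr)
      assume "\<not> card S < k"
      hence "k \<le> card S" by simp
      then obtain I where I: "I \<subseteq> S" "card I = k" by (rule obtain_subset_with_card_n)
      hence "I \<subseteq> {..<n}" using S by auto
      from pE[OF this I(2)] obtain c \<tau> where \<tau>: "\<tau> \<in> nsets I 2" "(c, p c ` \<tau>) \<in> E"
        "\<not> (\<exists>c' v. \<forall>x\<in>\<tau>. (c', {p c' x, v}) \<in> E)" by blast
      have "\<tau> \<in> nsets {..<n} 2" using \<tau>(1) nsets_mono[OF \<open>I \<subseteq> {..<n}\<close>] by blast
      hence "\<tau> \<in> G" using \<tau> by (auto simp: G_def)
      moreover obtain a b where "\<tau> = {a, b}" "a \<noteq> b" "a \<in> I" "b \<in> I"
        using \<tau>(1) by (auto simp: nsets_def card_2_iff)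
      ultimately show False using S(2) I(1) by (auto simp: indep_def)
    qed
    moreover have "{} \<subseteq> {..<n} \<and> indep {} G" by simp
    ultimately have "independence_number {..<n} G < k"
      unfolding independence_number_def by (subst Max_less_iff) (auto intro: finite_subset[of _ "Pow {..<n}"])
    \<comment> \<open>An integer below the ceiling of \<open>K\<close> is strictly below
      \<open>K\<close>, so rounding \<open>k\<close> up costs nothing.\<close>
    hence "real (independence_number {..<n} G) < K" unfolding k_def using K0 by linarith
    also have "K \<le> (1 + \<epsilon>) * sqrt (real n * ln (real n))"
      unfolding K_def using e elim(2) by (intro mult_right_mono) auto
    finally have "real (independence_number {..<n} G) < (1 + \<epsilon>) * sqrt (real n * ln (real n))" .
    moreover have "simple_graph {..<n} G" by (auto simp: simple_graph_def G_def)
    moreover have "triangle_free {..<n} G" unfolding G_def by (rule triangle_free_two_colour)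
    ultimately show ?case by (intro exI[of _ "{..<n}"] exI[of _ G]) simp
  qed
  thus ?thesis unfolding eventually_sequentially by blast
qed

end
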